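(* For any integers $N>n\ge 1$ there exists a non-zero shift-invariant differential-algebraic operator $D=D(n,N)$ (depending only on $n$ and $N$), acting on analytic functions of $2n+1$ variables $(z,a,u)\in\mathbb{C}^n\times\mathbb{C}^n\times\mathbb{C}$, such that the following holds. If $M\subset\mathbb{C}^{n+1}$ is a (connected) real-analytic hypersurface with a defining equation $$v=\varphi(z,\overline z,u),\qquad (z,w)=(z,u+iv)\in\mathbb{C}^n\times\mathbb{C},$$ which contains at least one Levi-nondegenerate point and which admits, near some point $p_0\in M$, a local transverse holomorphic embedding into a hyperquadric $\mathcal{Q}^{2N+1}\subset\mathbb{C}^{N+1}$, then $$D(\varphi)\equiv 0 .$$
   Context: Differential-algebraic operator: let $r,l\ge1$ be integers and let $P$ be a polynomial on the jet space $J^l(\mathbb{C}^r,\mathbb{C})$. It defines the operator $\mathcal{D}(\rho):=P(j^l\rho)$ acting on analytic functions $\rho:U\to\mathbb{C}$, $U\subset\mathbb{C}^r$ a domain; $l$ is its order. It is non-zero if it is not identically zero as an operator (equivalently $P\ne0$). It is shift-invariant if $\mathcal{D}(\rho)$ does not depend explicitly on the independent variables nor on $\rho$ itself, i.e. it depends only on derivatives of $\rho$ of order at least $1$. Here $r=2n+1$, and $D$ is applied to the real-analytic function $\varphi(z,\overline z,u)$ by treating $z$, $a=\overline z$, $u$ as independent variables. Hyperquadric: $\mathcal{Q}^{2N+1}\subset\mathbb{C}^{N+1}$ denotes any nondegenerate real hyperquadric $\operatorname{Im}W=-\sum_{j=1}^{l}|Z_j|^2+\sum_{j=l+1}^{N}|Z_j|^2$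 with $0\le l\le N$ (any signature), $(Z_1,\dots,Z_N,W)$ being coordinates in $\mathbb{C}^{N+1}$. Local transverse holomorphic embedding near $p_0$: a holomorphic embedding $F:U\to\mathbb{C}^{N+1}$ of an open neighborhood $U$ of $p_0$ in $\mathbb{C}^{n+1}$ with $F(M\cap U)\subset\mathcal{Q}^{2N+1}$ that is transversal to $\mathcal{Q}^{2N+1}$ at $F(p_0)$: $T_{F(p_0)}\mathcal{Q}^{2N+1}+dF(T_{p_0}\mathbb{C}^{n+1})=T_{F(p_0)}\mathbb{C}^{N+1}$ (real tangent spaces). *)

theory Defs
  imports "HOL-Complex_Analysis.Complex_Analysis" "HOL-Library.Poly_Mapping"
begin

text \<open>
  The space \<open>\<complex>\<^sup>r\<close> is \<open>complex ^ 'r\<close> with \<open>r = CARD('r)\<close>. A type \<open>'k option\<close> adds one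
  coordinate:
  \<^item> \<open>(z, w) \<in> \<complex>\<^sup>n\<^sup>+\<^sup>1\<close> is a vector \<open>p :: complex ^ ('n option)\<close>, with \<open>z\<^sub>j = p $ Some j\<close>
    and \<open>w = p $ None\<close>; likewise for \<open>(Z, W) \<in> \<complex>\<^sup>N\<^sup>+\<^sup>1\<close>;
  \<^item> \<open>(z, a, u) \<in> \<complex>\<^sup>2\<^sup>n\<^sup>+\<^sup>1\<close> is a vector \<open>x :: complex ^ (('n + 'n) option)\<close>, with
    \<open>z\<^sub>j = x $ Some (Inl j)\<close>, \<open>a\<^sub>j = x $ Some (Inr j)\<close> and \<open>u = x $ None\<close>.
\<close>

definition holomorphic_fun_on :: "(complex ^ 'r \<Rightarrow> complex) \<Rightarrow> (complex ^ 'r::finite) set \<Rightarrow> bool" where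
  "holomorphic_fun_on f U \<longleftrightarrow>
     (\<forall>x\<in>U. \<exists>f'. (f has_derivative f') (at x) \<and> (\<forall>c v. f' (c *s v) = c * f' v))"

definition holomorphic_map_on ::
    "(complex ^ 'r \<Rightarrow> complex ^ 's) \<Rightarrow> (complex ^ 'r::finite) set \<Rightarrow> bool" where
  "holomorphic_map_on F U \<longleftrightarrow> (\<forall>i. holomorphic_fun_on (\<lambda>x. F x $ i) U)"

definition holomorphic_embedding_on ::
    "(complex ^ 'r \<Rightarrow> complex ^ 's) \<Rightarrow> (complex ^ 'r::finite) set \<Rightarrow> bool" where
  "holomorphic_embedding_on F U \<longleftrightarrow>
     holomorphic_map_on F U \<and>
     (\<forall>x\<in>U. inj (frechet_derivative F (at x))) \<and>
     (\<exists>G. homeomorphism U (F ` U) F G)"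

definition cpartial :: "'r \<Rightarrow> (complex ^ 'r \<Rightarrow> complex) \<Rightarrow> complex ^ 'r::finite \<Rightarrow> complex" where
  "cpartial i f x = deriv (\<lambda>t. f (x + axis i t)) 0"

text \<open>
  The partial derivatives of a holomorphic function commute, so for such functions the
  enumeration of the variables chosen below is immaterial.
\<close>

definition mixed_partial :: "('r \<Rightarrow> nat) \<Rightarrow> (complex ^ 'r \<Rightarrow> complex) \<Rightarrow> complex ^ 'r::finite \<Rightarrow> complex" where
  "mixed_partial \<alpha> f =
     fold (\<lambda>i. cpartial i ^^ \<alpha> i) (SOME is. distinct is \<and> set is = (UNIV :: 'r set)) f"

text \<open>
  Coordinates on the jet spaces of functions on \<open>\<complex>\<^sup>r\<close>: the independent variables, and one
  coordinate \<open>Jet \<alpha>\<close> for the derivative with multi-index \<open>\<alpha>\<close> (\<open>Jet (\<lambda>_. 0)\<close> is the value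
  of the function itself). A polynomial in them is an element of the monoid algebra
  \<open>('r jet_coord \<Rightarrow>\<^sub>0 nat) \<Rightarrow>\<^sub>0 complex\<close>.
\<close>

datatype 'r jet_coord = Indep 'r | Jet "'r \<Rightarrow> nat"

type_synonym 'r jet_poly = "('r jet_coord \<Rightarrow>\<^sub>0 nat) \<Rightarrow>\<^sub>0 complex"

definition jet_order :: "('r::finite \<Rightarrow> nat) \<Rightarrow> nat" where
  "jet_order \<alpha> = (\<Sum>i\<in>UNIV. \<alpha> i)"

definition jet_poly_coords :: "'r jet_poly \<Rightarrow> 'r jet_coord set" where
  "jet_poly_coords P = (\<Union>m\<in>Poly_Mapping.keys P. Poly_Mapping.keys m)"

definition jet_poly_of_order :: "nat \<Rightarrow> 'r::finite jet_poly \<Rightarrow> bool" where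
  "jet_poly_of_order l P \<longleftrightarrow> (\<forall>\<alpha>. Jet \<alpha> \<in> jet_poly_coords P \<longrightarrow> jet_order \<alpha> \<le> l)"

fun jet_coord_value :: "(complex ^ 'r \<Rightarrow> complex) \<Rightarrow> complex ^ 'r \<Rightarrow> 'r::finite jet_coord \<Rightarrow> complex" where
  "jet_coord_value \<rho> x (Indep i) = x $ i"
| "jet_coord_value \<rho> x (Jet \<alpha>) = mixed_partial \<alpha> \<rho> x"

definition diff_alg_op ::
    "'r::finite jet_poly \<Rightarrow> (complex ^ 'r \<Rightarrow> complex) \<Rightarrow> complex ^ 'r \<Rightarrow> complex" where
  "diff_alg_op P \<rho> x =
     (\<Sum>m\<in>Poly_Mapping.keys P. Poly_Mapping.lookup P m *
        (\<Prod>c\<in>Poly_Mapping.keys m. jet_coord_value \<rho> x c ^ Poly_Mapping.lookup m c))"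

definition nonzero_op :: "'r::finite jet_poly \<Rightarrow> bool" where
  "nonzero_op P \<longleftrightarrow>
     (\<exists>U \<rho>. open U \<and> connected U \<and> holomorphic_fun_on \<rho> U \<and> (\<exists>x\<in>U. diff_alg_op P \<rho> x \<noteq> 0))"

definition shift_invariant :: "'r::finite jet_poly \<Rightarrow> bool" where
  "shift_invariant P \<longleftrightarrow> jet_poly_coords P \<subseteq> {Jet \<alpha> |\<alpha>. jet_order \<alpha> \<ge> 1}"

definition real_analytic_on ::
    "((complex ^ 'n::finite) \<times> real \<Rightarrow> real) \<Rightarrow> ((complex ^ 'n) \<times> real) set \<Rightarrow> bool" where
  "real_analytic_on \<phi> V \<longleftrightarrow>
     (\<forall>(z0, u0)\<in>V. \<exists>(c :: ('n \<Rightarrow> nat) \<Rightarrow> ('n \<Rightarrow> nat) \<Rightarrow> nat \<Rightarrow> complex). \<exists>e>0.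
        \<forall>(z, u)\<in>ball (z0, u0) e.
          ((\<lambda>(\<alpha>, \<beta>, k). c \<alpha> \<beta> k
               * (\<Prod>j\<in>UNIV. (z $ j - z0 $ j) ^ \<alpha> j)
               * (\<Prod>j\<in>UNIV. cnj (z $ j - z0 $ j) ^ \<beta> j)
               * of_real (u - u0) ^ k)
            has_sum of_real (\<phi> (z, u))) UNIV)"

definition z_u_part :: "complex ^ ('n::finite option) \<Rightarrow> (complex ^ 'n) \<times> real" where
  "z_u_part p = ((\<chi> j. p $ Some j), Re (p $ None))"

definition graph_hypersurface ::
    "((complex ^ 'n::finite) \<times> real) set \<Rightarrow> ((complex ^ 'n) \<times> real \<Rightarrow> real) \<Rightarrow> (complex ^ ('n option)) set" where
  "graph_hypersurface V \<phi> = {p. z_u_part p \<in> V \<and> Im (p $ None) = \<phi> (z_u_part p)}"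

definition z_zbar_u :: "(complex ^ 'n::finite) \<times> real \<Rightarrow> complex ^ (('n + 'n) option)" where
  "z_zbar_u q = (\<chi> i. case i of
       None \<Rightarrow> of_real (snd q)
     | Some (Inl j) \<Rightarrow> fst q $ j
     | Some (Inr j) \<Rightarrow> cnj (fst q $ j))"

text \<open>
  A complexification of \<open>\<phi>\<close>: a holomorphic function \<open>\<Phi>(z, a, u)\<close> on some domain \<open>\<Omega>\<close> meeting the
  slice \<open>a = cnj z\<close>, \<open>u\<close> real, over \<open>V\<close>, and equal to \<open>\<phi>\<close> there. If \<open>\<phi>\<close> is real-analytic on \<open>V\<close>,
  substituting independent variables \<open>a\<close> for \<open>cnj z\<close> in its power series gives one near every point
  of \<open>V\<close>.
\<close>

definition complexification ::
    "((complex ^ 'n::finite) \<times> real) set \<Rightarrow> ((complex ^ 'n) \<times> real \<Rightarrow> real) \<Rightarrow>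
     (complex ^ (('n + 'n) option)) set \<Rightarrow> (complex ^ (('n + 'n) option) \<Rightarrow> complex) \<Rightarrow> bool" where
  "complexification V \<phi> \<Omega> \<Phi> \<longleftrightarrow>
     open \<Omega> \<and> connected \<Omega> \<and> holomorphic_fun_on \<Phi> \<Omega> \<and>
     (\<exists>q\<in>V. z_zbar_u q \<in> \<Omega>) \<and>
     (\<forall>q\<in>V. z_zbar_u q \<in> \<Omega> \<longrightarrow> \<Phi> (z_zbar_u q) = of_real (\<phi> q))"

definition diff_alg_op_vanishes ::
    "(('n::finite + 'n) option) jet_poly \<Rightarrow> ((complex ^ 'n) \<times> real) set \<Rightarrow>
     ((complex ^ 'n) \<times> real \<Rightarrow> real) \<Rightarrow> bool" where
  "diff_alg_op_vanishes P V \<phi> \<longleftrightarrow>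
     (\<forall>\<Omega> \<Phi>. complexification V \<phi> \<Omega> \<Phi> \<longrightarrow> (\<forall>x\<in>\<Omega>. diff_alg_op P \<Phi> x = 0))"

definition wirtinger :: "'r \<Rightarrow> (complex ^ 'r \<Rightarrow> complex) \<Rightarrow> complex ^ 'r::finite \<Rightarrow> complex" where
  "wirtinger j f x =
     (frechet_derivative f (at x) (axis j 1) - \<i> * frechet_derivative f (at x) (axis j \<i>)) / 2"

definition wirtinger_bar :: "'r \<Rightarrow> (complex ^ 'r \<Rightarrow> complex) \<Rightarrow> complex ^ 'r::finite \<Rightarrow> complex" where
  "wirtinger_bar j f x =
     (frechet_derivative f (at x) (axis j 1) + \<i> * frechet_derivative f (at x) (axis j \<i>)) / 2"

text \<open>
  Here \<open>\<rho>\<close> is a real-valued defining function with nonzero differential at \<open>p\<close>; another such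
  function for the same hypersurface gives the same nondegeneracy condition.
\<close>

definition hol_tangent_space :: "(complex ^ 'r \<Rightarrow> complex) \<Rightarrow> complex ^ 'r::finite \<Rightarrow> (complex ^ 'r) set" where
  "hol_tangent_space \<rho> p = {X. (\<Sum>j\<in>UNIV. wirtinger j \<rho> p * X $ j) = 0}"

definition levi_form ::
    "(complex ^ 'r \<Rightarrow> complex) \<Rightarrow> complex ^ 'r::finite \<Rightarrow> complex ^ 'r \<Rightarrow> complex ^ 'r \<Rightarrow> complex" where
  "levi_form \<rho> p X Y =
     (\<Sum>j\<in>UNIV. \<Sum>k\<in>UNIV. wirtinger j (wirtinger_bar k \<rho>) p * X $ j * cnj (Y $ k))"

definition levi_nondegenerate_at :: "(complex ^ 'r \<Rightarrow> complex) \<Rightarrow> complex ^ 'r::finite \<Rightarrow> bool" where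
  "levi_nondegenerate_at \<rho> p \<longleftrightarrow>
     (\<forall>X\<in>hol_tangent_space \<rho> p.
        (\<forall>Y\<in>hol_tangent_space \<rho> p. levi_form \<rho> p X Y = 0) \<longrightarrow> X = 0)"

definition graph_defining_fun ::
    "((complex ^ 'n::finite) \<times> real \<Rightarrow> real) \<Rightarrow> complex ^ ('n option) \<Rightarrow> complex" where
  "graph_defining_fun \<phi> p = of_real (\<phi> (z_u_part p) - Im (p $ None))"

text \<open>\<open>S\<close> is the set of indices with negative sign; up to renumbering it is \<open>{1..l}\<close> with \<open>l = card S\<close>.\<close>

definition hyperquadric :: "'m::finite set \<Rightarrow> (complex ^ ('m option)) set" where
  "hyperquadric S = {q. Im (q $ None) =
      - (\<Sum>j\<in>S. (norm (q $ Some j))\<^sup>2) + (\<Sum>j\<in>- S. (norm (q $ Some j))\<^sup>2)}"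

text \<open>
  Velocities at \<open>q\<close> of curves in \<open>A\<close>; for a smooth real hypersurface this is the real tangent
  space.
\<close>

definition real_tangent_space :: "'e::real_normed_vector set \<Rightarrow> 'e \<Rightarrow> 'e set" where
  "real_tangent_space A q =
     {v. \<exists>\<gamma> :: real \<Rightarrow> 'e. \<exists>e>0. \<gamma> 0 = q \<and> (\<forall>t. \<bar>t\<bar> < e \<longrightarrow> \<gamma> t \<in> A) \<and>
           (\<gamma> has_vector_derivative v) (at 0)}"

definition transverse_at :: "('d::real_normed_vector \<Rightarrow> 'e::real_normed_vector) \<Rightarrow> 'e set \<Rightarrow> 'd \<Rightarrow> bool" where
  "transverse_at F A p \<longleftrightarrow>
     {v + w |v w. v \<in> real_tangent_space A (F p) \<and> w \<in> range (frechet_derivative F (at p))} = UNIV"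

definition local_transverse_embedding ::
    "(complex ^ ('n::finite option)) set \<Rightarrow> (complex ^ ('m::finite option)) set \<Rightarrow>
     complex ^ ('n option) \<Rightarrow> (complex ^ ('n option)) set \<Rightarrow>
     (complex ^ ('n option) \<Rightarrow> complex ^ ('m option)) \<Rightarrow> bool" where
  "local_transverse_embedding M Q p0 U F \<longleftrightarrow>
     open U \<and> p0 \<in> U \<and> holomorphic_embedding_on F U \<and> F ` (M \<inter> U) \<subseteq> Q \<and> transverse_at F Q p0"

end

theory Submission
  imports Defs
begin

text \<open>
  Near \<open>p\<^sub>0\<close> the complexified mapping equation reads
  \<open>g(z, w) - G(a, \<tau>) = 2\<i> \<Sum>\<^sub>j f\<^sub>j(z, w) h\<^sub>j(a, \<tau>)\<close> with \<open>w = u + \<i>\<Phi>\<close>, \<open>\<tau> = u - \<i>\<Phi>\<close>, where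
  \<open>(f, g)\<close> is the embedding and \<open>(h, G)\<close> its formal conjugate, the signs of the quadric being absorbed
  into \<open>h\<close>. Transversality says that the derivative \<open>\<Delta>\<close> of this equation in the direction of \<open>\<Phi>\<close> does
  not vanish, so every derivative of \<open>\<Phi>\<close> of order between \<open>1\<close> and \<open>k\<close> is a universal polynomial in
  \<open>1/\<Delta>\<close> and the jets of order at most \<open>k\<close> of the components. Differentiating only in \<open>z\<^sub>1, a\<^sub>1, u\<close>,
  there are about \<open>k\<^sup>3\<close> derivatives of \<open>\<Phi>\<close>, but only \<open>O(k\<^sup>2)\<close> jet variables, because each component
  is differentiated in only two of its variables. Hence the derivatives of \<open>\<Phi>\<close> satisfy a fixed nontrivial
  algebraic relation. It holds near \<open>p\<^sub>0\<close>, and the identity theorem carries it to every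
  complexification.
\<close>

text \<open>The operator must be fixed before hypersurface, embedding and signature are known, and
  this shapes the middle of the proof: each derivative of \<Phi> needs one polynomial valid for all
  mapping equations at once. So the existential over polynomials stands outside the quantifiers over
  equations, and derivatives are taken along all curves that such equations produce in parameter
  space. Treating 1/\<Delta> as one further parameter keeps the formulas polynomial under repeated
  differentiation. Dependence then comes from linear algebra: products of powers of the derivatives
  outnumber the monomials into which they can expand. That \<Delta> is nonzero at p0 is not
  immediate: transversality directly excludes only that all derivatives in (z, w) vanish, and the
  differentiated equation supplies the link. A second obstacle is that a complexification may lie
  far from p0 and is tied to \<phi> only along a totally real slice. The vanishing is therefore
  carried along the connected V through local complexifications, any two of which agree near a
  common slice point, and only then across the given domain.\<close>

no_notation fps_nth (infixl \<open>$\<close> 75)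

section \<open>Complex derivatives and lines\<close>

text \<open>The complex differential, assembled from coordinate derivatives so that it is complex
  linear by construction. Holomorphy becomes real differentiability with this particular derivative
  (\<open>holomorphic_fun_on_iff\<close>).\<close>

definition cderiv :: "(complex ^ 'r \<Rightarrow> complex) \<Rightarrow> complex ^ 'r::finite \<Rightarrow> complex ^ 'r \<Rightarrow> complex" where
  "cderiv f x v = (\<Sum>i\<in>UNIV. v $ i * cpartial i f x)"

lemma axis_zero [simp]: "axis i 0 = 0"
  by (simp add: vec_eq_iff axis_def)

lemma scaleC_axis: "t *s axis i (1::complex) = axis i t"
  by (simp add: vec_eq_iff axis_def)

lemma bounded_linear_scaleC_left: "bounded_linear (\<lambda>s::complex. s *s (v :: complex ^ 'r::finite))"
  unfolding linear_conv_bounded_linear[symmetric]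
  by (rule linearI) (simp_all add: vec_eq_iff algebra_simps)

lemma has_derivative_line:
  "((\<lambda>s::complex. x + s *s (v :: complex ^ 'r::finite)) has_derivative (\<lambda>s. s *s v)) (at t)"
  using has_derivative_add[OF has_derivative_const bounded_linear_imp_has_derivative[OF bounded_linear_scaleC_left]]
  by simp

lemma continuous_on_axis:
  assumes "continuous_on S g"
  shows "continuous_on S (\<lambda>p. axis i (g p :: complex) :: complex ^ 'r::finite)"
  using bounded_linear.continuous_on[OF bounded_linear_scaleC_left[of "axis i 1"] assms]
  by (simp add: scaleC_axis)

text \<open>Restriction to a complex line turns the derivative into a one-variable complex
  derivative; on the axes this is \<open>cpartial\<close>, and complex linearity extends the
  identification to every direction.\<close>

lemma holomorphic_fun_on_cderivI:
  assumes "(f has_derivative f') (at x)" "\<And>c v. f' (c *s v) = c * f' v"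
  shows "f' = cderiv f x" "((\<lambda>s. f (x + s *s v)) has_field_derivative f' v) (at 0)"
proof -
  have *: "((\<lambda>s. f (x + s *s v)) has_field_derivative f' v) (at 0)" for v
  proof -
    have "((\<lambda>s. f (x + s *s v)) has_derivative (\<lambda>s. f' (s *s v))) (at 0)"
      by (rule has_derivative_compose[OF has_derivative_line]) (use assms(1) in simp)
    then show ?thesis
      by (simp add: has_field_derivative_def assms(2) mult_commute_abs)
  qed
  then show "((\<lambda>s. f (x + s *s v)) has_field_derivative f' v) (at 0)" .
  have cp: "cpartial i f x = f' (axis i 1)" for i
    unfolding cpartial_def using DERIV_imp_deriv[OF *[of "axis i 1"]] by (simp add: scaleC_axis)
  interpret f': bounded_linear f' using assms(1) by (rule has_derivative_bounded_linear)
  show "f' = cderiv f x"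
  proof
    fix v
    have "f' v = f' (\<Sum>i\<in>UNIV. v $ i *s axis i 1)" by (simp only: basis_expansion)
    also have "\<dots> = cderiv f x v" by (simp add: f'.sum assms(2) cderiv_def cp)
    finally show "f' v = cderiv f x v" .
  qed
qed

lemma cderiv_scaleC: "cderiv f x (c *s v) = c * cderiv f x v"
  by (simp add: cderiv_def sum_distrib_left mult.assoc)

lemma cderiv_axis: "cderiv f x (axis i c) = c * cpartial i f x"
  by (simp add: cderiv_def axis_def if_distrib[of "\<lambda>y. y * _"] cong: if_cong)

lemma holomorphic_fun_on_iff:
  "holomorphic_fun_on f U \<longleftrightarrow> (\<forall>x\<in>U. (f has_derivative cderiv f x) (at x))"
  unfolding holomorphic_fun_on_def using holomorphic_fun_on_cderivI(1) cderiv_scaleC by metis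

lemma holomorphic_fun_on_imp_has_derivative:
  "holomorphic_fun_on f U \<Longrightarrow> x \<in> U \<Longrightarrow> (f has_derivative cderiv f x) (at x)"
  by (simp add: holomorphic_fun_on_iff)

lemma holomorphic_fun_on_subset: "holomorphic_fun_on f U \<Longrightarrow> V \<subseteq> U \<Longrightarrow> holomorphic_fun_on f V"
  by (auto simp: holomorphic_fun_on_def)

lemma holomorphic_fun_on_continuous: "holomorphic_fun_on f U \<Longrightarrow> continuous_on U f"
  by (meson continuous_at_imp_continuous_on has_derivative_continuous holomorphic_fun_on_def)

lemma has_field_derivative_line:
  assumes "holomorphic_fun_on f U" "x + t *s v \<in> U"
  shows "((\<lambda>s. f (x + s *s v)) has_field_derivative cderiv f (x + t *s v) v) (at t)"
proof -
  have "((\<lambda>s. f (x + s *s v)) has_derivative (\<lambda>s. cderiv f (x + t *s v) (s *s v))) (at t)"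
    by (rule has_derivative_compose[OF has_derivative_line holomorphic_fun_on_imp_has_derivative[OF assms]])
  then show ?thesis
    by (simp add: has_field_derivative_def cderiv_scaleC mult_commute_abs)
qed

lemma holomorphic_on_line:
  assumes "holomorphic_fun_on f U" "\<And>t. t \<in> T \<Longrightarrow> x + t *s v \<in> U"
  shows "(\<lambda>s. f (x + s *s v)) holomorphic_on T"
  by (rule holomorphic_onI) (metis assms field_differentiable_def field_differentiable_at_within has_field_derivative_line)

lemma has_field_derivative_axis:
  assumes "holomorphic_fun_on f U" "x \<in> U"
  shows "((\<lambda>t. f (x + axis i t)) has_field_derivative cpartial i f x) (at 0)"
  using has_field_derivative_line[of f U x 0 "axis i 1"] assms by (simp add: scaleC_axis cderiv_axis)

lemma has_derivative_compose_line:
  assumes "holomorphic_fun_on f U" "(g has_derivative (\<lambda>s. s *s w)) (at t)" "g t \<in> U"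
  shows "((\<lambda>s. f (g s)) has_field_derivative cderiv f (g t) w) (at t)"
proof -
  have "((\<lambda>s. f (g s)) has_derivative (\<lambda>s. cderiv f (g t) (s *s w))) (at t)"
    by (rule has_derivative_compose[OF assms(2) holomorphic_fun_on_imp_has_derivative[OF assms(1,3)]])
  then show ?thesis
    by (simp add: has_field_derivative_def cderiv_scaleC mult_commute_abs)
qed

section \<open>The partial derivatives of a holomorphic function\<close>

definition circ :: "real \<Rightarrow> real \<Rightarrow> complex" where
  "circ r t = of_real r * exp (2 * of_real pi * \<i> * of_real t)"

lemma continuous_on_circ: "continuous_on S (circ r)"
  unfolding circ_def by (intro continuous_intros)

lemma norm_circ: "norm (circ r t) = \<bar>r\<bar>"
  by (simp add: circ_def norm_mult)

lemma norm_scaleC: "norm (c *s (v :: complex ^ 'r::finite)) = norm c * norm v"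
  by (simp add: norm_vec_def L2_set_right_distrib norm_mult)

lemma norm_axis: "norm (axis i c :: complex ^ 'r::finite) = norm c"
  by (simp add: norm_vec_def L2_set_def axis_def if_distrib[of norm] if_distrib[of "\<lambda>y. y\<^sup>2"] cong: if_cong)

text \<open>Cauchy's formula for the first derivative, on a circle in the i-th coordinate. The
  velocity of the circle cancels 2 pi i and one factor of the squared denominator. Since r may stay
  fixed while x moves, regularity of \<open>cpartial i f\<close> reduces to integrals with a
  parameter.\<close>

lemma cpartial_integral:
  assumes "holomorphic_fun_on f U" "cball x r \<subseteq> U" "r > 0"
  shows "cpartial i f x = integral (cbox 0 1) (\<lambda>t. f (x + axis i (circ r t)) / circ r t)"
proof -
  let ?g = "\<lambda>s. f (x + axis i s)"
  have sub: "x + axis i s \<in> U" if "s \<in> cball 0 r" for s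
    using that assms(2) by (auto simp: subset_iff dist_norm norm_axis)
  have hol: "?g holomorphic_on cball 0 r"
    using holomorphic_on_line[OF assms(1), of "cball 0 r" x "axis i 1"] sub by (simp add: scaleC_axis)
  have "contour_integral (circlepath 0 r) (\<lambda>u. ?g u/(u-0)^2) = (2 * pi * \<i>) * deriv ?g 0"
    by (rule Cauchy_contour_integral_circlepath_2)
       (use hol assms(3) in \<open>auto intro: holomorphic_on_imp_continuous_on holomorphic_on_subset\<close>)
  moreover have "contour_integral (circlepath 0 r) (\<lambda>u. ?g u/(u-0)^2)
      = integral {0..1} (\<lambda>t. (2 * pi * \<i>) * (?g (circ r t) / circ r t))"
    unfolding contour_integral_integral
    by (rule integral_cong, simp only: vector_derivative_circlepath)
       (simp add: circlepath circ_def field_simps power2_eq_square)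
  ultimately have "(2 * pi * \<i>) * deriv ?g 0 = (2 * pi * \<i>) * integral {0..1} (\<lambda>t. ?g (circ r t) / circ r t)"
    by (simp only: integral_mult_right)
  then show ?thesis
    by (simp add: cpartial_def)
qed

text \<open>One radius serves all centres near x, as differentiating the Cauchy integral in its
  centre requires.\<close>

lemma open_contains_cballs:
  assumes "open U" "x \<in> U"
  obtains r where "r > 0" "cball x r \<subseteq> U" "\<And>y. y \<in> ball x r \<Longrightarrow> cball y r \<subseteq> U"
proof -
  obtain e where e: "e > 0" "cball x e \<subseteq> U" using assms open_contains_cball by metis
  have "cball y (e/2) \<subseteq> U" if "y \<in> ball x (e/2)" for y
  proof
    fix z assume "z \<in> cball y (e/2)"
    then show "z \<in> U" using e that dist_triangle[of x z y] by (auto simp: subset_iff)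
  qed
  then show ?thesis using that[of "e/2"] e by (auto simp: subset_iff)
qed

lemma continuous_on_circ_slice:
  fixes f :: "complex ^ 'r::finite \<Rightarrow> complex"
  assumes "continuous_on U f" "\<And>y. y \<in> S \<Longrightarrow> cball y r \<subseteq> U" "r > 0"
  shows "continuous_on (S \<times> T) (\<lambda>(y, t). f (y + axis i (circ r t)) / circ r t)"
proof -
  have "continuous_on (S \<times> T) (\<lambda>p. fst p + axis i (circ r (snd p)))"
    by (intro continuous_intros continuous_on_axis continuous_on_compose2[OF continuous_on_circ]) auto
  moreover have "y + axis i (circ r t) \<in> U" if "y \<in> S" for y t
    using assms(2)[OF that] assms(3) by (auto simp: subset_iff dist_norm norm_axis norm_circ)
  ultimately have "continuous_on (S \<times> T) (\<lambda>p. f (fst p + axis i (circ r (snd p))))"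
    by (intro continuous_on_compose2[OF assms(1)]) auto
  moreover have "circ r t \<noteq> 0" for t using norm_circ[of r t] assms(3) by auto
  ultimately show ?thesis
    unfolding case_prod_beta
    by (intro continuous_on_divide continuous_on_compose2[OF continuous_on_circ continuous_on_snd]) auto
qed

lemma continuous_on_cpartial:
  assumes f: "holomorphic_fun_on f U" and U: "open U"
  shows "continuous_on U (cpartial i f)"
  unfolding continuous_on_eq_continuous_at[OF U]
proof
  fix x assume "x \<in> U"
  then obtain r where r: "r > 0" "cball x r \<subseteq> U" "\<And>y. y \<in> ball x r \<Longrightarrow> cball y r \<subseteq> U"
    using open_contains_cballs[OF U] by metis
  have "continuous_on (ball x r) (\<lambda>y. integral (cbox 0 1) (\<lambda>t. f (y + axis i (circ r t)) / circ r t))"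
    by (rule integral_continuous_on_param[OF continuous_on_circ_slice[OF holomorphic_fun_on_continuous[OF f]]]) (use r in auto)
  then have "continuous_on (ball x r) (cpartial i f)"
    by (rule continuous_on_eq) (use r in \<open>simp add: cpartial_integral[OF f, of _ r]\<close>)
  then show "isCont (cpartial i f) x"
    using r by (simp add: continuous_on_eq_continuous_at)
qed

text \<open>Differentiation under the Cauchy integral shows that \<open>cpartial i f\<close> is
  holomorphic. In direction j the integrand becomes that of Cauchy's formula for
  \<open>cpartial j f\<close>, so the same computation gives the symmetry of second
  derivatives.\<close>

lemma cpartial_props:
  fixes f :: "complex ^ 'r::finite \<Rightarrow> complex"
  assumes f: "holomorphic_fun_on f U" and U: "open U"
  shows holomorphic_cpartial: "holomorphic_fun_on (cpartial i f) U"
    and cpartial_commute: "x \<in> U \<Longrightarrow> cpartial j (cpartial i f) x = cpartial i (cpartial j f) x"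
proof -
  \<comment> \<open>The last clause is conditional because Cauchy's formula for
    \<open>cpartial j f\<close> presupposes its holomorphy, which the first two clauses provide for
    all j afterwards.\<close>
  have main: "\<exists>f'. (cpartial i f has_derivative f') (at x) \<and> (\<forall>c v. f' (c *s v) = c * f' v)
     \<and> (\<forall>j. holomorphic_fun_on (cpartial j f) U \<longrightarrow> f' (axis j 1) = cpartial i (cpartial j f) x)"
    if x: "x \<in> U" for x i
  proof -
    obtain r where r: "r > 0" "cball x r \<subseteq> U" "\<And>y. y \<in> ball x r \<Longrightarrow> cball y r \<subseteq> U"
      using open_contains_cballs[OF U x] by metis
    have c0: "circ r t \<noteq> 0" for t using norm_circ[of r t] r by auto
    define fx where "fx = (\<lambda>y t. Blinfun (\<lambda>v. cderiv f (y + axis i (circ r t)) v / circ r t))"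
    have bl: "bounded_linear (\<lambda>v. cderiv f y v / c)" for y c
      unfolding cderiv_def divide_inverse
      by (intro bounded_linear_mult_const bounded_linear_sum bounded_linear_vec_nth)
    have fx: "blinfun_apply (fx y t) = (\<lambda>v. cderiv f (y + axis i (circ r t)) v / circ r t)" for y t
      unfolding fx_def using bl by (rule bounded_linear_Blinfun_apply)
    have inU: "y + axis i (circ r t) \<in> U" if "y \<in> ball x r" for y t
      using r(3)[OF that] r(1) by (auto simp: subset_iff dist_norm norm_axis norm_circ)
    have cont: "continuous_on (ball x r \<times> T) (\<lambda>(y, t). cderiv f (y + axis i (circ r t)) v / circ r t)" for v T
    proof -
      have "continuous_on (ball x r \<times> T) (\<lambda>p. \<Sum>j\<in>UNIV. v $ j * (case p of (y, t) \<Rightarrow> cpartial j f (y + axis i (circ r t)) / circ r t))"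
        by (intro continuous_on_sum continuous_on_mult continuous_on_const
              continuous_on_circ_slice[OF continuous_on_cpartial[OF f U]]) (use r in auto)
      then show ?thesis
        by (simp only: cderiv_def case_prod_beta' sum_divide_distrib times_divide_eq_right)
    qed
    have contfx: "continuous_on (ball x r \<times> T) (\<lambda>(y, t). fx y t)" for T
      by (rule continuous_on_blinfun_componentwise) (use cont in \<open>simp add: fx case_prod_beta\<close>)
    have xr: "x \<in> ball x r" using r by simp
    have fi: "(\<lambda>t. f (y + axis i (circ r t)) / circ r t) integrable_on cbox 0 1" if "y \<in> ball x r" for y
    proof -
      have "continuous_on ({y} \<times> cbox 0 1) (\<lambda>(y, t). f (y + axis i (circ r t)) / circ r t)"
        by (rule continuous_on_circ_slice[OF holomorphic_fun_on_continuous[OF f]]) (use r that in auto)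
      then have "continuous_on (cbox 0 1) (\<lambda>t. (\<lambda>(y, t). f (y + axis i (circ r t)) / circ r t) (Pair y t))"
        by (rule continuous_on_compose2) (auto intro: continuous_intros)
      then show ?thesis by (intro integrable_continuous) simp
    qed
    have fxi: "fx x integrable_on cbox 0 1"
    proof -
      have "continuous_on (cbox 0 1) (\<lambda>t. (\<lambda>(y, t). fx y t) (Pair x t))"
        by (rule continuous_on_compose2[OF contfx]) (use xr in \<open>auto intro: continuous_intros\<close>)
      then show ?thesis by (intro integrable_continuous) simp
    qed
    have der: "((\<lambda>y. integral (cbox 0 1) (\<lambda>t. f (y + axis i (circ r t)) / circ r t))
        has_derivative integral (cbox 0 1) (fx x)) (at x within ball x r)"
    proof (rule leibniz_rule[OF _ fi contfx xr])
      fix y t assume y: "y \<in> ball x r"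
      have "((\<lambda>y. f (y + axis i (circ r t))) has_derivative cderiv f (y + axis i (circ r t))) (at y)"
        by (rule has_derivative_compose[where f = "\<lambda>y. y + axis i (circ r t)" and f' = "\<lambda>v. v" and g = f,
              OF _ holomorphic_fun_on_imp_has_derivative[OF f inU[OF y]]])
           (auto intro!: derivative_eq_intros)
      then show "((\<lambda>y. f (y + axis i (circ r t)) / circ r t) has_derivative (blinfun_apply (fx y t))) (at y within ball x r)"
        unfolding fx divide_inverse by (intro has_derivative_mult_left) (rule has_derivative_at_withinI)
    qed auto
    have eq: "blinfun_apply (integral (cbox 0 1) (fx x)) v = integral (cbox 0 1) (\<lambda>t. cderiv f (x + axis i (circ r t)) v / circ r t)" for v
      by (simp only: blinfun_apply_integral[OF fxi] fx)
    have der': "(cpartial i f has_derivative integral (cbox 0 1) (fx x)) (at x)"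
    proof -
      have "(cpartial i f has_derivative integral (cbox 0 1) (fx x)) (at x within ball x r)"
        by (rule has_derivative_transform[OF xr _ der]) (use r in \<open>simp add: cpartial_integral[OF f, of _ r]\<close>)
      then show ?thesis using xr at_within_open[OF xr open_ball] by simp
    qed
    have lin: "blinfun_apply (integral (cbox 0 1) (fx x)) (c *s v) = c * blinfun_apply (integral (cbox 0 1) (fx x)) v" for c v
      unfolding eq cderiv_scaleC times_divide_eq_right[symmetric] by (rule integral_mult_right)
    have "blinfun_apply (integral (cbox 0 1) (fx x)) (axis j 1) = cpartial i (cpartial j f) x"
      if "holomorphic_fun_on (cpartial j f) U" for j
      unfolding eq cderiv_axis mult_1 by (rule cpartial_integral[OF that r(2,1), symmetric])
    with der' lin show ?thesis by blast
  qed
  have hol: "holomorphic_fun_on (cpartial i f) U" for i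
    unfolding holomorphic_fun_on_def using main by blast
  show "holomorphic_fun_on (cpartial i f) U" by (rule hol)
  show "cpartial j (cpartial i f) x = cpartial i (cpartial j f) x" if x: "x \<in> U"
  proof -
    obtain f' where f': "(cpartial i f has_derivative f') (at x)" "\<forall>c v. f' (c *s v) = c * f' v"
       "\<forall>j. holomorphic_fun_on (cpartial j f) U \<longrightarrow> f' (axis j 1) = cpartial i (cpartial j f) x"
      using main[OF x] by blast
    from holomorphic_fun_on_cderivI(1)[OF f'(1)] f'(2) have "f' = cderiv (cpartial i f) x" by blast
    with f'(3) hol show ?thesis by (simp add: cderiv_axis)
  qed
qed

section \<open>Closure properties of holomorphic functions\<close>

lemma holomorphic_fun_on_const: "holomorphic_fun_on (\<lambda>x. c) U"
  unfolding holomorphic_fun_on_def by (auto intro!: exI[of _ "\<lambda>_. 0"])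

lemma holomorphic_fun_on_nth: "holomorphic_fun_on (\<lambda>x. x $ i) U"
  unfolding holomorphic_fun_on_def
  by (auto intro!: exI[of _ "\<lambda>v. v $ i"] bounded_linear_imp_has_derivative bounded_linear_vec_nth)

lemma holomorphic_fun_on_add:
  "holomorphic_fun_on f U \<Longrightarrow> holomorphic_fun_on g U \<Longrightarrow> holomorphic_fun_on (\<lambda>x. f x + g x) U"
  unfolding holomorphic_fun_on_def
proof
  fix x assume "\<forall>x\<in>U. \<exists>f'. (f has_derivative f') (at x) \<and> (\<forall>c v. f' (c *s v) = c * f' v)"
    "\<forall>x\<in>U. \<exists>f'. (g has_derivative f') (at x) \<and> (\<forall>c v. f' (c *s v) = c * f' v)" "x \<in> U"
  then obtain f' g' where *: "(f has_derivative f') (at x)" "\<forall>c v. f' (c *s v) = c * f' v"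
    "(g has_derivative g') (at x)" "\<forall>c v. g' (c *s v) = c * g' v" by blast
  show "\<exists>h. ((\<lambda>x. f x + g x) has_derivative h) (at x) \<and> (\<forall>c v. h (c *s v) = c * h v)"
    by (rule exI[of _ "\<lambda>v. f' v + g' v"]) (use * in \<open>auto intro: has_derivative_add simp: algebra_simps\<close>)
qed

lemma holomorphic_fun_on_mult:
  "holomorphic_fun_on f U \<Longrightarrow> holomorphic_fun_on g U \<Longrightarrow> holomorphic_fun_on (\<lambda>x. f x * g x) U"
  unfolding holomorphic_fun_on_def
proof
  fix x assume "\<forall>x\<in>U. \<exists>f'. (f has_derivative f') (at x) \<and> (\<forall>c v. f' (c *s v) = c * f' v)"
    "\<forall>x\<in>U. \<exists>f'. (g has_derivative f') (at x) \<and> (\<forall>c v. f' (c *s v) = c * f' v)" "x \<in> U"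
  then obtain f' g' where *: "(f has_derivative f') (at x)" "\<forall>c v. f' (c *s v) = c * f' v"
    "(g has_derivative g') (at x)" "\<forall>c v. g' (c *s v) = c * g' v" by blast
  show "\<exists>h. ((\<lambda>x. f x * g x) has_derivative h) (at x) \<and> (\<forall>c v. h (c *s v) = c * h v)"
    by (rule exI[of _ "\<lambda>v. f x * g' v + f' v * g x"]) (use * in \<open>auto intro: has_derivative_mult simp: algebra_simps\<close>)
qed

lemma holomorphic_fun_on_cmult: "holomorphic_fun_on f U \<Longrightarrow> holomorphic_fun_on (\<lambda>x. c * f x) U"
  by (intro holomorphic_fun_on_mult holomorphic_fun_on_const)

lemma holomorphic_fun_on_diff:
  "holomorphic_fun_on f U \<Longrightarrow> holomorphic_fun_on g U \<Longrightarrow> holomorphic_fun_on (\<lambda>x. f x - g x) U"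
  using holomorphic_fun_on_add[OF _ holomorphic_fun_on_cmult[of g U "-1"], of f] by simp

lemma holomorphic_fun_on_sum:
  "(\<And>i. i \<in> I \<Longrightarrow> holomorphic_fun_on (f i) U) \<Longrightarrow> holomorphic_fun_on (\<lambda>x. \<Sum>i\<in>I. f i x) U"
  by (induction I rule: infinite_finite_induct) (auto intro: holomorphic_fun_on_const holomorphic_fun_on_add)

lemma holomorphic_fun_on_prod:
  "(\<And>i. i \<in> I \<Longrightarrow> holomorphic_fun_on (f i) U) \<Longrightarrow> holomorphic_fun_on (\<lambda>x. \<Prod>i\<in>I. f i x) U"
  by (induction I rule: infinite_finite_induct) (auto intro: holomorphic_fun_on_const holomorphic_fun_on_mult)

lemma holomorphic_fun_on_power: "holomorphic_fun_on f U \<Longrightarrow> holomorphic_fun_on (\<lambda>x. f x ^ k) U"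
  by (induction k) (auto intro: holomorphic_fun_on_const holomorphic_fun_on_mult)

lemma has_derivative_vec_componentwise:
  fixes f :: "'a::real_normed_vector \<Rightarrow> complex ^ 'r::finite"
  assumes "\<And>i. ((\<lambda>x. f x $ i) has_derivative (\<lambda>v. f' v $ i)) (at a within S)"
  shows "(f has_derivative f') (at a within S)"
  unfolding has_derivative_componentwise_within[of f]
proof
  fix b :: "complex ^ 'r" assume "b \<in> Basis"
  then obtain i u where b: "b = axis i u" by (auto simp: Basis_vec_def)
  show "((\<lambda>x. f x \<bullet> b) has_derivative (\<lambda>x. f' x \<bullet> b)) (at a within S)"
    unfolding b inner_axis using assms[of i] by (rule has_derivative_inner_left)
qed

lemma holomorphic_map_on_compose:
  assumes "holomorphic_fun_on f W" "holomorphic_map_on G U" "\<And>x. x \<in> U \<Longrightarrow> G x \<in> W"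
  shows "holomorphic_fun_on (\<lambda>x. f (G x)) U"
  unfolding holomorphic_fun_on_def
proof
  fix x assume x: "x \<in> U"
  have "((\<lambda>x. G x $ i) has_derivative cderiv (\<lambda>x. G x $ i) x) (at x)" for i
    using assms(2) x by (auto simp: holomorphic_map_on_def intro: holomorphic_fun_on_imp_has_derivative)
  then have "(G has_derivative (\<lambda>v. \<chi> i. cderiv (\<lambda>x. G x $ i) x v)) (at x)"
    by (intro has_derivative_vec_componentwise) simp
  from has_derivative_compose[OF this holomorphic_fun_on_imp_has_derivative[OF assms(1) assms(3)[OF x]]]
  have "((\<lambda>x. f (G x)) has_derivative (\<lambda>v. cderiv f (G x) (\<chi> i. cderiv (\<lambda>x. G x $ i) x v))) (at x)" .
  moreover have "cderiv f (G x) (\<chi> i. cderiv (\<lambda>x. G x $ i) x (c *s v)) = c * cderiv f (G x) (\<chi> i. cderiv (\<lambda>x. G x $ i) x v)" for c v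
    by (rule trans[OF _ cderiv_scaleC], rule arg_cong[where f = "cderiv f (G x)"])
       (simp add: vec_eq_iff cderiv_scaleC)
  ultimately show "\<exists>f'. ((\<lambda>x. f (G x)) has_derivative f') (at x) \<and> (\<forall>c v. f' (c *s v) = c * f' v)"
    by blast
qed

section \<open>Identity theorems\<close>

text \<open>Joins x to y by a complex line: the parameters that stay in the ball form a convex open
  set, hence a connected one, and one-variable continuation applies.\<close>

lemma identity_theorem_ball:
  fixes g :: "complex ^ 'r::finite \<Rightarrow> complex"
  assumes g: "holomorphic_fun_on g (ball c r)" and x: "x \<in> ball c r" "e > 0"
    and zero: "\<And>y. y \<in> ball x e \<Longrightarrow> g y = 0" and y: "y \<in> ball c r"
  shows "g y = 0"
proof -
  define w where "w = y - x"
  define T where "T = (\<lambda>t. t *s w) -` ball (c - x) r"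
  have T: "t \<in> T \<longleftrightarrow> x + t *s w \<in> ball c r" for t
    by (simp add: T_def dist_norm algebra_simps)
  have hol: "(\<lambda>t. g (x + t *s w)) holomorphic_on T"
    by (rule holomorphic_on_line[OF g]) (simp add: T)
  have "open T"
    unfolding T_def by (intro open_vimage linear_continuous_on bounded_linear_scaleC_left) auto
  have "connected T"
    unfolding T_def
    by (intro convex_connected convex_linear_vimage) (auto simp: bounded_linear_scaleC_left linear_conv_bounded_linear)
  \<comment> \<open>The added 1 keeps the quotient meaningful when w = 0, that is when y =
    x.\<close>
  define d where "d = e / (norm w + 1)"
  have d: "d > 0" using x by (simp add: d_def add_nonneg_pos)
  have 0: "0 \<in> T" using x by (simp add: T)
  have "g (x + t *s w) = 0" if "t \<in> ball 0 d" for t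
  proof (rule zero)
    have "norm (t *s w) \<le> norm t * (norm w + 1)" by (simp add: norm_scaleC mult_left_mono)
    also have "\<dots> < d * (norm w + 1)"
      using that by (intro mult_strict_right_mono) (auto simp: add_nonneg_pos)
    also have "norm w + 1 \<noteq> 0" using norm_ge_zero[of w] by linarith
    then have "d * (norm w + 1) = e" by (simp add: d_def)
    finally show "x + t *s w \<in> ball x e" by (simp add: dist_norm)
  qed
  then have zero': "\<And>t. t \<in> T \<inter> ball 0 d \<Longrightarrow> g (x + t *s w) = 0" by blast
  have "0 islimpt T \<inter> ball 0 d"
    using 0 d \<open>open T\<close> by (intro interior_limit_point) (simp add: interior_open)
  moreover have "1 \<in> T" using y by (simp add: T w_def)
  ultimately have "g (x + 1 *s w) = 0"
    using analytic_continuation[OF hol \<open>open T\<close> \<open>connected T\<close> Int_lower1[of T "ball 0 d"] 0 _ zero', of 1] by blast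
  then show ?thesis by (simp add: w_def)
qed

text \<open>By the ball case, vanishing near a point holds at all points of a ball inside \<Omega>
  or at none; connectedness does the rest.\<close>

lemma identity_theorem:
  fixes g :: "complex ^ 'r::finite \<Rightarrow> complex"
  assumes g: "holomorphic_fun_on g \<Omega>" and \<Omega>: "open \<Omega>" "connected \<Omega>" and x: "x \<in> \<Omega>" "e > 0"
    and zero: "\<And>y. y \<in> ball x e \<Longrightarrow> g y = 0" and y: "y \<in> \<Omega>"
  shows "g y = 0"
proof -
  define Z where "Z = (\<lambda>x. \<exists>e>0. \<forall>z\<in>ball x e. g z = 0)"
  have "Z y"
  proof (rule connected_induction_simple[OF \<Omega>(2) x(1) y])
    show "Z x" unfolding Z_def using x zero by blast
    fix a assume "a \<in> \<Omega>"
    then obtain r where r: "r > 0" "ball a r \<subseteq> \<Omega>" using \<Omega>(1) open_contains_ball by metis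
    have "Z y" if xy: "x \<in> ball a r" "y \<in> ball a r" "Z x" for x y
    proof -
      obtain s where s: "s > 0" "ball y s \<subseteq> ball a r" using xy(2) open_contains_ball[of "ball a r"] by blast
      obtain e where "e > 0" "\<forall>z\<in>ball x e. g z = 0" using xy(3) unfolding Z_def by blast
      then have "g z = 0" if "z \<in> ball a r" for z
        using identity_theorem_ball[OF holomorphic_fun_on_subset[OF g r(2)] xy(1), of e z] that by blast
      with s show ?thesis unfolding Z_def by blast
    qed
    moreover have "openin (top_of_set \<Omega>) (ball a r)" using r by (simp add: open_subset)
    moreover have "a \<in> ball a r" using r by simp
    ultimately show "\<exists>T. openin (top_of_set \<Omega>) T \<and> a \<in> T \<and> (\<forall>x\<in>T. \<forall>y\<in>T. Z x \<longrightarrow> Z y)"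
      by blast
  qed
  then show ?thesis unfolding Z_def by auto
qed

section \<open>Uniqueness of holomorphic extension from the totally real slice\<close>

lemma linear_z_zbar_u: "linear z_zbar_u"
  by (rule linearI) (auto simp: z_zbar_u_def vec_eq_iff scaleR_conv_of_real[where 'a = complex] split: option.split sum.split)

lemma z_zbar_u_nth [simp]:
  "z_zbar_u q $ None = of_real (snd q)" "z_zbar_u q $ Some (Inl j) = fst q $ j"
  "z_zbar_u q $ Some (Inr j) = cnj (fst q $ j)"
  by (simp_all add: z_zbar_u_def)

text \<open>\<open>range z_zbar_u\<close> is the fixed space of the antilinear involution (z, a, u)
  -> (cnj a, cnj z, cnj u). \<open>slice_re\<close> and \<open>slice_im\<close> are the real and
  imaginary parts for this real structure, read back as points (z, u).\<close>

definition slice_re :: "complex ^ (('n::finite + 'n) option) \<Rightarrow> (complex ^ 'n) \<times> real" where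
  "slice_re x = ((\<chi> j. (x $ Some (Inl j) + cnj (x $ Some (Inr j))) / 2), Re (x $ None))"

definition slice_im :: "complex ^ (('n::finite + 'n) option) \<Rightarrow> (complex ^ 'n) \<times> real" where
  "slice_im x = ((\<chi> j. (x $ Some (Inl j) - cnj (x $ Some (Inr j))) / (2 * \<i>)), Im (x $ None))"

lemma slice_decomposition: "z_zbar_u (slice_re x) + \<i> *s z_zbar_u (slice_im x) = x"
proof -
  have "(z_zbar_u (slice_re x) + \<i> *s z_zbar_u (slice_im x)) $ k = x $ k" for k
  proof (cases k)
    case None
    then show ?thesis by (simp add: slice_re_def slice_im_def complex_eq flip: complex_eq)
  next
    case (Some s)
    then show ?thesis by (cases s) (simp_all add: slice_re_def slice_im_def field_simps)
  qed
  then show ?thesis by (simp add: vec_eq_iff)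
qed

lemma linear_slice: "linear slice_re" "linear slice_im"
  by (auto intro!: linearI simp: slice_re_def slice_im_def vec_eq_iff scaleR_conv_of_real[where 'a = complex] field_simps)

text \<open>A nearby point is \<open>z_zbar_u (q0 + P) + \<i> *s z_zbar_u Q\<close>. Replacing \<i>
  by a parameter t gives a holomorphic function of t that vanishes for real t in (-1, 1), where the
  point lies on the slice; hence it vanishes at t = \<i>.\<close>

lemma totally_real_slice:
  fixes g :: "complex ^ (('n::finite + 'n) option) \<Rightarrow> complex"
  assumes g: "holomorphic_fun_on g (ball (z_zbar_u q0) e)" "e > 0" "d > 0"
    and zero: "\<And>q. q \<in> ball q0 d \<Longrightarrow> z_zbar_u q \<in> ball (z_zbar_u q0) e \<Longrightarrow> g (z_zbar_u q) = 0"
  obtains e' where "e' > 0" "\<And>x. x \<in> ball (z_zbar_u q0) e' \<Longrightarrow> g x = 0"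
proof -
  interpret Z: linear z_zbar_u by (rule linear_z_zbar_u)
  obtain B where B: "B > 0" "\<And>q :: (complex ^ 'n) \<times> real. norm (z_zbar_u q) \<le> B * norm q"
    using linear_bounded_pos[OF linear_z_zbar_u] by blast
  obtain B1 where B1: "B1 > 0" "\<And>x :: complex ^ (('n + 'n) option). norm (slice_re x) \<le> B1 * norm x"
    using linear_bounded_pos[OF linear_slice(1)] by blast
  obtain B2 where B2: "B2 > 0" "\<And>x :: complex ^ (('n + 'n) option). norm (slice_im x) \<le> B2 * norm x"
    using linear_bounded_pos[OF linear_slice(2)] by blast
  \<comment> \<open>The 2 is the radius of the parameter disc, chosen to exceed the norm of \<i>.
    The two terms of \<open>e'\<close> then keep the real segment within distance d of q0 and the
    whole disc inside the ball of radius e.\<close>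
  define K where "K = B1 + 2 * B2"
  have K: "K > 0" using B1 B2 by (simp add: K_def)
  define e' where "e' = min (d / K) (e / (B * K))"
  have e': "e' > 0" using K B g by (simp add: e'_def)
  show ?thesis
  proof (rule that[OF e'])
    fix x assume "x \<in> ball (z_zbar_u q0) e'"
    define y where "y = x - z_zbar_u q0"
    have y: "norm y < e'" using \<open>x \<in> _\<close> by (simp add: y_def dist_norm norm_minus_commute)
    define P where "P = slice_re y"
    define Q where "Q = slice_im y"
    have PQ: "norm P + 2 * norm Q \<le> K * norm y"
      using B1(2)[of y] B2(2)[of y] by (simp add: P_def Q_def K_def algebra_simps)
    have PQd: "norm P + 2 * norm Q < d"
    proof -
      have "K * norm y < K * (d / K)" using y K by (intro mult_strict_left_mono) (auto simp: e'_def)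
      then show ?thesis using PQ K by simp
    qed
    have PQe: "B * (norm P + 2 * norm Q) < e"
    proof -
      have "B * (norm P + 2 * norm Q) \<le> B * (K * norm y)" using PQ B by simp
      also have "\<dots> < B * (K * (e / (B * K)))" using y K B by (intro mult_strict_left_mono) (auto simp: e'_def)
      finally show ?thesis using K B by simp
    qed
    let ?h = "\<lambda>t. g (z_zbar_u (q0 + P) + t *s z_zbar_u Q)"
    have inb: "z_zbar_u (q0 + P) + t *s z_zbar_u Q \<in> ball (z_zbar_u q0) e" if "t \<in> ball 0 2" for t
    proof -
      have "norm (z_zbar_u P + t *s z_zbar_u Q) \<le> norm (z_zbar_u P) + norm t * norm (z_zbar_u Q)"
        by (metis norm_triangle_ineq norm_scaleC)
      also have "\<dots> \<le> B * norm P + 2 * (B * norm Q)"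
        using that by (intro add_mono mult_mono B) auto
      also have "\<dots> < e" using PQe by (simp add: algebra_simps)
      finally show ?thesis by (simp add: Z.add dist_norm norm_minus_commute[of _ "z_zbar_u q0"] algebra_simps)
          (metis norm_minus_cancel minus_add_distrib diff_conv_add_uminus)
    qed
    have hol: "?h holomorphic_on ball 0 2" by (rule holomorphic_on_line[OF g(1) inb])
    have "?h \<i> = 0"
    proof (rule analytic_continuation[OF hol, of "of_real ` {-1<..<1}" 0])
      show "(0::complex) islimpt of_real ` {-1<..<1}"
        unfolding islimpt_approachable
      proof (intro allI impI)
        fix \<epsilon> :: real assume "\<epsilon> > 0"
        then show "\<exists>x'\<in>complex_of_real ` {-1<..<1}. x' \<noteq> 0 \<and> dist x' 0 < \<epsilon>"
          by (intro bexI[of _ "of_real (min (\<epsilon>/2) (1/2))"]) (auto simp: min_def)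
      qed
      fix z :: complex assume "z \<in> of_real ` {-1<..<1}"
      then obtain t where t: "z = of_real t" "\<bar>t\<bar> < 1" by auto
      have eq: "z_zbar_u (q0 + P) + z *s z_zbar_u Q = z_zbar_u (q0 + (P + t *\<^sub>R Q))"
        by (simp add: Z.add Z.scaleR t vec_eq_iff scaleR_conv_of_real[where 'a = complex])
      have "norm (P + t *\<^sub>R Q) \<le> norm P + 2 * norm Q"
        using norm_triangle_ineq[of P "t *\<^sub>R Q"] mult_right_mono[of "\<bar>t\<bar>" 2 "norm Q"] t by simp
      then have "dist (q0 + (P + t *\<^sub>R Q)) q0 < d" using PQd by (simp add: dist_norm)
      then have "q0 + (P + t *\<^sub>R Q) \<in> ball q0 d" by (simp add: dist_commute)
      moreover have "z_zbar_u (q0 + (P + t *\<^sub>R Q)) \<in> ball (z_zbar_u q0) e"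
        using inb[of z] t unfolding eq by simp
      ultimately show "?h z = 0" unfolding eq by (rule zero)
    qed auto
    then have "g (z_zbar_u q0 + (z_zbar_u P + \<i> *s z_zbar_u Q)) = 0" by (simp add: Z.add add.assoc)
    then show "g x = 0" by (simp add: P_def Q_def slice_decomposition) (simp add: y_def)
  qed
qed

section \<open>Power series\<close>

definition monomial_at :: "complex ^ 'r \<Rightarrow> ('r \<Rightarrow> nat) \<Rightarrow> complex ^ 'r::finite \<Rightarrow> complex" where
  "monomial_at x0 \<mu> x = (\<Prod>i\<in>UNIV. (x $ i - x0 $ i) ^ \<mu> i)"

lemma holomorphic_monomial_at: "holomorphic_fun_on (monomial_at x0 \<mu>) U"
  unfolding monomial_at_def
  by (intro holomorphic_fun_on_prod holomorphic_fun_on_power holomorphic_fun_on_diff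
      holomorphic_fun_on_nth holomorphic_fun_on_const)

lemma DERIV_monomial_at:
  "((\<lambda>t. monomial_at x0 \<mu> (x + axis i t)) has_field_derivative
     of_nat (\<mu> i) * monomial_at x0 (\<mu>(i := \<mu> i - 1)) x) (at 0)"
proof -
  have split: "monomial_at x0 \<nu> y = (y $ i - x0 $ i) ^ \<nu> i * (\<Prod>j\<in>UNIV - {i}. (y $ j - x0 $ j) ^ \<nu> j)" for y \<nu>
    by (simp add: monomial_at_def prod.remove[of UNIV i])
  have "(\<Prod>j\<in>UNIV - {i}. ((x + axis i t) $ j - x0 $ j) ^ \<mu> j) = (\<Prod>j\<in>UNIV - {i}. (x $ j - x0 $ j) ^ \<mu> j)" for t
    by (intro prod.cong) (auto simp: axis_def)
  then have "monomial_at x0 \<mu> (x + axis i t) = (x $ i + t - x0 $ i) ^ \<mu> i * (\<Prod>j\<in>UNIV - {i}. (x $ j - x0 $ j) ^ \<mu> j)" for t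
    by (simp add: split)
  moreover have "((\<lambda>t. (x $ i + t - x0 $ i) ^ \<mu> i * (\<Prod>j\<in>UNIV - {i}. (x $ j - x0 $ j) ^ \<mu> j)) has_field_derivative
     (of_nat (\<mu> i) * (x $ i - x0 $ i) ^ (\<mu> i - 1)) * (\<Prod>j\<in>UNIV - {i}. (x $ j - x0 $ j) ^ \<mu> j)) (at 0)"
    by (auto intro!: derivative_eq_intros)
  moreover have "(\<Prod>j\<in>UNIV - {i}. (x $ j - x0 $ j) ^ (\<mu>(i := \<mu> i - 1)) j) = (\<Prod>j\<in>UNIV - {i}. (x $ j - x0 $ j) ^ \<mu> j)"
    by (intro prod.cong) auto
  ultimately show ?thesis by (simp add: split[of "\<mu>(i := \<mu> i - 1)"] mult.assoc del: One_nat_def)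
qed

text \<open>The majorant M makes the differentials converge uniformly, so the series may be
  differentiated termwise; a sum of complex linear maps is complex linear.\<close>

lemma holomorphic_fun_on_suminf:
  fixes f :: "nat \<Rightarrow> complex ^ 'r::finite \<Rightarrow> complex"
  assumes hol: "\<And>n. holomorphic_fun_on (f n) S" and S: "open S" "convex S"
    and M: "summable M" "\<And>n x h. x \<in> S \<Longrightarrow> norm (cderiv (f n) x h) \<le> M n * norm h"
    and sm: "\<And>x. x \<in> S \<Longrightarrow> summable (\<lambda>n. f n x)"
  shows "holomorphic_fun_on (\<lambda>x. suminf (\<lambda>n. f n x)) S"
proof (cases "S = {}")
  case False
  then obtain x1 where x1: "x1 \<in> S" by auto
  have sd: "summable (\<lambda>n. cderiv (f n) x h)" if "x \<in> S" for x h
    by (rule summable_comparison_test'[OF summable_mult2[OF M(1), of "norm h"] M(2)[OF that]])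
  have "\<exists>g. \<forall>x\<in>S. (\<lambda>n. f n x) sums g x \<and> (g has_derivative (\<lambda>h. suminf (\<lambda>n. cderiv (f n) x h))) (at x within S)"
  proof (rule has_derivative_series[where f = f and f' = "\<lambda>n. cderiv (f n)", OF S(2) _ _ x1 summable_sums[OF sm[OF x1]]])
    fix n x assume "x \<in> S"
    then show "(f n has_derivative cderiv (f n) x) (at x within S)"
      by (rule has_derivative_at_withinI[OF holomorphic_fun_on_imp_has_derivative[OF hol]])
  next
    fix e :: real assume "e > 0"
    obtain N where N: "\<And>n. n \<ge> N \<Longrightarrow> norm (suminf (\<lambda>i. M (i + n))) < e"
      using suminf_exist_split[OF \<open>e > 0\<close> M(1)] by blast
    have "norm (sum (\<lambda>i. cderiv (f i) x h) {..<n} - (suminf (\<lambda>i. cderiv (f i) x h))) \<le> e * norm h"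
      if "n \<ge> N" "x \<in> S" for n x h
    proof -
      have sM: "summable (\<lambda>i. M (i + n) * norm h)"
        using M(1) by (intro summable_mult2 summable_ignore_initial_segment)
      have sn: "summable (\<lambda>i. norm (cderiv (f (i + n)) x h))"
        by (rule summable_comparison_test'[OF sM]) (use M(2)[OF that(2)] in simp)
      have "(suminf (\<lambda>i. cderiv (f i) x h)) = (suminf (\<lambda>i. cderiv (f (i + n)) x h)) + (\<Sum>i<n. cderiv (f i) x h)"
        by (rule suminf_split_initial_segment[OF sd[OF that(2)]])
      then have "norm (sum (\<lambda>i. cderiv (f i) x h) {..<n} - (suminf (\<lambda>i. cderiv (f i) x h))) = norm (suminf (\<lambda>i. cderiv (f (i + n)) x h))"
        by simp
      also have "\<dots> \<le> (suminf (\<lambda>i. norm (cderiv (f (i + n)) x h)))" by (rule summable_norm[OF sn])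
      also have "\<dots> \<le> (suminf (\<lambda>i. M (i + n) * norm h))" by (rule suminf_le[OF M(2)[OF that(2)] sn sM])
      also have "\<dots> = (suminf (\<lambda>i. M (i + n))) * norm h"
        using M(1) by (intro suminf_mult2[symmetric] summable_ignore_initial_segment)
      also have "\<dots> \<le> e * norm h" using N[OF that(1)] by (intro mult_right_mono) auto
      finally show ?thesis .
    qed
    then show "\<forall>\<^sub>F n in sequentially. \<forall>x\<in>S. \<forall>h. norm (sum (\<lambda>i. cderiv (f i) x h) {..<n} - (suminf (\<lambda>i. cderiv (f i) x h))) \<le> e * norm h"
      unfolding eventually_sequentially by blast
  qed
  then obtain g where g: "\<And>x. x \<in> S \<Longrightarrow> (\<lambda>n. f n x) sums g x"
    "\<And>x. x \<in> S \<Longrightarrow> (g has_derivative (\<lambda>h. suminf (\<lambda>n. cderiv (f n) x h))) (at x within S)" by blast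
  show ?thesis
    unfolding holomorphic_fun_on_def
  proof
    fix x assume x: "x \<in> S"
    have "((\<lambda>x. suminf (\<lambda>n. f n x)) has_derivative (\<lambda>h. suminf (\<lambda>n. cderiv (f n) x h))) (at x within S)"
      by (rule has_derivative_transform[OF x _ g(2)[OF x]]) (use g(1) sums_unique in metis)
    then have "((\<lambda>x. suminf (\<lambda>n. f n x)) has_derivative (\<lambda>h. suminf (\<lambda>n. cderiv (f n) x h))) (at x)"
      using at_within_open[OF x S(1)] by simp
    moreover have "(suminf (\<lambda>n. cderiv (f n) x (c *s v))) = c * (suminf (\<lambda>n. cderiv (f n) x v))" for c v
      by (simp add: cderiv_scaleC suminf_mult[OF sd[OF x]])
    ultimately show "\<exists>f'. ((\<lambda>x. suminf (\<lambda>n. f n x)) has_derivative f') (at x) \<and> (\<forall>c v. f' (c *s v) = c * f' v)"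
      by blast
  qed
qed (simp add: holomorphic_fun_on_def)

text \<open>On the ball of radius R/2, differentiating a monomial of degree m costs a factor at most
  m \<le> 2^m, which the passage from R/2 back to R absorbs. So the summable majorant at radius R
  also controls the differentials.\<close>

lemma holomorphic_power_series_sum:
  fixes c :: "('r::finite \<Rightarrow> nat) \<Rightarrow> complex"
  assumes R: "R > 0" and sm: "(\<lambda>\<mu>. norm (c \<mu>) * R ^ (\<Sum>i\<in>UNIV. \<mu> i)) summable_on UNIV"
  obtains f where "holomorphic_fun_on f (ball x0 (R/2))"
    "\<And>x. x \<in> ball x0 (R/2) \<Longrightarrow> ((\<lambda>\<mu>. c \<mu> * monomial_at x0 \<mu> x) has_sum f x) UNIV"
proof -
  define r where "r = R / 2"
  have r: "r > 0" "r \<le> R" "R = 2 * r" using R by (auto simp: r_def)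
  define deg :: "('r \<Rightarrow> nat) \<Rightarrow> nat" where "deg \<mu> = (\<Sum>i\<in>UNIV. \<mu> i)" for \<mu>
  have mono_bound: "norm (monomial_at x0 \<mu> x) \<le> r ^ deg \<mu>" if "x \<in> ball x0 r" for x \<mu>
  proof -
    have "norm (x $ i - x0 $ i) \<le> r" for i
      using Finite_Cartesian_Product.norm_nth_le[of "x - x0" i] that by (simp add: dist_norm norm_minus_commute)
    then have "norm (monomial_at x0 \<mu> x) \<le> (\<Prod>i\<in>UNIV. r ^ \<mu> i)"
      unfolding monomial_at_def prod_norm[symmetric] norm_power by (intro prod_mono conjI power_mono) auto
    then show ?thesis by (simp add: deg_def power_sum)
  qed
  let ?N = "\<lambda>\<mu>. norm (c \<mu>) * R ^ deg \<mu>"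
  have sN: "?N summable_on UNIV" using sm by (simp add: deg_def)
  \<comment> \<open>Multi-indices are coded by natural numbers, with zero terms at numbers that are
    no code, to turn the unordered sum into an ordinary series.\<close>
  define e where "e = (to_nat :: ('r \<Rightarrow> nat) \<Rightarrow> nat)"
  define g :: "(('r \<Rightarrow> nat) \<Rightarrow> complex) \<Rightarrow> nat \<Rightarrow> complex"
    where "g h n = (if n \<in> range e then h (from_nat n) else 0)" for h n
  have transfer: "(h has_sum s) UNIV \<longleftrightarrow> (g h has_sum s) UNIV" for h s
  proof -
    have "(h has_sum s) UNIV \<longleftrightarrow> (g h has_sum s) (range e)"
      using has_sum_reindex[of e UNIV "g h" s] by (simp add: e_def g_def o_def)
    also have "\<dots> \<longleftrightarrow> (g h has_sum s) UNIV" by (intro has_sum_cong_neutral) (auto simp: g_def)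
    finally show ?thesis .
  qed
  \<comment> \<open>Each coordinate derivative of the term is at most
    \<open>norm (c \<mu>) * R ^ deg \<mu> / r\<close>, and there are \<open>CARD('r)\<close>
    coordinates.\<close>
  define M where "M n = (if n \<in> range e then real CARD('r) / r * ?N (from_nat n) else 0)" for n
  have "M summable_on UNIV"
  proof -
    have "(\<lambda>\<mu>. real CARD('r) / r * ?N \<mu>) summable_on UNIV" by (intro summable_on_cmult_right sN)
    then have "(M \<circ> e) summable_on UNIV" by (simp add: M_def e_def o_def)
    then have "M summable_on range e" by (subst summable_on_reindex) (auto simp: e_def)
    then show ?thesis by (rule summable_on_cong_neutral[THEN iffD1, rotated -1]) (auto simp: M_def)
  qed
  then have M: "summable M" by (auto simp: summable_on_def summable_def dest: has_sum_imp_sums)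
  let ?t = "\<lambda>x \<mu>. c \<mu> * monomial_at x0 \<mu> x"
  have st: "?t x summable_on UNIV" if "x \<in> ball x0 r" for x
  proof (rule abs_summable_summable, rule summable_on_comparison_test[OF sN])
    fix \<mu>
    have "norm (?t x \<mu>) \<le> norm (c \<mu>) * r ^ deg \<mu>"
      unfolding norm_mult by (intro mult_left_mono mono_bound that) auto
    also have "\<dots> \<le> ?N \<mu>" using r by (intro mult_left_mono power_mono) auto
    finally show "norm (?t x \<mu>) \<le> ?N \<mu>" .
  qed auto
  have sums: "(\<lambda>n. g (?t x) n) sums (\<Sum>\<^sub>\<infinity>\<mu>. ?t x \<mu>)" if "x \<in> ball x0 r" for x
    using has_sum_infsum[OF st[OF that]] unfolding transfer by (rule has_sum_imp_sums)
  have hol: "holomorphic_fun_on (\<lambda>x. g (?t x) n) (ball x0 r)" for n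
    by (cases "n \<in> range e")
       (auto simp: g_def intro: holomorphic_fun_on_const holomorphic_fun_on_mult holomorphic_monomial_at)
  have cd: "norm (cderiv (\<lambda>x. ?t x \<mu>) x h) \<le> real CARD('r) / r * ?N \<mu> * norm h" if x: "x \<in> ball x0 r" for \<mu> x h
  proof -
    have cp: "cpartial i (\<lambda>x. ?t x \<mu>) x = c \<mu> * (of_nat (\<mu> i) * monomial_at x0 (\<mu>(i := \<mu> i - 1)) x)" for i
      unfolding cpartial_def by (intro DERIV_imp_deriv DERIV_cmult DERIV_monomial_at)
    have "norm (of_nat (\<mu> i) * monomial_at x0 (\<mu>(i := \<mu> i - 1)) x) \<le> R ^ deg \<mu> / r" for i
    proof (cases "\<mu> i = 0")
      case False
      have deg: "deg \<mu> = Suc (deg (\<mu>(i := \<mu> i - 1)))"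
      proof -
        have "deg \<nu> = \<nu> i + (\<Sum>j\<in>UNIV - {i}. \<nu> j)" for \<nu>
          by (simp add: deg_def sum.remove[of UNIV i])
        moreover have "(\<Sum>j\<in>UNIV - {i}. (\<mu>(i := \<mu> i - 1)) j) = (\<Sum>j\<in>UNIV - {i}. \<mu> j)"
          by (intro sum.cong) auto
        ultimately show ?thesis using False by simp
      qed
      have "\<mu> i \<le> deg \<mu>" unfolding deg_def by (intro member_le_sum) auto
      also have "\<dots> \<le> 2 ^ deg \<mu>" by (rule less_imp_le[OF less_exp])
      finally have "real (\<mu> i) \<le> 2 ^ deg \<mu>" by (metis of_nat_le_iff of_nat_numeral of_nat_power)
      then have "norm (of_nat (\<mu> i) * monomial_at x0 (\<mu>(i := \<mu> i - 1)) x) \<le> 2 ^ deg \<mu> * r ^ deg (\<mu>(i := \<mu> i - 1))"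
        unfolding norm_mult norm_of_nat by (intro mult_mono mono_bound x) auto
      also have "\<dots> = R ^ deg \<mu> / r" unfolding deg using r by (simp add: power_mult_distrib field_simps)
      finally show ?thesis .
    qed (use r in simp)
    then have "norm (h $ i * cpartial i (\<lambda>x. ?t x \<mu>) x) \<le> norm h * (norm (c \<mu>) * (R ^ deg \<mu> / r))" for i
      unfolding cp norm_mult using r by (intro mult_mono Finite_Cartesian_Product.norm_nth_le) (auto simp: norm_mult)
    then have "norm (cderiv (\<lambda>x. ?t x \<mu>) x h) \<le> (\<Sum>i\<in>(UNIV::'r set). norm h * (norm (c \<mu>) * (R ^ deg \<mu> / r)))"
      unfolding cderiv_def by (intro sum_norm_le)
    also have "\<dots> = real CARD('r) / r * ?N \<mu> * norm h" by simp
    finally show ?thesis .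
  qed
  have bound: "norm (cderiv (\<lambda>x. g (?t x) n) x h) \<le> M n * norm h" if "x \<in> ball x0 r" for n x h
  proof (cases "n \<in> range e")
    case True
    then have "(\<lambda>x. g (?t x) n) = (\<lambda>x. ?t x (from_nat n))" "M n = real CARD('r) / r * ?N (from_nat n)"
      by (auto simp: g_def M_def)
    then show ?thesis using cd[OF that, of "from_nat n" h] by simp
  next
    case False
    then have "(\<lambda>x. g (?t x) n) = (\<lambda>x. 0)" "M n = 0" by (auto simp: g_def M_def)
    then show ?thesis by (simp add: cderiv_def cpartial_def)
  qed
  have "holomorphic_fun_on (\<lambda>x. suminf (\<lambda>n. g (?t x) n)) (ball x0 r)"
    by (rule holomorphic_fun_on_suminf[OF hol _ _ M bound]) (use sums in \<open>auto simp: sums_iff\<close>)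
  then show ?thesis
  proof (rule that[unfolded r_def[symmetric]])
    fix x assume x: "x \<in> ball x0 r"
    show "(?t x has_sum (suminf (\<lambda>n. g (?t x) n))) UNIV"
      using has_sum_infsum[OF st[OF x]] sums_unique[OF sums[OF x]] by simp
  qed
qed

text \<open>Convergence at one point whose coordinate increments all equal the same s > 0 suffices:
  there every monomial has value s to its degree, and unordered summability of complex numbers is
  absolute. The series then converges in independent z, a, u.\<close>

lemma real_analytic_local_complexification:
  fixes \<phi> :: "(complex ^ 'n::finite) \<times> real \<Rightarrow> real"
  assumes \<phi>: "real_analytic_on \<phi> V" and q0: "q0 \<in> V"
  obtains \<Phi> e where "e > 0" "holomorphic_fun_on \<Phi> (ball (z_zbar_u q0) e)"
    "\<And>q. z_zbar_u q \<in> ball (z_zbar_u q0) e \<Longrightarrow> \<Phi> (z_zbar_u q) = of_real (\<phi> q)"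
proof -
  obtain z0 u0 where q: "q0 = (z0, u0)" by force
  obtain c e where e: "e > 0" and hs: "\<And>z u. (z, u) \<in> ball (z0, u0) e \<Longrightarrow>
      ((\<lambda>(\<alpha>, \<beta>, k). c \<alpha> \<beta> k * (\<Prod>j\<in>UNIV. (z $ j - z0 $ j) ^ \<alpha> j) * (\<Prod>j\<in>UNIV. cnj (z $ j - z0 $ j) ^ \<beta> j)
          * of_real (u - u0) ^ k) has_sum of_real (\<phi> (z, u))) UNIV"
    using \<phi> q0 unfolding real_analytic_on_def q by fast
  \<comment> \<open>Identifies a multi-index on the 2n+1 variables with the exponents of z, cnj z
    and u.\<close>
  define pk :: "(('n + 'n) option \<Rightarrow> nat) \<Rightarrow> ('n \<Rightarrow> nat) \<times> ('n \<Rightarrow> nat) \<times> nat"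
    where "pk = (\<lambda>\<mu>. ((\<lambda>j. \<mu> (Some (Inl j))), (\<lambda>j. \<mu> (Some (Inr j))), \<mu> None))"
  have bij: "bij pk"
    by (rule bij_betw_byWitness[where f' = "\<lambda>(\<alpha>, \<beta>, k). \<lambda>i. case i of None \<Rightarrow> k | Some (Inl j) \<Rightarrow> \<alpha> j | Some (Inr j) \<Rightarrow> \<beta> j"])
       (auto simp: pk_def fun_eq_iff split: option.split sum.split)
  define c' where "c' = (\<lambda>\<mu>. case pk \<mu> of (\<alpha>, \<beta>, k) \<Rightarrow> c \<alpha> \<beta> k)"
  have UN: "(UNIV :: ('n + 'n) option set) = insert None (Some ` (range Inl \<union> range Inr))"
    by (metis UNIV_option_conv UNIV_sum)
  have prod: "(\<Prod>i\<in>UNIV. h i) = h None * (\<Prod>j\<in>UNIV. h (Some (Inl j))) * (\<Prod>j\<in>UNIV. h (Some (Inr j)))"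
    for h :: "('n + 'n) option \<Rightarrow> complex"
    unfolding UN by (subst prod.insert, simp, force, subst prod.reindex, simp, subst prod.union_disjoint)
      (auto simp: prod.reindex mult.assoc add.assoc)
  have sum: "(\<Sum>i\<in>UNIV. h i) = h None + (\<Sum>j\<in>UNIV. h (Some (Inl j))) + (\<Sum>j\<in>UNIV. h (Some (Inr j)))"
    for h :: "('n + 'n) option \<Rightarrow> nat"
    unfolding UN by (subst sum.insert, simp, force, subst sum.reindex, simp, subst sum.union_disjoint)
      (auto simp: sum.reindex mult.assoc add.assoc)
  have hs': "((\<lambda>\<mu>. c' \<mu> * monomial_at (z_zbar_u q0) \<mu> (z_zbar_u q)) has_sum of_real (\<phi> q)) UNIV"
    if "q \<in> ball q0 e" for q
  proof -
    obtain z u where zu: "q = (z, u)" by force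
    have "((\<lambda>\<mu>. (case pk \<mu> of (\<alpha>, \<beta>, k) \<Rightarrow> c \<alpha> \<beta> k * (\<Prod>j\<in>UNIV. (z $ j - z0 $ j) ^ \<alpha> j) * (\<Prod>j\<in>UNIV. cnj (z $ j - z0 $ j) ^ \<beta> j)
          * of_real (u - u0) ^ k)) has_sum of_real (\<phi> (z, u))) UNIV"
      by (rule has_sum_reindex_bij_betw[OF bij, THEN iffD2, OF hs]) (use that in \<open>simp add: zu q\<close>)
    then show ?thesis
      by (simp add: c'_def pk_def monomial_at_def prod zu q algebra_simps)
  qed
  \<comment> \<open>All entries are 1, which conjugation does not change, so the increments of z,
    cnj z and u along \<open>s *\<^sub>R w\<close> all equal s.\<close>
  define w :: "(complex ^ 'n) \<times> real" where "w = ((\<chi> j. 1), 1)"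
  define s where "s = e / (2 * (norm w + 1))"
  have nw: "norm w + 1 > 0" by (simp add: add_nonneg_pos)
  have s: "s > 0" using e nw by (simp add: s_def)
  have "norm (s *\<^sub>R w) < e"
  proof -
    have "norm (s *\<^sub>R w) \<le> s * (norm w + 1)" using s by simp
    also have "\<dots> = e / 2" unfolding s_def using less_imp_neq[OF nw] by (simp add: divide_simps)
    finally show ?thesis using e by simp
  qed
  then have "q0 + s *\<^sub>R w \<in> ball q0 e" by (simp add: dist_norm)
  from hs'[OF this] have "(\<lambda>\<mu>. c' \<mu> * monomial_at (z_zbar_u q0) \<mu> (z_zbar_u (q0 + s *\<^sub>R w))) summable_on UNIV"
    by (auto simp: summable_on_def)
  moreover have "monomial_at (z_zbar_u q0) \<mu> (z_zbar_u (q0 + s *\<^sub>R w)) = of_real s ^ (\<Sum>i\<in>UNIV. \<mu> i)" for \<mu>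
    unfolding monomial_at_def prod sum
    by (simp add: w_def q scaleR_conv_of_real[where 'a = complex] power_sum power_add)
  ultimately have "(\<lambda>\<mu>. c' \<mu> * of_real s ^ (\<Sum>i\<in>UNIV. \<mu> i)) summable_on UNIV"
    by (simp only:)
  then have "(\<lambda>\<mu>. norm (c' \<mu> * of_real s ^ (\<Sum>i\<in>UNIV. \<mu> i))) summable_on UNIV"
    by (rule summable_on_iff_abs_summable_on_complex[THEN iffD1])
  moreover have "norm (c' \<mu> * of_real s ^ (\<Sum>i\<in>UNIV. \<mu> i)) = norm (c' \<mu>) * s ^ (\<Sum>i\<in>UNIV. \<mu> i)" for \<mu>
    using s by (simp only: norm_mult norm_power norm_of_real abs_of_pos)
  ultimately have sm: "(\<lambda>\<mu>. norm (c' \<mu>) * s ^ (\<Sum>i\<in>UNIV. \<mu> i)) summable_on UNIV"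
    by (simp only:)
  obtain \<Phi> where \<Phi>: "holomorphic_fun_on \<Phi> (ball (z_zbar_u q0) (s/2))"
    "\<And>x. x \<in> ball (z_zbar_u q0) (s/2) \<Longrightarrow> ((\<lambda>\<mu>. c' \<mu> * monomial_at (z_zbar_u q0) \<mu> x) has_sum \<Phi> x) UNIV"
    by (rule holomorphic_power_series_sum[OF s sm, of "z_zbar_u q0"]) (rule that)
  obtain B where B: "B > 0" "\<And>x :: complex ^ (('n + 'n) option). norm (slice_re x) \<le> B * norm x"
    using linear_bounded_pos[OF linear_slice(1)] by blast
  \<comment> \<open>\<open>slice_re\<close> is a left inverse of \<open>z_zbar_u\<close>, so
    closeness of the images forces closeness of the points, and the original series is available at
    q.\<close>
  have sl: "slice_re (z_zbar_u q) = q" for q :: "(complex ^ 'n) \<times> real"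
    by (cases q) (simp add: slice_re_def vec_eq_iff)
  interpret Z: linear z_zbar_u by (rule linear_z_zbar_u)
  show ?thesis
  proof (rule that[of "min (s/2) (e/B)" \<Phi>])
    show "min (s/2) (e/B) > 0" using s e B by simp
    show "holomorphic_fun_on \<Phi> (ball (z_zbar_u q0) (min (s/2) (e/B)))"
      by (rule holomorphic_fun_on_subset[OF \<Phi>(1)]) auto
    fix q assume qb: "z_zbar_u q \<in> ball (z_zbar_u q0) (min (s/2) (e/B))"
    have "norm (q0 - q) \<le> B * norm (z_zbar_u (q0 - q))" using B(2)[of "z_zbar_u (q0 - q)"] by (simp add: sl)
    also have "\<dots> < B * (e / B)" using qb B(1) by (intro mult_strict_left_mono) (auto simp: Z.diff dist_norm)
    also have "\<dots> = e" using B by simp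
    finally have "q \<in> ball q0 e" by (simp add: dist_norm)
    from has_sum_unique[OF \<Phi>(2) hs'[OF this]] qb show "\<Phi> (z_zbar_u q) = of_real (\<phi> q)" by simp
  qed
qed

section \<open>Algebraic dependence by counting monomials\<close>

text \<open>Gaussian elimination, one equation at a time: an unknown with nonzero coefficient in the
  new equation is solved for and eliminated from the others.\<close>

lemma homogeneous_system_solution:
  fixes a :: "'e \<Rightarrow> 't \<Rightarrow> 'a::field"
  assumes "finite T" "finite E" "card T < card E"
  obtains c where "\<exists>\<mu>\<in>E. c \<mu> \<noteq> 0" "\<And>\<nu>. \<nu> \<in> T \<Longrightarrow> (\<Sum>\<mu>\<in>E. c \<mu> * a \<mu> \<nu>) = 0"
proof -
  have "\<exists>c. (\<exists>\<mu>\<in>E. c \<mu> \<noteq> 0) \<and> (\<forall>\<nu>\<in>T. (\<Sum>\<mu>\<in>E. c \<mu> * a \<mu> \<nu>) = 0)"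
    using assms
  proof (induction T arbitrary: E a rule: finite_induct)
    case empty
    then have "E \<noteq> {}" by auto
    then show ?case by (intro exI[of _ "\<lambda>_. 1"]) auto
  next
    case (insert t T)
    show ?case
    proof (cases "\<forall>\<mu>\<in>E. a \<mu> t = 0")
      case True
      have "card T < card E" using insert by simp
      from insert.IH[OF insert.prems(1) this, of a] True show ?thesis by (auto intro!: exI)
    next
      case False
      then obtain \<mu>0 where \<mu>0: "\<mu>0 \<in> E" "a \<mu>0 t \<noteq> 0" by blast
      define a' where "a' = (\<lambda>\<mu> \<nu>. a \<mu> \<nu> - a \<mu> t / a \<mu>0 t * a \<mu>0 \<nu>)"
      have "card T < card (E - {\<mu>0})" using insert \<mu>0 by simp
      from insert.IH[OF _ this, of a'] insert.prems obtain c where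
        c: "\<exists>\<mu>\<in>E - {\<mu>0}. c \<mu> \<noteq> 0" "\<forall>\<nu>\<in>T. (\<Sum>\<mu>\<in>E - {\<mu>0}. c \<mu> * a' \<mu> \<nu>) = 0" by auto
      \<comment> \<open>The value of the eliminated unknown that equation t forces.\<close>
      define s where "s = - (\<Sum>\<mu>\<in>E - {\<mu>0}. c \<mu> * a \<mu> t) / a \<mu>0 t"
      define d where "d = c(\<mu>0 := s)"
      have sum_d: "(\<Sum>\<mu>\<in>E. d \<mu> * a \<mu> \<nu>) = s * a \<mu>0 \<nu> + (\<Sum>\<mu>\<in>E - {\<mu>0}. c \<mu> * a \<mu> \<nu>)" for \<nu>
      proof -
        have "(\<Sum>\<mu>\<in>E. d \<mu> * a \<mu> \<nu>) = d \<mu>0 * a \<mu>0 \<nu> + (\<Sum>\<mu>\<in>E - {\<mu>0}. d \<mu> * a \<mu> \<nu>)"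
          using insert.prems(1) \<mu>0(1) by (rule sum.remove)
        also have "(\<Sum>\<mu>\<in>E - {\<mu>0}. d \<mu> * a \<mu> \<nu>) = (\<Sum>\<mu>\<in>E - {\<mu>0}. c \<mu> * a \<mu> \<nu>)"
          by (rule sum.cong) (auto simp: d_def)
        finally show ?thesis by (simp add: d_def)
      qed
      have "(\<Sum>\<mu>\<in>E. d \<mu> * a \<mu> t) = 0" unfolding sum_d using \<mu>0(2) by (simp add: s_def)
      moreover have "(\<Sum>\<mu>\<in>E. d \<mu> * a \<mu> \<nu>) = 0" if "\<nu> \<in> T" for \<nu>
      proof -
        have "(\<Sum>\<mu>\<in>E - {\<mu>0}. c \<mu> * a' \<mu> \<nu>) =
            (\<Sum>\<mu>\<in>E - {\<mu>0}. c \<mu> * a \<mu> \<nu>) - (\<Sum>\<mu>\<in>E - {\<mu>0}. c \<mu> * a \<mu> t) / a \<mu>0 t * a \<mu>0 \<nu>"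
          by (simp add: a'_def right_diff_distrib sum_subtractf sum_divide_distrib sum_distrib_right mult.assoc)
        then show ?thesis unfolding sum_d using c(2) that by (simp add: s_def)
      qed
      moreover have "\<exists>\<mu>\<in>E. d \<mu> \<noteq> 0" using c(1) by (auto simp: d_def)
      ultimately show ?thesis by (intro exI[of _ d]) auto
    qed
  qed
  then show ?thesis using that by blast
qed

text \<open>Polynomials are kept as functions together with a derivation of their polynomiality:
  substituting parameters is then application, and degree bounds and differentiation follow the four
  rules.\<close>

inductive poly_fun :: "'i set \<Rightarrow> (('i \<Rightarrow> complex) \<Rightarrow> complex) \<Rightarrow> bool" for S where
  poly_fun_const: "poly_fun S (\<lambda>e. c)"
| poly_fun_var: "i \<in> S \<Longrightarrow> poly_fun S (\<lambda>e. e i)"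
| poly_fun_add: "poly_fun S f \<Longrightarrow> poly_fun S g \<Longrightarrow> poly_fun S (\<lambda>e. f e + g e)"
| poly_fun_mult: "poly_fun S f \<Longrightarrow> poly_fun S g \<Longrightarrow> poly_fun S (\<lambda>e. f e * g e)"

lemma poly_fun_mono: "poly_fun S f \<Longrightarrow> S \<subseteq> T \<Longrightarrow> poly_fun T f"
  by (induction rule: poly_fun.induct) (auto intro: poly_fun.intros)

lemma poly_fun_diff: "poly_fun S f \<Longrightarrow> poly_fun S g \<Longrightarrow> poly_fun S (\<lambda>e. f e - g e)"
  using poly_fun_add[OF _ poly_fun_mult[OF poly_fun_const[of S "-1"]], of f g] by simp

lemma poly_fun_sum: "(\<And>k. k \<in> I \<Longrightarrow> poly_fun S (f k)) \<Longrightarrow> poly_fun S (\<lambda>e. \<Sum>k\<in>I. f k e)"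
  by (induction I rule: infinite_finite_induct) (auto intro: poly_fun.intros)

text \<open>The degree is bounded by C in each variable separately. The admissible exponents then
  form a box with (C + 1) ^ card S elements, and under products the bounds add.\<close>

inductive box_poly :: "'i set \<Rightarrow> nat \<Rightarrow> (('i \<Rightarrow> complex) \<Rightarrow> complex) \<Rightarrow> bool" for S C where
  box_poly_zero: "box_poly S C (\<lambda>e. 0)"
| box_poly_step: "\<nu> \<in> S \<rightarrow>\<^sub>E {..C} \<Longrightarrow> box_poly S C f \<Longrightarrow> box_poly S C (\<lambda>e. c * (\<Prod>i\<in>S. e i ^ \<nu> i) + f e)"

lemma box_poly_coeffs:
  assumes "box_poly S C f" "finite S"
  shows "\<exists>a. \<forall>e. f e = (\<Sum>\<nu>\<in>S \<rightarrow>\<^sub>E {..C}. a \<nu> * (\<Prod>i\<in>S. e i ^ \<nu> i))"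
  using assms(1)
proof induction
  case box_poly_zero
  then show ?case by (intro exI[of _ "\<lambda>_. 0"]) simp
next
  case (box_poly_step \<nu> f c)
  then obtain a where a: "\<And>e. f e = (\<Sum>\<nu>\<in>S \<rightarrow>\<^sub>E {..C}. a \<nu> * (\<Prod>i\<in>S. e i ^ \<nu> i))" by blast
  have fin: "finite (S \<rightarrow>\<^sub>E {..C})" using assms(2) by (simp add: finite_PiE)
  have "c * (\<Prod>i\<in>S. e i ^ \<nu> i) + f e = (\<Sum>\<nu>'\<in>S \<rightarrow>\<^sub>E {..C}. (a \<nu>' + (if \<nu>' = \<nu> then c else 0)) * (\<Prod>i\<in>S. e i ^ \<nu>' i))" for e
    using box_poly_step.hyps(1) fin by (simp add: a distrib_right sum.distrib if_distrib[of "\<lambda>y. y * _"] cong: if_cong)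
  then show ?case by (intro exI[of _ "\<lambda>\<nu>'. a \<nu>' + (if \<nu>' = \<nu> then c else 0)"] allI)
qed

lemma box_poly_mono: "box_poly S C f \<Longrightarrow> C \<le> C' \<Longrightarrow> box_poly S C' f"
proof (induction rule: box_poly.induct)
  case (box_poly_step \<nu> f c)
  have "\<nu> \<in> S \<rightarrow>\<^sub>E {..C'}"
    by (rule subsetD[OF PiE_mono box_poly_step.hyps(1)]) (use box_poly_step.prems in auto)
  then show ?case using box_poly_step.IH[OF box_poly_step.prems] by (rule box_poly.box_poly_step)
qed (rule box_poly_zero)

lemma box_poly_add: "box_poly S C f \<Longrightarrow> box_poly S C g \<Longrightarrow> box_poly S C (\<lambda>e. f e + g e)"
  by (induction rule: box_poly.induct) (auto simp: add.assoc intro: box_poly_step)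

lemma box_poly_monomial_mult:
  assumes \<nu>: "\<nu> \<in> S \<rightarrow>\<^sub>E {..C}" and "box_poly S C' g"
  shows "box_poly S (C + C') (\<lambda>e. c * (\<Prod>i\<in>S. e i ^ \<nu> i) * g e)"
  using assms(2)
proof induction
  case (box_poly_step \<nu>' g c')
  define \<kappa> where "\<kappa> = restrict (\<lambda>i. \<nu> i + \<nu>' i) S"
  have "\<kappa> \<in> S \<rightarrow>\<^sub>E {..C + C'}" using \<nu> box_poly_step.hyps by (auto simp: \<kappa>_def PiE_iff intro: add_mono)
  from box_poly.box_poly_step[OF this box_poly_step.IH, of "c * c'"]
  show ?case by (simp add: \<kappa>_def power_add prod.distrib algebra_simps)
qed (simp add: box_poly_zero)

lemma box_poly_mult: "box_poly S C f \<Longrightarrow> box_poly S C' g \<Longrightarrow> box_poly S (C + C') (\<lambda>e. f e * g e)"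
  by (induction rule: box_poly.induct)
     (auto simp: distrib_right intro: box_poly_zero box_poly_add box_poly_monomial_mult)

lemma box_poly_const: "box_poly S C (\<lambda>e. c)"
proof -
  have "(\<lambda>i\<in>S. 0) \<in> S \<rightarrow>\<^sub>E {..C}" by auto
  from box_poly_step[OF this box_poly_zero, of c] show ?thesis by simp
qed

lemma box_poly_var: "finite S \<Longrightarrow> i \<in> S \<Longrightarrow> box_poly S 1 (\<lambda>e. e i)"
proof -
  assume S: "finite S" "i \<in> S"
  have "(\<lambda>j\<in>S. if j = i then 1 else 0 :: nat) \<in> S \<rightarrow>\<^sub>E {..1}" by auto
  from box_poly_step[OF this box_poly_zero, of 1] show ?thesis
    using S by (simp add: if_distrib[of "\<lambda>n. _ ^ n"] prod.delta cong: if_cong)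
qed

lemma box_poly_power: "box_poly S C f \<Longrightarrow> box_poly S (C * n) (\<lambda>e. f e ^ n)"
  by (induction n) (auto intro: box_poly_const box_poly_mult)

lemma box_poly_prod:
  "(\<And>j. j \<in> J \<Longrightarrow> box_poly S C (f j)) \<Longrightarrow> box_poly S (C * card J) (\<lambda>e. \<Prod>j\<in>J. f j e)"
proof (induction J rule: infinite_finite_induct)
  case (insert j J)
  then show ?case using box_poly_mult[of S C "f j" "C * card J"] by simp
qed (auto intro: box_poly_const)

lemma poly_fun_imp_box_poly:
  assumes "poly_fun S f" "finite S"
  shows "\<exists>C. box_poly S C f"
  using assms(1)
proof induction
  case (poly_fun_add f g)
  then obtain C1 C2 where "box_poly S C1 f" "box_poly S C2 g" by blast
  then show ?case
    by (intro exI[of _ "max C1 C2"] box_poly_add) (auto intro: box_poly_mono)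
next
  case (poly_fun_mult f g)
  then show ?case by (auto dest: box_poly_mult)
next
  case (poly_fun_const c)
  show ?case by (rule exI[of _ 0]) (rule box_poly_const)
next
  case (poly_fun_var i)
  then show ?case by (intro exI[of _ 1] box_poly_var assms(2))
qed

text \<open>The choice d = (A + 1)^K gives (A d + 1)^K \<le> (A + 1)^K (d + 1)^K = d (d + 1)^K < (d
  + 1)^(K + 1), so the higher exponent wins whatever the factor A is.\<close>

lemma box_count:
  fixes A K M :: nat
  assumes "K < M"
  obtains d where "(A * d + 1) ^ K < (d + 1) ^ M"
proof
  define d where "d = (A + 1) ^ K"
  have "(A * d + 1) ^ K \<le> ((A + 1) * (d + 1)) ^ K" by (intro power_mono) auto
  also have "\<dots> = d * (d + 1) ^ K" by (simp only: power_mult_distrib d_def)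
  also have "\<dots> < (d + 1) ^ Suc K" by simp
  also have "\<dots> \<le> (d + 1) ^ M" using assms by (intro power_increasing) auto
  finally show "(A * d + 1) ^ K < (d + 1) ^ M" .
qed

text \<open>There are more monomials of degree at most \<open>d\<close> in the \<open>p j\<close> than monomials in the variables
  \<open>S\<close> that can occur in them, once \<open>d\<close> is large.\<close>

lemma algebraic_dependence:
  assumes S: "finite S" and J: "finite J" "card S < card J" and p: "\<And>j. j \<in> J \<Longrightarrow> poly_fun S (p j)"
  obtains d c where "\<exists>\<mu>\<in>J \<rightarrow>\<^sub>E {..d}. c \<mu> \<noteq> (0::complex)"
    "\<And>e. (\<Sum>\<mu>\<in>J \<rightarrow>\<^sub>E {..d}. c \<mu> * (\<Prod>j\<in>J. p j e ^ \<mu> j)) = 0"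
proof -
  have "\<forall>j\<in>J. \<exists>C. box_poly S C (p j)" using p poly_fun_imp_box_poly S by blast
  then obtain Cf where Cf: "\<And>j. j \<in> J \<Longrightarrow> box_poly S (Cf j) (p j)" by metis
  define C where "C = Max (Cf ` J)"
  have C: "box_poly S C (p j)" if "j \<in> J" for j
    by (rule box_poly_mono[OF Cf[OF that]]) (use J that in \<open>simp add: C_def\<close>)
  \<comment> \<open>A product of the \<open>p j\<close> with exponents at most d has degree at most
    C * card J * d in each variable of S. The left side counts the monomials available to it, the
    right side the products.\<close>
  obtain d where d: "(C * card J * d + 1) ^ card S < (d + 1) ^ card J" using box_count[OF J(2)] by blast
  let ?B = "S \<rightarrow>\<^sub>E {..C * card J * d}" and ?E = "J \<rightarrow>\<^sub>E {..d}"
  have "\<exists>a. \<forall>e. (\<Prod>j\<in>J. p j e ^ \<mu> j) = (\<Sum>\<nu>\<in>?B. a \<nu> * (\<Prod>i\<in>S. e i ^ \<nu> i))" if "\<mu> \<in> ?E" for \<mu>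
  proof (rule box_poly_coeffs[OF _ S])
    have "box_poly S (C * d) (\<lambda>e. p j e ^ \<mu> j)" if "j \<in> J" for j
      by (rule box_poly_mono[OF box_poly_power[OF C[OF that]]]) (use \<open>\<mu> \<in> ?E\<close> that in \<open>auto simp: PiE_iff\<close>)
    from box_poly_prod[of J S "C * d", OF this] show "box_poly S (C * card J * d) (\<lambda>e. \<Prod>j\<in>J. p j e ^ \<mu> j)"
      by (simp add: mult.commute mult.left_commute)
  qed
  then have "\<forall>\<mu>\<in>?E. \<exists>a. \<forall>e. (\<Prod>j\<in>J. p j e ^ \<mu> j) = (\<Sum>\<nu>\<in>?B. a \<nu> * (\<Prod>i\<in>S. e i ^ \<nu> i))" by blast
  from bchoice[OF this] obtain a where
    a: "\<And>\<mu> e. \<mu> \<in> ?E \<Longrightarrow> (\<Prod>j\<in>J. p j e ^ \<mu> j) = (\<Sum>\<nu>\<in>?B. a \<mu> \<nu> * (\<Prod>i\<in>S. e i ^ \<nu> i))" by blast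
  have "finite ?B" "finite ?E" using S J by (auto intro: finite_PiE)
  moreover have "card ?B < card ?E" using S J d by (simp add: card_PiE)
  ultimately obtain c where c: "\<exists>\<mu>\<in>?E. c \<mu> \<noteq> 0" "\<And>\<nu>. \<nu> \<in> ?B \<Longrightarrow> (\<Sum>\<mu>\<in>?E. c \<mu> * a \<mu> \<nu>) = 0"
    using homogeneous_system_solution[of ?B ?E a] by metis
  have "(\<Sum>\<mu>\<in>?E. c \<mu> * (\<Prod>j\<in>J. p j e ^ \<mu> j)) = 0" for e
  proof -
    have "(\<Sum>\<mu>\<in>?E. c \<mu> * (\<Prod>j\<in>J. p j e ^ \<mu> j)) = (\<Sum>\<mu>\<in>?E. \<Sum>\<nu>\<in>?B. c \<mu> * a \<mu> \<nu> * (\<Prod>i\<in>S. e i ^ \<nu> i))"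
      by (intro sum.cong) (simp_all add: a sum_distrib_left mult.assoc)
    also have "\<dots> = (\<Sum>\<nu>\<in>?B. (\<Sum>\<mu>\<in>?E. c \<mu> * a \<mu> \<nu>) * (\<Prod>i\<in>S. e i ^ \<nu> i))"
      by (subst sum.swap) (simp add: sum_distrib_right)
    finally show ?thesis using c(2) by simp
  qed
  with c(1) that show ?thesis by blast
qed

text \<open>Induction on the variables: the coefficient of a suitable power of the new variable is
  nonzero at some v, and fixing the other variables there leaves a nonzero one-variable
  polynomial.\<close>

lemma box_polynomial_nonvanishing:
  fixes c :: "('j \<Rightarrow> nat) \<Rightarrow> complex"
  assumes "finite J" "\<mu>0 \<in> J \<rightarrow>\<^sub>E {..d}" "c \<mu>0 \<noteq> 0"
  shows "\<exists>v. (\<Sum>\<mu>\<in>J \<rightarrow>\<^sub>E {..d}. c \<mu> * (\<Prod>j\<in>J. v j ^ \<mu> j)) \<noteq> 0"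
  using assms
proof (induction J arbitrary: c \<mu>0 rule: finite_induct)
  case (insert j J)
  have im: "insert j J \<rightarrow>\<^sub>E {..d} = (\<lambda>(y, g). g(j := y)) ` ({..d} \<times> (J \<rightarrow>\<^sub>E {..d}))"
    by (rule PiE_insert_eq)
  have inj: "inj_on (\<lambda>(y, g). g(j := y)) ({..d} \<times> (J \<rightarrow>\<^sub>E {..d}))"
    using inj_combinator[OF insert.hyps(2), of "\<lambda>_. {..d}"] by simp
  obtain k0 g0 where g0: "\<mu>0 = g0(j := k0)" "k0 \<le> d" "g0 \<in> J \<rightarrow>\<^sub>E {..d}"
    using insert.prems(1) unfolding im by auto
  obtain v where v: "(\<Sum>g\<in>J \<rightarrow>\<^sub>E {..d}. c (g(j := k0)) * (\<Prod>i\<in>J. v i ^ g i)) \<noteq> 0"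
    using insert.IH[OF g0(3), of "\<lambda>g. c (g(j := k0))"] insert.prems(2) unfolding g0(1) by blast
  define b where "b k = (\<Sum>g\<in>J \<rightarrow>\<^sub>E {..d}. c (g(j := k)) * (\<Prod>i\<in>J. v i ^ g i))" for k
  have "\<not> (\<forall>t. (\<Sum>k\<le>d. b k * t ^ k) = 0)"
    unfolding polyfun_eq_0 using v g0(2) by (auto simp: b_def)
  then obtain t where t: "(\<Sum>k\<le>d. b k * t ^ k) \<noteq> 0" by blast
  have "(\<Sum>\<mu>\<in>insert j J \<rightarrow>\<^sub>E {..d}. c \<mu> * (\<Prod>i\<in>insert j J. (v(j := t)) i ^ \<mu> i)) =
      (\<Sum>(k, g)\<in>{..d} \<times> (J \<rightarrow>\<^sub>E {..d}). c (g(j := k)) * (t ^ k * (\<Prod>i\<in>J. v i ^ g i)))"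
    unfolding im
  proof (subst sum.reindex[OF inj], rule sum.cong[OF refl])
    fix x assume "x \<in> {..d} \<times> (J \<rightarrow>\<^sub>E {..d})"
    obtain k g where x: "x = (k, g)" by force
    have "(\<Prod>i\<in>J. (v(j := t)) i ^ (g(j := k)) i) = (\<Prod>i\<in>J. v i ^ g i)"
      by (rule prod.cong) (use insert.hyps(2) in auto)
    then show "((\<lambda>\<mu>. c \<mu> * (\<Prod>i\<in>insert j J. (v(j := t)) i ^ \<mu> i)) \<circ> (\<lambda>(y, g). g(j := y))) x =
       (case x of (k, g) \<Rightarrow> c (g(j := k)) * (t ^ k * (\<Prod>i\<in>J. v i ^ g i)))"
      using insert.hyps by (simp add: x)
  qed
  also have "\<dots> = (\<Sum>k\<le>d. b k * t ^ k)"
    unfolding sum.cartesian_product[symmetric] b_def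
    by (simp add: sum_distrib_right sum_distrib_left ac_simps)
  finally show ?case using t by metis
qed simp

section \<open>Jet polynomials\<close>

definition jet_monomial :: "('r \<Rightarrow> nat) set \<Rightarrow> (('r \<Rightarrow> nat) \<Rightarrow> nat) \<Rightarrow> ('r jet_coord \<Rightarrow>\<^sub>0 nat)" where
  "jet_monomial J \<mu> = Abs_poly_mapping (\<lambda>x. case x of Indep _ \<Rightarrow> 0 | Jet \<alpha> \<Rightarrow> if \<alpha> \<in> J then \<mu> \<alpha> else 0)"

definition jet_polynomial ::
    "('r \<Rightarrow> nat) set \<Rightarrow> nat \<Rightarrow> ((('r \<Rightarrow> nat) \<Rightarrow> nat) \<Rightarrow> complex) \<Rightarrow> 'r jet_poly" where
  "jet_polynomial J d c = (\<Sum>\<mu>\<in>J \<rightarrow>\<^sub>E {..d}. Poly_Mapping.single (jet_monomial J \<mu>) (c \<mu>))"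

lemma lookup_jet_monomial:
  assumes "finite J"
  shows "Poly_Mapping.lookup (jet_monomial J \<mu>) x = (case x of Indep _ \<Rightarrow> 0 | Jet \<alpha> \<Rightarrow> if \<alpha> \<in> J then \<mu> \<alpha> else 0)"
proof -
  have "{x. (case x of Indep _ \<Rightarrow> 0 | Jet \<alpha> \<Rightarrow> if \<alpha> \<in> J then \<mu> \<alpha> else 0) \<noteq> 0} \<subseteq> Jet ` J"
  proof
    fix x assume "x \<in> {x. (case x of Indep _ \<Rightarrow> 0 | Jet \<alpha> \<Rightarrow> if \<alpha> \<in> J then \<mu> \<alpha> else 0) \<noteq> 0}"
    then show "x \<in> Jet ` J" by (cases x) (auto split: if_splits)
  qed
  then have "finite {x. (case x of Indep _ \<Rightarrow> 0 | Jet \<alpha> \<Rightarrow> if \<alpha> \<in> J then \<mu> \<alpha> else 0) \<noteq> 0}"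
    using assms finite_subset by blast
  then show ?thesis unfolding jet_monomial_def by (subst lookup_Abs_poly_mapping) auto
qed

lemma keys_jet_monomial:
  assumes "finite J"
  shows "Poly_Mapping.keys (jet_monomial J \<mu>) = Jet ` {\<alpha>\<in>J. \<mu> \<alpha> \<noteq> 0}"
  by (auto simp: in_keys_iff lookup_jet_monomial[OF assms] split: jet_coord.splits if_splits)

lemma inj_on_jet_monomial:
  assumes "finite J"
  shows "inj_on (jet_monomial J) (J \<rightarrow>\<^sub>E {..d})"
proof (rule inj_onI)
  fix \<mu> \<nu> assume \<mu>\<nu>: "\<mu> \<in> J \<rightarrow>\<^sub>E {..d}" "\<nu> \<in> J \<rightarrow>\<^sub>E {..d}" "jet_monomial J \<mu> = jet_monomial J \<nu>"
  have "\<mu> \<alpha> = \<nu> \<alpha>" if "\<alpha> \<in> J" for \<alpha>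
    using arg_cong[OF \<mu>\<nu>(3), of "\<lambda>m. Poly_Mapping.lookup m (Jet \<alpha>)"] that
    by (simp add: lookup_jet_monomial[OF assms])
  then show "\<mu> = \<nu>" using \<mu>\<nu> by (intro PiE_ext)
qed

lemma keys_jet_polynomial:
  "Poly_Mapping.keys (jet_polynomial J d c) \<subseteq> jet_monomial J ` (J \<rightarrow>\<^sub>E {..d})"
proof -
  have "Poly_Mapping.keys (jet_polynomial J d c)
     \<subseteq> (\<Union>\<mu>\<in>J \<rightarrow>\<^sub>E {..d}. Poly_Mapping.keys (Poly_Mapping.single (jet_monomial J \<mu>) (c \<mu>)))"
    unfolding jet_polynomial_def by (rule keys_sum)
  then show ?thesis by (auto split: if_splits)
qed

lemma jet_poly_coords_jet_polynomial:
  assumes "finite J"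
  shows "jet_poly_coords (jet_polynomial J d c) \<subseteq> Jet ` J"
proof
  fix x assume "x \<in> jet_poly_coords (jet_polynomial J d c)"
  then obtain m where m: "m \<in> Poly_Mapping.keys (jet_polynomial J d c)" "x \<in> Poly_Mapping.keys m"
    unfolding jet_poly_coords_def by blast
  from subsetD[OF keys_jet_polynomial m(1)] obtain \<mu> where "m = jet_monomial J \<mu>" by blast
  with m(2) show "x \<in> Jet ` J" by (auto simp: keys_jet_monomial[OF assms])
qed

text \<open>Distinct exponents give distinct monomials, so no coefficients merge. The finite
  supports in the definition of the operator drop only zero coefficients and zeroth powers, which
  changes neither sum nor product.\<close>

lemma diff_alg_op_jet_polynomial:
  assumes J: "finite J"
  shows "diff_alg_op (jet_polynomial J d c) \<rho> x
     = (\<Sum>\<mu>\<in>J \<rightarrow>\<^sub>E {..d}. c \<mu> * (\<Prod>\<alpha>\<in>J. mixed_partial \<alpha> \<rho> x ^ \<mu> \<alpha>))"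
proof -
  let ?E = "J \<rightarrow>\<^sub>E {..d}" and ?P = "jet_polynomial J d c"
  let ?m = "\<lambda>m. \<Prod>c\<in>Poly_Mapping.keys m. jet_coord_value \<rho> x c ^ Poly_Mapping.lookup m c"
  have fin: "finite ?E" using J by (simp add: finite_PiE)
  have lk: "Poly_Mapping.lookup ?P (jet_monomial J \<mu>) = c \<mu>" if \<mu>: "\<mu> \<in> ?E" for \<mu>
  proof -
    have "Poly_Mapping.lookup ?P (jet_monomial J \<mu>) = (\<Sum>\<nu>\<in>?E. if \<nu> = \<mu> then c \<nu> else 0)"
      unfolding jet_polynomial_def lookup_sum
      by (rule sum.cong) (use inj_onD[OF inj_on_jet_monomial[OF J] _ _ \<mu>] in \<open>auto simp: lookup_single when_def\<close>)
    then show ?thesis using fin \<mu> by simp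
  qed
  have mm: "?m (jet_monomial J \<mu>) = (\<Prod>\<alpha>\<in>J. mixed_partial \<alpha> \<rho> x ^ \<mu> \<alpha>)" for \<mu>
  proof -
    have "?m (jet_monomial J \<mu>) = (\<Prod>\<alpha>\<in>{\<alpha>\<in>J. \<mu> \<alpha> \<noteq> 0}. mixed_partial \<alpha> \<rho> x ^ \<mu> \<alpha>)"
      unfolding keys_jet_monomial[OF J] by (subst prod.reindex) (auto simp: inj_on_def lookup_jet_monomial[OF J] intro!: prod.cong)
    also have "\<dots> = (\<Prod>\<alpha>\<in>J. mixed_partial \<alpha> \<rho> x ^ \<mu> \<alpha>)"
      by (rule prod.mono_neutral_left) (use J in auto)
    finally show ?thesis .
  qed
  have "diff_alg_op ?P \<rho> x = (\<Sum>m\<in>jet_monomial J ` ?E. Poly_Mapping.lookup ?P m * ?m m)"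
    unfolding diff_alg_op_def
    by (rule sum.mono_neutral_left) (use fin keys_jet_polynomial[of J d c] in \<open>auto simp: in_keys_iff subset_iff\<close>)
  also have "\<dots> = (\<Sum>\<mu>\<in>?E. c \<mu> * (\<Prod>\<alpha>\<in>J. mixed_partial \<alpha> \<rho> x ^ \<mu> \<alpha>))"
    unfolding sum.reindex[OF inj_on_jet_monomial[OF J]] by (rule sum.cong) (simp_all add: lk mm)
  finally show ?thesis .
qed

section \<open>Mixed partial derivatives\<close>

text \<open>Flattens the chosen enumeration of the variables into a list of single derivatives, fit
  for induction; its set and length record which variables occur and how many derivatives are
  taken.\<close>

lemma mixed_partial_as_foldr:
  fixes \<alpha> :: "'r::finite \<Rightarrow> nat"
  obtains L where "\<And>f. mixed_partial \<alpha> f = foldr cpartial L f" "set L = {i. \<alpha> i \<noteq> 0}" "length L = jet_order \<alpha>"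
proof -
  have "\<exists>L. (\<forall>f. fold (\<lambda>i. cpartial i ^^ \<alpha> i) is f = foldr cpartial L f)
      \<and> set L = {i\<in>set is. \<alpha> i \<noteq> 0} \<and> length L = sum_list (map \<alpha> is)" for "is" :: "'r list"
  proof (induction "is")
    case (Cons i "is")
    then obtain L where L: "\<And>f. fold (\<lambda>i. cpartial i ^^ \<alpha> i) is f = foldr cpartial L f"
      "set L = {i\<in>set is. \<alpha> i \<noteq> 0}" "length L = sum_list (map \<alpha> is)" by blast
    have "(cpartial i ^^ n) f = foldr cpartial (replicate n i) f" for n f
      by (induction n) auto
    \<comment> \<open>\<open>fold\<close> applies the first variable first, whereas
      \<open>foldr\<close> applies the last list entry first; hence the new block goes to the
      end.\<close>
    then show ?case
      by (intro exI[of _ "L @ replicate (\<alpha> i) i"]) (use L in auto)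
  qed auto
  moreover define is' where "is' = (SOME is. distinct is \<and> set is = (UNIV :: 'r set))"
  have "\<exists>is. distinct is \<and> set is = (UNIV :: 'r set)" using finite_distinct_list[of "UNIV :: 'r set"] by auto
  then have is': "distinct is'" "set is' = UNIV" unfolding is'_def by (metis (mono_tags, lifting) someI_ex)+
  ultimately obtain L where "\<And>f. fold (\<lambda>i. cpartial i ^^ \<alpha> i) is' f = foldr cpartial L f"
    "set L = {i\<in>set is'. \<alpha> i \<noteq> 0}" "length L = sum_list (map \<alpha> is')" by meson
  with is' show ?thesis
    by (intro that[of L]) (auto simp: mixed_partial_def is'_def jet_order_def sum_list_distinct_conv_sum_set simp flip: is'_def)
qed

text \<open>The falling factorial a (a - 1) ... (a - n + 1). Truncated subtraction is harmless: for
  a < n the factor with l = a is already 0.\<close>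

definition falling :: "nat \<Rightarrow> nat \<Rightarrow> complex" where
  "falling a n = (\<Prod>l<n. of_nat (a - l))"

lemma falling_eq_0: "falling a n = 0 \<longleftrightarrow> a < n"
  by (auto simp: falling_def)

lemma cpartial_sum_monomials:
  assumes "finite I"
  shows "cpartial i (\<lambda>x. \<Sum>k\<in>I. b k * monomial_at x0 (m k) x)
     = (\<lambda>x. \<Sum>k\<in>I. b k * of_nat (m k i) * monomial_at x0 ((m k)(i := m k i - 1)) x)"
proof
  fix x
  show "cpartial i (\<lambda>x. \<Sum>k\<in>I. b k * monomial_at x0 (m k) x) x
     = (\<Sum>k\<in>I. b k * of_nat (m k i) * monomial_at x0 ((m k)(i := m k i - 1)) x)"
    unfolding cpartial_def mult.assoc by (intro DERIV_imp_deriv DERIV_sum DERIV_cmult DERIV_monomial_at)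
qed

lemma cpartial_power_sum_monomials:
  assumes "finite I"
  shows "(cpartial i ^^ n) (\<lambda>x. \<Sum>k\<in>I. b k * monomial_at x0 (m k) x)
     = (\<lambda>x. \<Sum>k\<in>I. b k * falling (m k i) n * monomial_at x0 ((m k)(i := m k i - n)) x)"
proof (induction n)
  case 0
  then show ?case by (simp add: falling_def)
next
  case (Suc n)
  have "(cpartial i ^^ Suc n) (\<lambda>x. \<Sum>k\<in>I. b k * monomial_at x0 (m k) x)
     = cpartial i (\<lambda>x. \<Sum>k\<in>I. b k * falling (m k i) n * monomial_at x0 ((m k)(i := m k i - n)) x)"
    by (simp only: funpow.simps o_apply Suc)
  also have "\<dots> = (\<lambda>x. \<Sum>k\<in>I. b k * falling (m k i) n * of_nat (((m k)(i := m k i - n)) i) *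
      monomial_at x0 (((m k)(i := m k i - n))(i := ((m k)(i := m k i - n)) i - 1)) x)"
    by (rule cpartial_sum_monomials[OF assms])
  finally show ?case by (simp add: falling_def fun_upd_def mult.assoc mult.commute mult.left_commute cong: if_cong)
qed

lemma fold_cpartial_sum_monomials:
  assumes "finite I" "distinct is"
  shows "fold (\<lambda>i. cpartial i ^^ \<beta> i) is (\<lambda>x. \<Sum>k\<in>I. b k * monomial_at x0 (m k) x)
     = (\<lambda>x. \<Sum>k\<in>I. b k * (\<Prod>i\<in>set is. falling (m k i) (\<beta> i)) *
          monomial_at x0 (\<lambda>i. if i \<in> set is then m k i - \<beta> i else m k i) x)"
  using assms(2)
proof (induction "is" arbitrary: b m)
  case (Cons i "is")
  define m' where "m' = (\<lambda>k. (m k)(i := m k i - \<beta> i))"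
  have "fold (\<lambda>i. cpartial i ^^ \<beta> i) (i # is) (\<lambda>x. \<Sum>k\<in>I. b k * monomial_at x0 (m k) x)
     = fold (\<lambda>i. cpartial i ^^ \<beta> i) is (\<lambda>x. \<Sum>k\<in>I. (b k * falling (m k i) (\<beta> i)) * monomial_at x0 (m' k) x)"
    by (simp add: cpartial_power_sum_monomials[OF assms(1)] m'_def)
  also have "\<dots> = (\<lambda>x. \<Sum>k\<in>I. (b k * falling (m k i) (\<beta> i)) * (\<Prod>j\<in>set is. falling (m' k j) (\<beta> j)) *
          monomial_at x0 (\<lambda>j. if j \<in> set is then m' k j - \<beta> j else m' k j) x)"
    using Cons by simp
  also have "(\<lambda>k. \<lambda>j. if j \<in> set is then m' k j - \<beta> j else m' k j)
      = (\<lambda>k. \<lambda>j. if j \<in> set (i # is) then m k j - \<beta> j else m k j)"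
    using Cons.prems by (auto simp: m'_def fun_eq_iff)
  also have "(\<lambda>k. \<Prod>j\<in>set is. falling (m' k j) (\<beta> j)) = (\<lambda>k. \<Prod>j\<in>set is. falling (m k j) (\<beta> j))"
    using Cons.prems by (intro ext prod.cong) (auto simp: m'_def)
  finally show ?case using Cons.prems by (simp add: mult.assoc)
qed simp

text \<open>A monomial with \<alpha> \<noteq> \<beta> contributes nothing: if some \<alpha> i <
  \<beta> i, a falling factorial is 0; otherwise a positive power remains and vanishes at the
  origin.\<close>

lemma mixed_partial_sum_monomials_0:
  fixes J :: "('r::finite \<Rightarrow> nat) set"
  assumes "finite J" "\<beta> \<in> J"
  shows "mixed_partial \<beta> (\<lambda>x. \<Sum>\<alpha>\<in>J. b \<alpha> * monomial_at 0 \<alpha> x) 0 = b \<beta> * (\<Prod>i\<in>UNIV. falling (\<beta> i) (\<beta> i))"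
proof -
  define is' where "is' = (SOME is. distinct is \<and> set is = (UNIV :: 'r set))"
  have "\<exists>is. distinct is \<and> set is = (UNIV :: 'r set)" using finite_distinct_list[of "UNIV :: 'r set"] by auto
  then have is': "distinct is'" "set is' = UNIV" unfolding is'_def by (metis (mono_tags, lifting) someI_ex)+
  have "mixed_partial \<beta> (\<lambda>x. \<Sum>\<alpha>\<in>J. b \<alpha> * monomial_at 0 \<alpha> x) 0
     = (\<Sum>\<alpha>\<in>J. b \<alpha> * (\<Prod>i\<in>UNIV. falling (\<alpha> i) (\<beta> i)) * monomial_at 0 (\<lambda>i. \<alpha> i - \<beta> i) 0)"
    unfolding mixed_partial_def is'_def[symmetric] fold_cpartial_sum_monomials[OF assms(1) is'(1), where m = "\<lambda>\<alpha>. \<alpha>"]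
    by (simp add: is')
  also have "\<dots> = (\<Sum>\<alpha>\<in>J. if \<alpha> = \<beta> then b \<beta> * (\<Prod>i\<in>UNIV. falling (\<beta> i) (\<beta> i)) else 0)"
  proof (rule sum.cong[OF refl])
    fix \<alpha> assume "\<alpha> \<in> J"
    show "b \<alpha> * (\<Prod>i\<in>UNIV. falling (\<alpha> i) (\<beta> i)) * monomial_at 0 (\<lambda>i. \<alpha> i - \<beta> i) 0
        = (if \<alpha> = \<beta> then b \<beta> * (\<Prod>i\<in>UNIV. falling (\<beta> i) (\<beta> i)) else 0)"
    proof (cases "\<alpha> = \<beta>")
      case False
      then obtain i where "\<alpha> i \<noteq> \<beta> i" by auto
      then consider "\<alpha> i < \<beta> i" | "\<alpha> i - \<beta> i \<noteq> 0" by linarith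
      then have "(\<Prod>i\<in>UNIV. falling (\<alpha> i) (\<beta> i)) = 0 \<or> monomial_at 0 (\<lambda>i. \<alpha> i - \<beta> i) 0 = 0"
        by cases (auto simp: falling_eq_0 monomial_at_def intro!: exI[of _ i])
      then show ?thesis using False by auto
    qed (simp add: monomial_at_def)
  qed
  finally show ?thesis using assms by simp
qed

text \<open>A polynomial \<rho> can have arbitrarily prescribed derivatives v \<alpha> at the
  origin, by taking v \<alpha> / \<alpha>! as coefficients. So it is enough that the polynomial in
  the jet variables is nonzero at some v.\<close>

lemma nonzero_op_jet_polynomial:
  fixes J :: "('r::finite \<Rightarrow> nat) set"
  assumes J: "finite J" and c: "\<exists>\<mu>\<in>J \<rightarrow>\<^sub>E {..d}. c \<mu> \<noteq> 0"
  shows "nonzero_op (jet_polynomial J d c)"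
proof -
  obtain v where v: "(\<Sum>\<mu>\<in>J \<rightarrow>\<^sub>E {..d}. c \<mu> * (\<Prod>\<alpha>\<in>J. v \<alpha> ^ \<mu> \<alpha>)) \<noteq> 0"
    using box_polynomial_nonvanishing[OF J] c by blast
  define b where "b \<alpha> = v \<alpha> / (\<Prod>i\<in>UNIV. falling (\<alpha> i) (\<alpha> i))" for \<alpha> :: "'r \<Rightarrow> nat"
  define \<rho> where "\<rho> = (\<lambda>x :: complex ^ 'r. \<Sum>\<alpha>\<in>J. b \<alpha> * monomial_at 0 \<alpha> x)"
  have "(\<Prod>i\<in>UNIV. falling (\<alpha> i) (\<alpha> i)) \<noteq> 0" for \<alpha> :: "'r \<Rightarrow> nat" by (simp add: falling_eq_0)
  then have "mixed_partial \<alpha> \<rho> 0 = v \<alpha>" if "\<alpha> \<in> J" for \<alpha>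
    unfolding \<rho>_def mixed_partial_sum_monomials_0[OF J that] by (simp add: b_def)
  then have "diff_alg_op (jet_polynomial J d c) \<rho> 0 \<noteq> 0"
    unfolding diff_alg_op_jet_polynomial[OF J] using v by simp
  moreover have "holomorphic_fun_on \<rho> UNIV"
    unfolding \<rho>_def by (intro holomorphic_fun_on_sum holomorphic_fun_on_cmult holomorphic_monomial_at)
  ultimately show ?thesis unfolding nonzero_op_def by (intro exI[of _ UNIV] exI[of _ \<rho>]) auto
qed

lemma cpartial_cong_open:
  assumes "open U" "x \<in> U" "\<And>y. y \<in> U \<Longrightarrow> f y = g y"
  shows "cpartial i f x = cpartial i g x"
proof -
  have "open ((\<lambda>t. x + axis i t) -` U)"
    by (intro open_vimage continuous_intros continuous_on_axis assms(1))
  moreover have "0 \<in> (\<lambda>t. x + axis i t) -` U" using assms(2) by simp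
  ultimately have "eventually (\<lambda>t. t \<in> (\<lambda>t. x + axis i t) -` U) (nhds 0)"
    by (rule eventually_nhds_in_open)
  then have "eventually (\<lambda>t. f (x + axis i t) = g (x + axis i t)) (nhds 0)"
    by eventually_elim (simp add: assms(3))
  then show ?thesis unfolding cpartial_def by (intro deriv_cong_ev) auto
qed

lemma holomorphic_funpow_cpartial:
  "holomorphic_fun_on f U \<Longrightarrow> open U \<Longrightarrow> holomorphic_fun_on ((cpartial i ^^ n) f) U"
  by (induction n) (auto intro: holomorphic_cpartial)

lemma cpartial_funpow_commute:
  assumes "holomorphic_fun_on f U" "open U" "x \<in> U"
  shows "cpartial j ((cpartial i ^^ n) f) x = (cpartial i ^^ n) (cpartial j f) x"
  using assms(3)
proof (induction n arbitrary: x)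
  case (Suc n)
  have "cpartial j ((cpartial i ^^ Suc n) f) x = cpartial i (cpartial j ((cpartial i ^^ n) f)) x"
    using cpartial_commute[OF holomorphic_funpow_cpartial[OF assms(1,2)] assms(2) Suc.prems] by simp
  also have "\<dots> = cpartial i ((cpartial i ^^ n) (cpartial j f)) x"
    by (rule cpartial_cong_open[OF assms(2) Suc.prems Suc.IH])
  finally show ?case by simp
qed simp

text \<open>Takes b derivatives in z at index \<open>j0\<close> and c in w, the only ones that arise
  from differentiating in the three chosen variables. With the w-derivatives outermost, one more of
  them needs no interchange, while one more in z does.\<close>

definition jet :: "'n \<Rightarrow> nat \<Rightarrow> nat \<Rightarrow> (complex ^ ('n::finite option) \<Rightarrow> complex) \<Rightarrow> complex ^ ('n option) \<Rightarrow> complex" where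
  "jet j0 b c f = (cpartial None ^^ c) ((cpartial (Some j0) ^^ b) f)"

lemma holomorphic_jet: "holomorphic_fun_on f U \<Longrightarrow> open U \<Longrightarrow> holomorphic_fun_on (jet j0 b c f) U"
  unfolding jet_def by (intro holomorphic_funpow_cpartial)

lemma cpartial_jet_None: "cpartial None (jet j0 b c f) = jet j0 b (Suc c) f"
  by (simp add: jet_def)

lemma cpartial_jet_Some:
  "holomorphic_fun_on f U \<Longrightarrow> open U \<Longrightarrow> x \<in> U \<Longrightarrow> cpartial (Some j0) (jet j0 b c f) x = jet j0 (Suc b) c f x"
  unfolding jet_def by (subst cpartial_funpow_commute[of _ U]) (auto intro: holomorphic_funpow_cpartial)

section \<open>The complexified mapping equation\<close>

text \<open>On the complexification of \<open>v = \<phi>(z, a, u)\<close> the variables \<open>(z, w)\<close> and their formal conjugates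
  \<open>(a, \<tau>)\<close> are \<open>(z, u + \<i>\<phi>)\<close> and \<open>(a, u - \<i>\<phi>)\<close>.\<close>

definition left_map :: "(complex ^ (('n::finite + 'n) option) \<Rightarrow> complex) \<Rightarrow> complex ^ (('n + 'n) option) \<Rightarrow> complex ^ ('n option)" where
  "left_map \<Phi> x = (\<chi> i. case i of None \<Rightarrow> x $ None + \<i> * \<Phi> x | Some j \<Rightarrow> x $ Some (Inl j))"

definition right_map :: "(complex ^ (('n::finite + 'n) option) \<Rightarrow> complex) \<Rightarrow> complex ^ (('n + 'n) option) \<Rightarrow> complex ^ ('n option)" where
  "right_map \<Phi> x = (\<chi> i. case i of None \<Rightarrow> x $ None - \<i> * \<Phi> x | Some j \<Rightarrow> x $ Some (Inr j))"

type_synonym ('m, 'n) components = "'m option \<Rightarrow> complex ^ ('n option) \<Rightarrow> complex"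

text \<open>The quadric equation multiplied by 2 \<i>, with the conjugates of Z and W replaced by
  independent functions B.\<close>

definition quadric_eq :: "('m::finite, 'n::finite) components \<Rightarrow> ('m, 'n) components \<Rightarrow> complex ^ ('n option) \<Rightarrow> complex ^ ('n option) \<Rightarrow> complex" where
  "quadric_eq A B p q = A None p - B None q - 2 * \<i> * (\<Sum>j\<in>UNIV. A (Some j) p * B (Some j) q)"

definition left_partial :: "('m::finite, 'n::finite) components \<Rightarrow> ('m, 'n) components \<Rightarrow> 'n option \<Rightarrow> complex ^ ('n option) \<Rightarrow> complex ^ ('n option) \<Rightarrow> complex" where
  "left_partial A B i p q = cpartial i (A None) p - 2 * \<i> * (\<Sum>j\<in>UNIV. cpartial i (A (Some j)) p * B (Some j) q)"

definition right_partial :: "('m::finite, 'n::finite) components \<Rightarrow> ('m, 'n) components \<Rightarrow> 'n option \<Rightarrow> complex ^ ('n option) \<Rightarrow> complex ^ ('n option) \<Rightarrow> complex" where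
  "right_partial A B i p q = - cpartial i (B None) q - 2 * \<i> * (\<Sum>j\<in>UNIV. A (Some j) p * cpartial i (B (Some j)) q)"

text \<open>The \<Delta> of the overview: \<Phi> enters p through w = u + \<i> \<Phi> and q through
  \<tau> = u - \<i> \<Phi>, which produces the factor \<i> and the opposite signs.\<close>

definition normal_partial :: "('m::finite, 'n::finite) components \<Rightarrow> ('m, 'n) components \<Rightarrow> complex ^ ('n option) \<Rightarrow> complex ^ ('n option) \<Rightarrow> complex" where
  "normal_partial A B p q = \<i> * (left_partial A B None p q - right_partial A B None p q)"

definition along_left :: "('n + 'n) option \<Rightarrow> ('n \<Rightarrow> complex) \<Rightarrow> complex" where
  "along_left d h = (case d of Some (Inl j) \<Rightarrow> h j | _ \<Rightarrow> 0)"

definition along_right :: "('n + 'n) option \<Rightarrow> ('n \<Rightarrow> complex) \<Rightarrow> complex" where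
  "along_right d h = (case d of Some (Inr j) \<Rightarrow> h j | _ \<Rightarrow> 0)"

lemma sum_along:
  fixes h :: "'n::finite \<Rightarrow> complex"
  shows "(\<Sum>j\<in>UNIV. of_bool (d = Some (Inl j)) * h j) = along_left d h"
    and "(\<Sum>j\<in>UNIV. of_bool (d = Some (Inr j)) * h j) = along_right d h"
  by (auto simp: along_left_def along_right_def of_bool_def if_distrib[of "\<lambda>y. y * _"] cong: if_cong
      split: option.split sum.split)

text \<open>A and B are related by the equation alone, and no hypersurface is mentioned. The
  formulas derived here are therefore uniform in the embedding and the signature, which enter only
  through A and B.\<close>

locale mapping_equation =
  fixes A B :: "('m::finite, 'n::finite) components" and \<Phi> :: "complex ^ (('n + 'n) option) \<Rightarrow> complex"
    and W :: "(complex ^ (('n + 'n) option)) set" and UA UB :: "(complex ^ ('n option)) set"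
  assumes open_W: "open W" and open_UA: "open UA" and open_UB: "open UB"
    and hol_A: "holomorphic_fun_on (A j) UA" and hol_B: "holomorphic_fun_on (B j) UB"
    and hol_\<Phi>: "holomorphic_fun_on \<Phi> W"
    and left_in: "x \<in> W \<Longrightarrow> left_map \<Phi> x \<in> UA" and right_in: "x \<in> W \<Longrightarrow> right_map \<Phi> x \<in> UB"
    and quadric_eq_0: "x \<in> W \<Longrightarrow> quadric_eq A B (left_map \<Phi> x) (right_map \<Phi> x) = 0"

lemma sum_option:
  fixes h :: "'a::finite option \<Rightarrow> complex"
  shows "(\<Sum>i\<in>UNIV. h i) = h None + (\<Sum>j\<in>UNIV. h (Some j))"
  unfolding UNIV_option_conv by (subst sum.insert) (auto simp: sum.reindex)

context mapping_equation
begin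

lemma DERIV_left_right:
  assumes x: "x \<in> W"
  shows "holomorphic_fun_on f UA \<Longrightarrow> ((\<lambda>t. f (left_map \<Phi> (x + axis d t))) has_field_derivative
      (of_bool (d = None) + \<i> * cpartial d \<Phi> x) * cpartial None f (left_map \<Phi> x)
      + along_left d (\<lambda>j. cpartial (Some j) f (left_map \<Phi> x))) (at 0)" (is "_ \<Longrightarrow> ?L")
    and "holomorphic_fun_on f UB \<Longrightarrow> ((\<lambda>t. f (right_map \<Phi> (x + axis d t))) has_field_derivative
      (of_bool (d = None) - \<i> * cpartial d \<Phi> x) * cpartial None f (right_map \<Phi> x)
      + along_right d (\<lambda>j. cpartial (Some j) f (right_map \<Phi> x))) (at 0)" (is "_ \<Longrightarrow> ?R")
proof -
  let ?v = "cpartial d \<Phi> x"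
  have \<Phi>: "((\<lambda>t. \<Phi> (x + axis d t)) has_field_derivative ?v) (at 0)"
    by (rule has_field_derivative_axis[OF hol_\<Phi> x])
  have ax: "((\<lambda>t. (x + axis d t) $ k) has_field_derivative of_bool (d = k)) (at 0)" for k
    by (cases "k = d") (auto simp: axis_def intro!: derivative_eq_intros)
  define wl where "wl = (\<chi> i. case i of None \<Rightarrow> of_bool (d = None) + \<i> * ?v | Some j \<Rightarrow> of_bool (d = Some (Inl j)))"
  define wr where "wr = (\<chi> i. case i of None \<Rightarrow> of_bool (d = None) - \<i> * ?v | Some j \<Rightarrow> of_bool (d = Some (Inr j)))"
  have "((\<lambda>t. left_map \<Phi> (x + axis d t) $ i) has_field_derivative wl $ i) (at 0)" for i
    unfolding left_map_def wl_def using ax \<Phi> by (cases i) (auto intro!: derivative_eq_intros simp del: vector_add_component)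
  then have l: "((\<lambda>t. left_map \<Phi> (x + axis d t)) has_derivative (\<lambda>s. s *s wl)) (at 0)"
    by (intro has_derivative_vec_componentwise) (simp add: has_field_derivative_def mult_commute_abs)
  have "((\<lambda>t. right_map \<Phi> (x + axis d t) $ i) has_field_derivative wr $ i) (at 0)" for i
    unfolding right_map_def wr_def using ax \<Phi> by (cases i) (auto intro!: derivative_eq_intros simp del: vector_add_component)
  then have r: "((\<lambda>t. right_map \<Phi> (x + axis d t)) has_derivative (\<lambda>s. s *s wr)) (at 0)"
    by (intro has_derivative_vec_componentwise) (simp add: has_field_derivative_def mult_commute_abs)
  show ?L if "holomorphic_fun_on f UA"
    using has_derivative_compose_line[OF that l] left_in[OF x] by (simp add: cderiv_def sum_option wl_def sum_along)
  show ?R if "holomorphic_fun_on f UB"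
    using has_derivative_compose_line[OF that r] right_in[OF x] by (simp add: cderiv_def sum_option wr_def sum_along)
qed

lemma eventually_axis_in_W:
  assumes "x \<in> W" shows "eventually (\<lambda>t. x + axis d t \<in> W) (nhds 0)"
proof -
  have "open ((\<lambda>t. x + axis d t) -` W)"
    by (intro open_vimage continuous_intros continuous_on_axis open_W)
  moreover have "0 \<in> (\<lambda>t. x + axis d t) -` W" using assms by simp
  ultimately have "eventually (\<lambda>t. t \<in> (\<lambda>t. x + axis d t) -` W) (nhds 0)"
    by (rule eventually_nhds_in_open)
  then show ?thesis by simp
qed

text \<open>Implicit differentiation of an identity on W: the terms with
  \<open>cpartial d \<Phi> x\<close> collect to the normal derivative, and the explicit dependence
  on the variable d goes to the right.\<close>

lemma derived_mapping_equation:
  assumes x: "x \<in> W"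
  defines "p \<equiv> left_map \<Phi> x" and "q \<equiv> right_map \<Phi> x"
  shows "cpartial d \<Phi> x * normal_partial A B p q =
    - (of_bool (d = None) * (left_partial A B None p q + right_partial A B None p q)
       + along_left d (\<lambda>j. left_partial A B (Some j) p q)
       + along_right d (\<lambda>j. right_partial A B (Some j) p q))"
proof -
  let ?v = "cpartial d \<Phi> x"
  define a where "a k = (of_bool (d = None) + \<i> * ?v) * cpartial None (A k) p
      + along_left d (\<lambda>j. cpartial (Some j) (A k) p)" for k
  define b where "b k = (of_bool (d = None) - \<i> * ?v) * cpartial None (B k) q
      + along_right d (\<lambda>j. cpartial (Some j) (B k) q)" for k
  have dA: "((\<lambda>t. A k (left_map \<Phi> (x + axis d t))) has_field_derivative a k) (at 0)" for k
    unfolding a_def p_def by (rule DERIV_left_right(1)[OF x hol_A])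
  have dB: "((\<lambda>t. B k (right_map \<Phi> (x + axis d t))) has_field_derivative b k) (at 0)" for k
    unfolding b_def q_def by (rule DERIV_left_right(2)[OF x hol_B])
  have "((\<lambda>t. quadric_eq A B (left_map \<Phi> (x + axis d t)) (right_map \<Phi> (x + axis d t))) has_field_derivative
      a None - b None - 2 * \<i> * (\<Sum>j\<in>UNIV. a (Some j) * B (Some j) q + A (Some j) p * b (Some j))) (at 0)"
    unfolding quadric_eq_def p_def q_def
    by (rule derivative_eq_intros dA dB refl | simp)+ (simp add: mult.commute)
  moreover have "((\<lambda>t. quadric_eq A B (left_map \<Phi> (x + axis d t)) (right_map \<Phi> (x + axis d t))) has_field_derivative 0) (at 0)"
  proof (rule DERIV_cong_ev[THEN iffD1, OF refl _ refl DERIV_const])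
    show "eventually (\<lambda>t. 0 = quadric_eq A B (left_map \<Phi> (x + axis d t)) (right_map \<Phi> (x + axis d t))) (nhds 0)"
      using eventually_axis_in_W[OF x, of d] by eventually_elim (simp add: quadric_eq_0)
  qed
  ultimately have 0: "a None - b None - 2 * \<i> * (\<Sum>j\<in>UNIV. a (Some j) * B (Some j) q + A (Some j) p * b (Some j)) = 0"
    by (rule DERIV_unique)
  \<comment> \<open>The differentiated equation splits into the contribution of A, here, and that of
    B, next; these combine derivatives in p and in q respectively.\<close>
  have 1: "a None - 2 * \<i> * (\<Sum>j\<in>UNIV. a (Some j) * B (Some j) q) = (of_bool (d = None) + \<i> * ?v) * left_partial A B None p q
      + along_left d (\<lambda>j. left_partial A B (Some j) p q)"
    by (cases d; (case_tac "the d")?)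
       (auto simp: a_def left_partial_def along_left_def algebra_simps sum_distrib_left sum.distrib sum_subtractf sum_negf
             split: option.splits sum.splits)
  have 2: "- b None - 2 * \<i> * (\<Sum>j\<in>UNIV. A (Some j) p * b (Some j)) = (of_bool (d = None) - \<i> * ?v) * right_partial A B None p q
      + along_right d (\<lambda>j. right_partial A B (Some j) p q)"
    by (cases d; (case_tac "the d")?)
       (auto simp: b_def right_partial_def along_right_def algebra_simps sum_distrib_left sum.distrib sum_subtractf sum_negf
             split: option.splits sum.splits)
  have "(of_bool (d = None) + \<i> * ?v) * left_partial A B None p q
      + along_left d (\<lambda>j. left_partial A B (Some j) p q)
      + ((of_bool (d = None) - \<i> * ?v) * right_partial A B None p q
      + along_right d (\<lambda>j. right_partial A B (Some j) p q)) = 0"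
    unfolding 1[symmetric] 2[symmetric] using 0 by (simp add: sum.distrib algebra_simps)
  then show ?thesis unfolding normal_partial_def by (simp add: algebra_simps eq_neg_iff_add_eq_0)
qed

end

section \<open>Derivatives of the graph function as universal polynomials\<close>

text \<open>Indeterminates for the jets of A and B, and \<open>Recip\<close> for 1/\<Delta>, which
  trades division for a single additional variable.\<close>

datatype 'j param = Hol 'j nat nat | Anti 'j nat nat | Recip

definition param_value :: "'n::finite \<Rightarrow> ('m::finite, 'n) components \<Rightarrow> ('m, 'n) components \<Rightarrow>
    (complex ^ (('n + 'n) option) \<Rightarrow> complex) \<Rightarrow> complex ^ (('n + 'n) option) \<Rightarrow> 'm option param \<Rightarrow> complex" where
  "param_value j0 A B \<Phi> x p = (case p of
      Hol k b c \<Rightarrow> jet j0 b c (A k) (left_map \<Phi> x)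
    | Anti k b c \<Rightarrow> jet j0 b c (B k) (right_map \<Phi> x)
    | Recip \<Rightarrow> inverse (normal_partial A B (left_map \<Phi> x) (right_map \<Phi> x)))"

definition jet_params :: "nat \<Rightarrow> 'j param set" where
  "jet_params n = (\<lambda>(k, b, c). Hol k b c) ` (UNIV \<times> {..n} \<times> {..n}) \<union> (\<lambda>(k, b, c). Anti k b c) ` (UNIV \<times> {..n} \<times> {..n})"

lemma jet_params_iff [simp]:
  "Hol k b c \<in> jet_params n \<longleftrightarrow> b \<le> n \<and> c \<le> n"
  "Anti k b c \<in> jet_params n \<longleftrightarrow> b \<le> n \<and> c \<le> n"
  "Recip \<notin> jet_params n"
  by (force simp: jet_params_def image_iff)+

definition params :: "nat \<Rightarrow> 'j param set" where
  "params n = insert Recip (jet_params n)"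

lemma params_iff [simp]:
  "Hol k b c \<in> params n \<longleftrightarrow> b \<le> n \<and> c \<le> n"
  "Anti k b c \<in> params n \<longleftrightarrow> b \<le> n \<and> c \<le> n"
  "Recip \<in> params n"
  by (auto simp: params_def)

lemma params_mono:
  assumes "n \<le> n'"
  shows "params n \<subseteq> params n'"
proof
  fix i :: "'j param" assume "i \<in> params n"
  then show "i \<in> params n'" using assms by (cases i) auto
qed

lemma finite_params: "finite (params n :: 'j::finite param set)"
  by (simp add: params_def jet_params_def)

lemma card_params: "card (params n :: 'j::finite param set) \<le> 2 * CARD('j) * (n + 1)\<^sup>2 + 1"
proof -
  have "card (jet_params n :: 'j param set) \<le> CARD('j) * (n + 1)\<^sup>2 + CARD('j) * (n + 1)\<^sup>2"
    unfolding jet_params_def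
    by (rule order_trans[OF card_Un_le add_mono]; rule order_trans[OF card_image_le])
       (auto simp: card_cartesian_product power2_eq_square)
  then show ?thesis
    unfolding params_def by (intro order_trans[OF card_insert_le_m1]) auto
qed

text \<open>\<open>left_partial\<close> as a polynomial in the indeterminates: (b, c) = (0, 1) is
  the derivative in w, (1, 0) that in z at \<open>j0\<close>.\<close>

definition left_poly :: "nat \<Rightarrow> nat \<Rightarrow> ('m::finite option param \<Rightarrow> complex) \<Rightarrow> complex" where
  "left_poly b c e = e (Hol None b c) - 2 * \<i> * (\<Sum>k\<in>UNIV. e (Hol (Some k) b c) * e (Anti (Some k) 0 0))"

text \<open>The factor \<open>- 1 *\<close> stands for a minus sign so that closure under products
  covers it; likewise in \<open>graph_poly\<close>.\<close>

definition right_poly :: "nat \<Rightarrow> nat \<Rightarrow> ('m::finite option param \<Rightarrow> complex) \<Rightarrow> complex" where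
  "right_poly b c e = - 1 * e (Anti None b c) - 2 * \<i> * (\<Sum>k\<in>UNIV. e (Hol (Some k) 0 0) * e (Anti (Some k) b c))"

definition normal_poly :: "('m::finite option param \<Rightarrow> complex) \<Rightarrow> complex" where
  "normal_poly e = \<i> * (left_poly 0 1 e - right_poly 0 1 e)"

text \<open>\<open>derived_mapping_equation\<close> solved for \<open>cpartial d \<Phi> x\<close> in
  the three directions of interest, with \<open>Recip\<close> in place of division by
  \<Delta>.\<close>

definition graph_poly :: "'n \<Rightarrow> ('n + 'n) option \<Rightarrow> ('m::finite option param \<Rightarrow> complex) \<Rightarrow> complex" where
  "graph_poly j0 d e = - 1 * e Recip * (of_bool (d = None) * (left_poly 0 1 e + right_poly 0 1 e)
      + of_bool (d = Some (Inl j0)) * left_poly 1 0 e + of_bool (d = Some (Inr j0)) * right_poly 1 0 e)"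

lemma poly_fun_left_right:
  assumes "b \<le> n" "c \<le> n"
  shows "poly_fun (jet_params n) (left_poly b c)" "poly_fun (jet_params n) (right_poly b c)"
  unfolding left_poly_def[abs_def] right_poly_def[abs_def] using assms
  by (intro poly_fun_diff poly_fun_mult poly_fun_sum poly_fun_const poly_fun_var; simp)+

lemma jet_params_subset: "jet_params n \<subseteq> params n"
  by (auto simp: params_def)

lemma poly_fun_normal: "poly_fun (jet_params 1) normal_poly"
  unfolding normal_poly_def[abs_def] by (intro poly_fun_diff poly_fun_mult poly_fun_const poly_fun_left_right) auto

lemma poly_fun_graph: "poly_fun (params (Suc n)) (graph_poly j0 d)"
  unfolding graph_poly_def[abs_def]
  by (intro poly_fun_add poly_fun_mult poly_fun_const poly_fun_var
        poly_fun_mono[OF poly_fun_left_right(1) jet_params_subset] poly_fun_mono[OF poly_fun_left_right(2) jet_params_subset]) auto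

locale transverse_mapping_equation = mapping_equation A B \<Phi> W UA UB
  for A B :: "('m::finite, 'n::finite) components" and \<Phi> W UA UB +
  fixes j0 :: 'n
  assumes transverse: "x \<in> W \<Longrightarrow> normal_partial A B (left_map \<Phi> x) (right_map \<Phi> x) \<noteq> 0"
begin

abbreviation "val \<equiv> param_value j0 A B \<Phi>"

lemma left_poly_val:
  "left_poly 0 1 (val x) = left_partial A B None (left_map \<Phi> x) (right_map \<Phi> x)"
  "left_poly 1 0 (val x) = left_partial A B (Some j0) (left_map \<Phi> x) (right_map \<Phi> x)"
  by (simp_all add: left_poly_def left_partial_def param_value_def jet_def)

lemma right_poly_val:
  "right_poly 0 1 (val x) = right_partial A B None (left_map \<Phi> x) (right_map \<Phi> x)"
  "right_poly 1 0 (val x) = right_partial A B (Some j0) (left_map \<Phi> x) (right_map \<Phi> x)"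
  by (simp_all add: right_poly_def right_partial_def param_value_def jet_def)

lemma normal_poly_val: "normal_poly (val x) = normal_partial A B (left_map \<Phi> x) (right_map \<Phi> x)"
  by (simp only: normal_poly_def normal_partial_def left_poly_val right_poly_val)

lemma cpartial_graph_poly:
  assumes "x \<in> W" "d \<in> {None, Some (Inl j0), Some (Inr j0)}"
  shows "cpartial d \<Phi> x = graph_poly j0 d (val x)"
proof -
  let ?p = "left_map \<Phi> x" and ?q = "right_map \<Phi> x"
  have "cpartial d \<Phi> x = inverse (normal_partial A B ?p ?q) * (cpartial d \<Phi> x * normal_partial A B ?p ?q)"
    using transverse[OF assms(1)] by simp
  also have "\<dots> = graph_poly j0 d (val x)"
    unfolding derived_mapping_equation[OF assms(1)] graph_poly_def left_poly_val right_poly_val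
    using assms(2) by (auto simp: along_left_def along_right_def param_value_def algebra_simps)
  finally show ?thesis .
qed

text \<open>Chain rule: direction d moves the last argument and possibly the one at
  \<open>j0\<close>. With \<open>cpartial d \<Phi> x\<close> replaced by \<open>graph_poly\<close>,
  the result is again polynomial in the parameters, with jet indices raised by at most one.\<close>

lemma DERIV_param_value:
  assumes x: "x \<in> W" and d: "d \<in> {None, Some (Inl j0), Some (Inr j0)}"
  shows "((\<lambda>t. val (x + axis d t) (Hol k b c)) has_field_derivative
     (of_bool (d = None) + \<i> * graph_poly j0 d (val x)) * val x (Hol k b (Suc c))
      + of_bool (d = Some (Inl j0)) * val x (Hol k (Suc b) c)) (at 0)"
    and "((\<lambda>t. val (x + axis d t) (Anti k b c)) has_field_derivative
     (of_bool (d = None) - \<i> * graph_poly j0 d (val x)) * val x (Anti k b (Suc c))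
      + of_bool (d = Some (Inr j0)) * val x (Anti k (Suc b) c)) (at 0)"
proof -
  have l: "along_left d (\<lambda>j. cpartial (Some j) (jet j0 b c (A k)) (left_map \<Phi> x))
      = of_bool (d = Some (Inl j0)) * jet j0 (Suc b) c (A k) (left_map \<Phi> x)"
    using d by (auto simp: along_left_def cpartial_jet_Some[OF hol_A open_UA left_in[OF x]])
  have r: "along_right d (\<lambda>j. cpartial (Some j) (jet j0 b c (B k)) (right_map \<Phi> x))
      = of_bool (d = Some (Inr j0)) * jet j0 (Suc b) c (B k) (right_map \<Phi> x)"
    using d by (auto simp: along_right_def cpartial_jet_Some[OF hol_B open_UB right_in[OF x]])
  show "((\<lambda>t. val (x + axis d t) (Hol k b c)) has_field_derivative
     (of_bool (d = None) + \<i> * graph_poly j0 d (val x)) * val x (Hol k b (Suc c))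
      + of_bool (d = Some (Inl j0)) * val x (Hol k (Suc b) c)) (at 0)"
    using DERIV_left_right(1)[OF x holomorphic_jet[OF hol_A[of k] open_UA, of j0 b c], of d]
    unfolding l cpartial_jet_None cpartial_graph_poly[OF x d] by (simp add: param_value_def[of _ _ _ _ _ "Hol _ _ _"])
  show "((\<lambda>t. val (x + axis d t) (Anti k b c)) has_field_derivative
     (of_bool (d = None) - \<i> * graph_poly j0 d (val x)) * val x (Anti k b (Suc c))
      + of_bool (d = Some (Inr j0)) * val x (Anti k (Suc b) c)) (at 0)"
    using DERIV_left_right(2)[OF x holomorphic_jet[OF hol_B[of k] open_UB, of j0 b c], of d]
    unfolding r cpartial_jet_None cpartial_graph_poly[OF x d] by (simp add: param_value_def[of _ _ _ _ _ "Anti _ _ _"])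
qed

end

text \<open>The formal derivative must be the same polynomial for all mapping equations, hence for
  a whole set of curves in the parameter space.\<close>

definition has_poly_derivative ::
    "(complex \<Rightarrow> 'i \<Rightarrow> complex) set \<Rightarrow> 'i set \<Rightarrow> (('i \<Rightarrow> complex) \<Rightarrow> complex) \<Rightarrow> bool" where
  "has_poly_derivative X T f \<longleftrightarrow>
     (\<exists>g. poly_fun T g \<and> (\<forall>\<gamma>\<in>X. ((\<lambda>t. f (\<gamma> t)) has_field_derivative g (\<gamma> 0)) (at 0)))"

text \<open>Sum and product rules reduce the claim to the variables. The inclusion of S in T serves
  the undifferentiated factors of the product rule.\<close>

lemma poly_fun_has_poly_derivative:
  assumes "poly_fun S f" "S \<subseteq> T" "\<And>i. i \<in> S \<Longrightarrow> has_poly_derivative X T (\<lambda>e. e i)"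
  shows "has_poly_derivative X T f"
  using assms(1)
proof induction
  case (poly_fun_const c)
  show ?case unfolding has_poly_derivative_def
    by (intro exI[of _ "\<lambda>_. 0"] conjI poly_fun.poly_fun_const ballI DERIV_const)
next
  case (poly_fun_add f g)
  then obtain f' g' where "poly_fun T f'" "\<forall>\<gamma>\<in>X. ((\<lambda>t. f (\<gamma> t)) has_field_derivative f' (\<gamma> 0)) (at 0)"
    "poly_fun T g'" "\<forall>\<gamma>\<in>X. ((\<lambda>t. g (\<gamma> t)) has_field_derivative g' (\<gamma> 0)) (at 0)"
    unfolding has_poly_derivative_def by blast
  then show ?case unfolding has_poly_derivative_def
    by (intro exI[of _ "\<lambda>e. f' e + g' e"] conjI poly_fun.poly_fun_add ballI DERIV_add) auto
next
  case (poly_fun_mult f g)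
  then obtain f' g' where "poly_fun T f'" "\<forall>\<gamma>\<in>X. ((\<lambda>t. f (\<gamma> t)) has_field_derivative f' (\<gamma> 0)) (at 0)"
    "poly_fun T g'" "\<forall>\<gamma>\<in>X. ((\<lambda>t. g (\<gamma> t)) has_field_derivative g' (\<gamma> 0)) (at 0)"
    unfolding has_poly_derivative_def by blast
  moreover have "poly_fun T f" "poly_fun T g"
    using poly_fun_mult.hyps assms(2) poly_fun_mono by blast+
  ultimately show ?case unfolding has_poly_derivative_def
    by (intro exI[of _ "\<lambda>e. f' e * g e + g' e * f e"] conjI poly_fun.poly_fun_add poly_fun.poly_fun_mult ballI DERIV_mult) auto
qed (rule assms(3))

definition param_curves :: "'n::finite \<Rightarrow> ('n + 'n) option \<Rightarrow> (complex \<Rightarrow> 'm::finite option param \<Rightarrow> complex) set" where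
  "param_curves j0 d = {(\<lambda>t. param_value j0 A B \<Phi> (x + axis d t)) |A B \<Phi> W UA UB x.
      transverse_mapping_equation A B \<Phi> W UA UB \<and> x \<in> W}"

context
  fixes j0 :: "'n::finite" and d :: "('n + 'n) option"
  assumes d: "d \<in> {None, Some (Inl j0), Some (Inr j0)}"
begin

lemma jet_param_has_poly_derivative:
  assumes "i \<in> jet_params n"
  shows "has_poly_derivative (param_curves j0 d :: (complex \<Rightarrow> 'm::finite option param \<Rightarrow> complex) set) (params (Suc n)) (\<lambda>e. e i)"
proof (cases i)
  case (Hol k b c)
  show ?thesis
    unfolding has_poly_derivative_def
  proof (intro exI conjI ballI)
    show "poly_fun (params (Suc n)) (\<lambda>e. (of_bool (d = None) + \<i> * graph_poly j0 d e) * e (Hol k b (Suc c))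
      + of_bool (d = Some (Inl j0)) * e (Hol k (Suc b) c))"
      using assms unfolding Hol
      by (intro poly_fun_add poly_fun_mult poly_fun_const poly_fun_var poly_fun_graph) auto
    fix \<gamma> :: "complex \<Rightarrow> 'm option param \<Rightarrow> complex" assume "\<gamma> \<in> param_curves j0 d"
    then obtain A B \<Phi> W UA UB x where \<gamma>: "\<gamma> = (\<lambda>t. param_value j0 A B \<Phi> (x + axis d t))" "x \<in> W"
      and t: "transverse_mapping_equation A B \<Phi> W UA UB"
      unfolding param_curves_def by blast
    interpret transverse_mapping_equation A B \<Phi> W UA UB j0 by (rule t)
    show "((\<lambda>t. \<gamma> t i) has_field_derivative (of_bool (d = None) + \<i> * graph_poly j0 d (\<gamma> 0)) * \<gamma> 0 (Hol k b (Suc c))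
      + of_bool (d = Some (Inl j0)) * \<gamma> 0 (Hol k (Suc b) c)) (at 0)"
      using DERIV_param_value(1)[OF \<gamma>(2) d] by (simp add: \<gamma>(1) Hol)
  qed
next
  case (Anti k b c)
  show ?thesis
    unfolding has_poly_derivative_def
  proof (intro exI conjI ballI)
    show "poly_fun (params (Suc n)) (\<lambda>e. (of_bool (d = None) - \<i> * graph_poly j0 d e) * e (Anti k b (Suc c))
      + of_bool (d = Some (Inr j0)) * e (Anti k (Suc b) c))"
      using assms unfolding Anti
      by (intro poly_fun_add poly_fun_diff poly_fun_mult poly_fun_const poly_fun_var poly_fun_graph) auto
    fix \<gamma> :: "complex \<Rightarrow> 'm option param \<Rightarrow> complex" assume "\<gamma> \<in> param_curves j0 d"
    then obtain A B \<Phi> W UA UB x where \<gamma>: "\<gamma> = (\<lambda>t. param_value j0 A B \<Phi> (x + axis d t))" "x \<in> W"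
      and t: "transverse_mapping_equation A B \<Phi> W UA UB"
      unfolding param_curves_def by blast
    interpret transverse_mapping_equation A B \<Phi> W UA UB j0 by (rule t)
    show "((\<lambda>t. \<gamma> t i) has_field_derivative (of_bool (d = None) - \<i> * graph_poly j0 d (\<gamma> 0)) * \<gamma> 0 (Anti k b (Suc c))
      + of_bool (d = Some (Inr j0)) * \<gamma> 0 (Anti k (Suc b) c)) (at 0)"
      using DERIV_param_value(2)[OF \<gamma>(2) d] by (simp add: \<gamma>(1) Anti)
  qed
qed (use assms in simp)

text \<open>The new case is \<open>Recip\<close>, with derivative -(1/\<Delta>)^2 \<Delta>'. As
  \<Delta> contains jets with indices up to 1, \<Delta>' needs indices up to 2, which explains the
  offsets \<open>Suc n\<close> and \<open>Suc (Suc n)\<close>.\<close>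

lemma param_has_poly_derivative:
  assumes "i \<in> params (Suc n)"
  shows "has_poly_derivative (param_curves j0 d :: (complex \<Rightarrow> 'm::finite option param \<Rightarrow> complex) set) (params (Suc (Suc n))) (\<lambda>e. e i)"
proof (cases "i = Recip")
  case False
  then show ?thesis using assms jet_param_has_poly_derivative[of i "Suc n"] by (simp add: params_def)
next
  case True
  have "has_poly_derivative (param_curves j0 d :: (complex \<Rightarrow> 'm option param \<Rightarrow> complex) set) (params (Suc (Suc 0))) normal_poly"
  proof (rule poly_fun_has_poly_derivative[OF poly_fun_normal])
    show "jet_params 1 \<subseteq> (params (Suc (Suc 0)) :: 'm option param set)"
      using jet_params_subset params_mono[of 1 "Suc (Suc 0)"] by force
    fix i :: "'m option param" assume "i \<in> jet_params 1"
    then show "has_poly_derivative (param_curves j0 d) (params (Suc (Suc 0))) (\<lambda>e. e i)"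
      using jet_param_has_poly_derivative[of i 1] by simp
  qed
  then obtain g where g: "poly_fun (params (Suc (Suc 0))) g"
    "\<And>\<gamma>. \<gamma> \<in> (param_curves j0 d :: (complex \<Rightarrow> 'm option param \<Rightarrow> complex) set) \<Longrightarrow>
       ((\<lambda>t. normal_poly (\<gamma> t)) has_field_derivative g (\<gamma> 0)) (at 0)"
    unfolding has_poly_derivative_def by blast
  show ?thesis
    unfolding has_poly_derivative_def
  proof (intro exI conjI ballI)
    show "poly_fun (params (Suc (Suc n))) (\<lambda>e. - 1 * (e Recip * (e Recip * g e)))"
      by (intro poly_fun_mult poly_fun_const poly_fun_var poly_fun_mono[OF g(1) params_mono]) auto
    fix \<gamma> :: "complex \<Rightarrow> 'm option param \<Rightarrow> complex" assume \<gamma>X: "\<gamma> \<in> param_curves j0 d"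
    then obtain A B \<Phi> W UA UB x where \<gamma>: "\<gamma> = (\<lambda>t. param_value j0 A B \<Phi> (x + axis d t))" "x \<in> W"
      and t: "transverse_mapping_equation A B \<Phi> W UA UB"
      unfolding param_curves_def by blast
    interpret transverse_mapping_equation A B \<Phi> W UA UB j0 by (rule t)
    have R: "\<gamma> t Recip = inverse (normal_poly (\<gamma> t))" for t
      by (simp add: \<gamma>(1) normal_poly_val) (simp add: param_value_def)
    have nz: "normal_poly (\<gamma> 0) \<noteq> 0" using transverse[OF \<gamma>(2)] by (simp add: \<gamma>(1) normal_poly_val)
    show "((\<lambda>t. \<gamma> t i) has_field_derivative - 1 * (\<gamma> 0 Recip * (\<gamma> 0 Recip * g (\<gamma> 0)))) (at 0)"
      unfolding True R using DERIV_inverse_fun[OF g(2)[OF \<gamma>X] nz]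
      by (simp add: mult.assoc mult.left_commute mult.commute power2_eq_square)
  qed
qed

end

text \<open>The polynomial is chosen before A, B and \<Phi>, so it depends only on the list and
  \<open>j0\<close>. The induction starts at one derivative, since the differentiated equation gives
  no formula for the value of \<Phi> itself.\<close>

lemma iterated_partials_universal:
  assumes "L \<noteq> []" "set L \<subseteq> {None, Some (Inl j0), Some (Inr j0)}"
  shows "\<exists>p. poly_fun (params (length L)) p \<and> (\<forall>(A :: ('m::finite, 'n::finite) components) B \<Phi> W UA UB x.
      transverse_mapping_equation A B \<Phi> W UA UB \<longrightarrow> x \<in> W \<longrightarrow>
      foldr cpartial L \<Phi> x = p (param_value j0 A B \<Phi> x))"
  using assms
proof (induction L)
  case (Cons d L)
  have d: "d \<in> {None, Some (Inl j0), Some (Inr j0)}" using Cons.prems by simp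
  show ?case
  proof (cases "L = []")
    case True
    show ?thesis
    proof (intro exI conjI allI impI)
      show "poly_fun (params (length (d # L))) (graph_poly j0 d)" using poly_fun_graph[of 0] by (simp add: True)
      fix A :: "('m, 'n) components" and B \<Phi> W UA UB x
      assume "transverse_mapping_equation A B \<Phi> W UA UB" "x \<in> W"
      then interpret transverse_mapping_equation A B \<Phi> W UA UB j0 by simp
      show "foldr cpartial (d # L) \<Phi> x = graph_poly j0 d (param_value j0 A B \<Phi> x)"
        using cpartial_graph_poly[OF \<open>x \<in> W\<close> d] by (simp add: True)
    qed
  next
    case False
    then obtain n where n: "length L = Suc n" by (cases L) auto
    have "set L \<subseteq> {None, Some (Inl j0), Some (Inr j0)}" using Cons.prems by simp
    from Cons.IH[OF False this] obtain p where p0: "poly_fun (params (Suc n)) p \<and>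
      (\<forall>(A :: ('m, 'n) components) B \<Phi> W UA UB x. transverse_mapping_equation A B \<Phi> W UA UB \<longrightarrow> x \<in> W \<longrightarrow>
        foldr cpartial L \<Phi> x = p (param_value j0 A B \<Phi> x))" unfolding n by (elim exE)
    note p = conjunct1[OF p0] conjunct2[OF p0, rule_format]
    have "has_poly_derivative (param_curves j0 d :: (complex \<Rightarrow> 'm option param \<Rightarrow> complex) set) (params (Suc (Suc n))) p"
      by (rule poly_fun_has_poly_derivative[OF p(1) params_mono param_has_poly_derivative[OF d]]) auto
    then obtain g where g: "poly_fun (params (Suc (Suc n))) g"
      "\<And>\<gamma>. \<gamma> \<in> (param_curves j0 d :: (complex \<Rightarrow> 'm option param \<Rightarrow> complex) set) \<Longrightarrow>
         ((\<lambda>t. p (\<gamma> t)) has_field_derivative g (\<gamma> 0)) (at 0)"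
      unfolding has_poly_derivative_def by blast
    show ?thesis
    proof (intro exI conjI allI impI)
      show "poly_fun (params (length (d # L))) g" using g(1) by (simp add: n)
      fix A :: "('m, 'n) components" and B \<Phi> W UA UB x
      assume t: "transverse_mapping_equation A B \<Phi> W UA UB" and x: "x \<in> W"
      interpret transverse_mapping_equation A B \<Phi> W UA UB j0 by (rule t)
      \<comment> \<open>The formula for L holds on the open set W and may be differentiated there,
        which leads to a curve of \<open>param_curves\<close>.\<close>
      have "foldr cpartial (d # L) \<Phi> x = cpartial d (\<lambda>y. p (val y)) x"
        by simp (rule cpartial_cong_open[OF open_W x p(2)[OF t]])
      also have "\<dots> = g (val x)"
      proof -
        have "(\<lambda>t. val (x + axis d t)) \<in> param_curves j0 d" unfolding param_curves_def using t x by blast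
        from DERIV_imp_deriv[OF g(2)[OF this]] show ?thesis by (simp add: cpartial_def)
      qed
      finally show "foldr cpartial (d # L) \<Phi> x = g (param_value j0 A B \<Phi> x)" .
    qed
  qed
qed simp

section \<open>The universal operator\<close>

text \<open>Multi-indices in u and in z, a at \<open>j0\<close>, each entry below K. Leaving out the
  zero index excludes the value of the function itself, as shift invariance demands.\<close>

definition jet_box :: "'n \<Rightarrow> nat \<Rightarrow> (('n + 'n) option \<Rightarrow> nat) set" where
  "jet_box j0 K = (\<lambda>(a, b, c). (\<lambda>_. 0)(None := a, Some (Inl j0) := b, Some (Inr j0) := c)) `
     ({..<K} \<times> {..<K} \<times> {..<K} - {(0, 0, 0)})"

lemma finite_jet_box: "finite (jet_box j0 K)"
  by (simp add: jet_box_def)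

lemma card_jet_box:
  assumes K: "K > 0"
  shows "card (jet_box j0 K) = K ^ 3 - 1"
proof -
  have "inj (\<lambda>(a, b, c). (\<lambda>_. 0 :: nat)(None := a, Some (Inl j0) := b, Some (Inr j0) := c))"
  proof (rule injI)
    fix x y :: "nat \<times> nat \<times> nat"
    obtain a b c a' b' c' where xy: "x = (a, b, c)" "y = (a', b', c')" by (metis prod_cases3)
    assume "(\<lambda>(a, b, c). (\<lambda>_. 0 :: nat)(None := a, Some (Inl j0) := b, Some (Inr j0) := c)) x
      = (\<lambda>(a, b, c). (\<lambda>_. 0)(None := a, Some (Inl j0) := b, Some (Inr j0) := c)) y"
    then have *: "(\<lambda>_. 0 :: nat)(None := a, Some (Inl j0) := b, Some (Inr j0) := c)
      = (\<lambda>_. 0)(None := a', Some (Inl j0) := b', Some (Inr j0) := c')" by (simp only: xy prod.case)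
    from fun_cong[OF *, of None] fun_cong[OF *, of "Some (Inl j0)"] fun_cong[OF *, of "Some (Inr j0)"]
    show "x = y" by (simp add: xy)
  qed
  then show ?thesis
    using K unfolding jet_box_def
    by (subst card_image[OF inj_on_subset]) (auto simp: card_Diff_singleton power3_eq_cube)
qed

lemma jet_box_props:
  fixes j0 :: "'n::finite"
  assumes "\<alpha> \<in> jet_box j0 K"
  shows "{i. \<alpha> i \<noteq> 0} \<subseteq> {None, Some (Inl j0), Some (Inr j0)}" "1 \<le> jet_order \<alpha>" "jet_order \<alpha> \<le> 3 * K"
proof -
  obtain a b c where \<alpha>: "\<alpha> = (\<lambda>_. 0)(None := a, Some (Inl j0) := b, Some (Inr j0) := c)"
    and abc: "a < K" "b < K" "c < K" "(a, b, c) \<noteq> (0, 0, 0)"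
  proof -
    from assms obtain t where "\<alpha> = (\<lambda>(a, b, c). (\<lambda>_. 0)(None := a, Some (Inl j0) := b, Some (Inr j0) := c)) t"
      "t \<in> {..<K} \<times> {..<K} \<times> {..<K} - {(0, 0, 0)}"
      unfolding jet_box_def by (elim imageE)
    then show ?thesis by (cases t) (auto intro!: that)
  qed
  show sub: "{i. \<alpha> i \<noteq> 0} \<subseteq> {None, Some (Inl j0), Some (Inr j0)}" by (auto simp: \<alpha>)
  have "jet_order \<alpha> = (\<Sum>i\<in>{None, Some (Inl j0), Some (Inr j0)}. \<alpha> i)"
    unfolding jet_order_def by (rule sum.mono_neutral_right) (use sub in auto)
  then have "jet_order \<alpha> = a + b + c" by (simp add: \<alpha>)
  then show "1 \<le> jet_order \<alpha>" "jet_order \<alpha> \<le> 3 * K" using abc by auto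
qed

lemma universal_operator:
  obtains l and D :: "(('n::finite + 'n) option) jet_poly"
  where "l \<ge> 1" "jet_poly_of_order l D" "nonzero_op D" "shift_invariant D"
    "\<And>(A :: ('m::finite, 'n) components) B \<Phi> W UA UB x.
       transverse_mapping_equation A B \<Phi> W UA UB \<Longrightarrow> x \<in> W \<Longrightarrow> diff_alg_op D \<Phi> x = 0"
proof -
  obtain j0 :: 'n where True by simp
  define N where "N = CARD('m option)"
  \<comment> \<open>Orders in the box stay below 3 K, so at most 2 N (3 K + 1)^2 + 1 \<le> 32 N K^2
    + 1 parameters occur, against K^3 - 1 = 32 N K^2 + 2 K^2 - 1 derivatives. N counts all
    components of the map, including g.\<close>
  define K where "K = 32 * N + 2"
  define J where "J = jet_box j0 K"
  have "\<forall>\<alpha>\<in>J. \<exists>p. poly_fun (params (3 * K)) p \<and> (\<forall>(A :: ('m, 'n) components) B \<Phi> W UA UB x.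
      transverse_mapping_equation A B \<Phi> W UA UB \<longrightarrow> x \<in> W \<longrightarrow> mixed_partial \<alpha> \<Phi> x = p (param_value j0 A B \<Phi> x))"
  proof
    fix \<alpha> assume "\<alpha> \<in> J"
    note \<alpha> = jet_box_props[OF this[unfolded J_def]]
    obtain L where L: "\<And>f. mixed_partial \<alpha> f = foldr cpartial L f" "set L = {i. \<alpha> i \<noteq> 0}" "length L = jet_order \<alpha>"
      using mixed_partial_as_foldr[of \<alpha>] by blast
    have "L \<noteq> []" using L(3) \<alpha>(2) by auto
    from iterated_partials_universal[OF this \<alpha>(1)[folded L(2)]] obtain p where
      p: "poly_fun (params (length L)) p \<and> (\<forall>(A :: ('m, 'n) components) B \<Phi> W UA UB x.
        transverse_mapping_equation A B \<Phi> W UA UB \<longrightarrow> x \<in> W \<longrightarrow> foldr cpartial L \<Phi> x = p (param_value j0 A B \<Phi> x))"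
      by (elim exE)
    show "\<exists>p. poly_fun (params (3 * K)) p \<and> (\<forall>(A :: ('m, 'n) components) B \<Phi> W UA UB x.
      transverse_mapping_equation A B \<Phi> W UA UB \<longrightarrow> x \<in> W \<longrightarrow> mixed_partial \<alpha> \<Phi> x = p (param_value j0 A B \<Phi> x))"
    proof (intro exI conjI)
      show "poly_fun (params (3 * K)) p"
        by (rule poly_fun_mono[OF conjunct1[OF p] params_mono]) (use \<alpha>(3) L(3) in simp)
      show "\<forall>(A :: ('m, 'n) components) B \<Phi> W UA UB x. transverse_mapping_equation A B \<Phi> W UA UB \<longrightarrow>
          x \<in> W \<longrightarrow> mixed_partial \<alpha> \<Phi> x = p (param_value j0 A B \<Phi> x)"
        unfolding L(1) by (rule conjunct2[OF p])
    qed
  qed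
  from bchoice[OF this] obtain p where p: "\<forall>\<alpha>\<in>J. poly_fun (params (3 * K)) (p \<alpha>) \<and> (\<forall>(A :: ('m, 'n) components) B \<Phi> W UA UB x.
      transverse_mapping_equation A B \<Phi> W UA UB \<longrightarrow> x \<in> W \<longrightarrow> mixed_partial \<alpha> \<Phi> x = p \<alpha> (param_value j0 A B \<Phi> x))"
    by (elim exE)
  have fJ: "finite J" by (simp add: J_def finite_jet_box)
  have count: "card (params (3 * K) :: 'm option param set) < card J"
  proof -
    have "card (params (3 * K) :: 'm option param set) \<le> 2 * N * (3 * K + 1)\<^sup>2 + 1"
      unfolding N_def by (rule card_params)
    also have "\<dots> \<le> 2 * N * (4 * K)\<^sup>2 + 1" by (intro add_mono mult_mono power_mono) (auto simp: K_def)
    also have "\<dots> = 32 * N * K\<^sup>2 + 1" by (simp add: power2_eq_square)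
    also have "\<dots> < 32 * N * K\<^sup>2 + 2 * K\<^sup>2 - 1"
    proof -
      have "2\<^sup>2 \<le> K\<^sup>2" by (intro power_mono) (auto simp: K_def)
      then show ?thesis by simp
    qed
    also have "32 * N * K\<^sup>2 + 2 * K\<^sup>2 = K ^ 3" by (simp add: K_def power2_eq_square power3_eq_cube algebra_simps)
    finally show ?thesis unfolding J_def by (subst card_jet_box) (auto simp: K_def)
  qed
  \<comment> \<open>The relation is an identity in arbitrary parameter values e, so it survives the
    substitution of every \<open>param_value\<close>.\<close>
  obtain d c where c: "\<exists>\<mu>\<in>J \<rightarrow>\<^sub>E {..d}. c \<mu> \<noteq> 0" "\<And>e. (\<Sum>\<mu>\<in>J \<rightarrow>\<^sub>E {..d}. c \<mu> * (\<Prod>\<alpha>\<in>J. p \<alpha> e ^ \<mu> \<alpha>)) = 0"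
    using algebraic_dependence[OF finite_params fJ count, of p] p by blast
  define D where "D = jet_polynomial J d c"
  have coords: "jet_poly_coords D \<subseteq> Jet ` J" unfolding D_def by (rule jet_poly_coords_jet_polynomial[OF fJ])
  show ?thesis
  proof (rule that[of "3 * K" D])
    show "3 * K \<ge> 1" by (simp add: K_def)
    show "jet_poly_of_order (3 * K) D"
      unfolding jet_poly_of_order_def using coords jet_box_props(3)[of _ j0 K] by (auto simp: J_def)
    show "nonzero_op D" unfolding D_def by (rule nonzero_op_jet_polynomial[OF fJ c(1)])
    show "shift_invariant D"
      unfolding shift_invariant_def using coords jet_box_props(2)[of _ j0 K] by (auto simp: J_def)
    fix A :: "('m, 'n) components" and B \<Phi> W UA UB x
    assume t: "transverse_mapping_equation A B \<Phi> W UA UB" "x \<in> W"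
    have "mixed_partial \<alpha> \<Phi> x = p \<alpha> (param_value j0 A B \<Phi> x)" if "\<alpha> \<in> J" for \<alpha>
      using p that t by blast
    then show "diff_alg_op D \<Phi> x = 0"
      unfolding D_def diff_alg_op_jet_polynomial[OF fJ] using c(2)[of "param_value j0 A B \<Phi> x"] by simp
  qed
qed

section \<open>Conjugation and the hyperquadric\<close>

definition cnj_vec :: "complex ^ 'r \<Rightarrow> complex ^ 'r::finite" where
  "cnj_vec p = (\<chi> i. cnj (p $ i))"

lemma bounded_linear_cnj_vec: "bounded_linear cnj_vec"
  unfolding linear_conv_bounded_linear[symmetric]
  by (rule linearI) (simp_all add: cnj_vec_def vec_eq_iff)

text \<open>The derivative is conjugated on both sides, and the two conjugations of a scalar cancel,
  which restores complex linearity.\<close>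

lemma holomorphic_reflection:
  fixes f :: "complex ^ 'r::finite \<Rightarrow> complex"
  assumes "holomorphic_fun_on f U"
  shows "holomorphic_fun_on (\<lambda>q. cnj (f (cnj_vec q))) (cnj_vec -` U)"
  unfolding holomorphic_fun_on_def
proof
  fix q assume "q \<in> cnj_vec -` U"
  then have "(f has_derivative cderiv f (cnj_vec q)) (at (cnj_vec q))"
    by (intro holomorphic_fun_on_imp_has_derivative[OF assms]) simp
  from has_derivative_compose[OF bounded_linear_imp_has_derivative[OF bounded_linear_cnj_vec] this]
  have "((\<lambda>q. cnj (f (cnj_vec q))) has_derivative (\<lambda>v. cnj (cderiv f (cnj_vec q) (cnj_vec v)))) (at q)"
    by (intro has_derivative_cnj)
  moreover have "cnj_vec (c *s v) = cnj c *s cnj_vec v" for c and v :: "complex ^ 'r"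
    by (simp add: cnj_vec_def vec_eq_iff)
  then have "cnj (cderiv f (cnj_vec q) (cnj_vec (c *s v))) = c * cnj (cderiv f (cnj_vec q) (cnj_vec v))" for c v
    by (simp add: cderiv_scaleC)
  ultimately show "\<exists>f'. ((\<lambda>q. cnj (f (cnj_vec q))) has_derivative f') (at q) \<and> (\<forall>c v. f' (c *s v) = c * f' v)"
    by blast
qed

definition sig :: "'m set \<Rightarrow> 'm \<Rightarrow> real" where
  "sig S j = (if j \<in> S then - 1 else 1)"

lemma hyperquadric_iff:
  "q \<in> hyperquadric S \<longleftrightarrow> Im (q $ None) = (\<Sum>j\<in>UNIV. sig S j * (q $ Some j \<bullet> q $ Some j))"
proof -
  have "(\<Sum>j\<in>UNIV. sig S j * (q $ Some j \<bullet> q $ Some j))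
      = (\<Sum>j\<in>S. sig S j * (q $ Some j \<bullet> q $ Some j)) + (\<Sum>j\<in>- S. sig S j * (q $ Some j \<bullet> q $ Some j))"
    by (subst sum.union_disjoint[symmetric]) (auto simp: Compl_partition)
  also have "\<dots> = - (\<Sum>j\<in>S. (norm (q $ Some j))\<^sup>2) + (\<Sum>j\<in>- S. (norm (q $ Some j))\<^sup>2)"
    by (simp add: sig_def dot_square_norm sum_negf)
  finally show ?thesis by (simp add: hyperquadric_def)
qed

text \<open>Differentiating the quadric equation along a curve inside the quadric confines the
  velocity to a real hyperplane.\<close>

lemma real_tangent_space_hyperquadric:
  assumes "v \<in> real_tangent_space (hyperquadric S) q"
  shows "Im (v $ None) = 2 * (\<Sum>j\<in>UNIV. sig S j * (q $ Some j \<bullet> v $ Some j))"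
proof -
  obtain \<gamma> e where \<gamma>: "e > 0" "\<gamma> 0 = q" "\<And>t::real. \<bar>t\<bar> < e \<Longrightarrow> \<gamma> t \<in> hyperquadric S"
    "(\<gamma> has_vector_derivative v) (at 0)"
    using assms unfolding real_tangent_space_def by blast
  let ?h = "\<lambda>t. Im (\<gamma> t $ None) - (\<Sum>j\<in>UNIV. sig S j * (\<gamma> t $ Some j \<bullet> \<gamma> t $ Some j))"
  have comp: "((\<lambda>t. \<gamma> t $ i) has_derivative (\<lambda>t. t *\<^sub>R v $ i)) (at 0)" for i
    using bounded_linear.has_derivative[OF bounded_linear_vec_nth \<gamma>(4)[unfolded has_vector_derivative_def]] by simp
  have "(?h has_derivative (\<lambda>t. Im (t *\<^sub>R v $ None) - (\<Sum>j\<in>UNIV. sig S j *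
      (\<gamma> 0 $ Some j \<bullet> (t *\<^sub>R v $ Some j) + (t *\<^sub>R v $ Some j) \<bullet> \<gamma> 0 $ Some j)))) (at 0)"
    by (intro has_derivative_diff has_derivative_sum has_derivative_mult_right has_derivative_inner has_derivative_Im comp)
  then have "(?h has_derivative (\<lambda>t. (Im (v $ None) - 2 * (\<Sum>j\<in>UNIV. sig S j * (q $ Some j \<bullet> v $ Some j))) * t)) (at 0)"
    by (rule has_derivative_eq_rhs) (simp add: fun_eq_iff \<gamma>(2) algebra_simps sum_distrib_left inner_commute)
  then have "(?h has_field_derivative Im (v $ None) - 2 * (\<Sum>j\<in>UNIV. sig S j * (q $ Some j \<bullet> v $ Some j))) (at 0)"
    unfolding has_field_derivative_def .
  moreover have "(?h has_field_derivative 0) (at 0)"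
  proof (rule DERIV_cong_ev[THEN iffD1, OF refl _ refl DERIV_const])
    have "eventually (\<lambda>t::real. \<bar>t\<bar> < e) (nhds 0)"
      using \<gamma>(1) eventually_nhds_metric[of "\<lambda>t::real. \<bar>t\<bar> < e" 0] by (auto simp: dist_real_def)
    then show "eventually (\<lambda>t. 0 = ?h t) (nhds 0)"
      by eventually_elim (use \<gamma>(3) in \<open>simp add: hyperquadric_iff\<close>)
  qed
  ultimately show ?thesis using DERIV_unique by fastforce
qed

section \<open>Transversality\<close>

definition embed_left :: "(complex ^ ('n::finite option) \<Rightarrow> complex ^ ('m::finite option)) \<Rightarrow> ('m, 'n) components" where
  "embed_left F k p = F p $ k"

text \<open>The conjugate component, made holomorphic in q by reflecting the argument too. The signs
  sit on the \<open>Some\<close> components only, so that \<open>quadric_eq\<close> has one form for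
  every signature.\<close>

definition embed_right :: "'m set \<Rightarrow> (complex ^ ('n::finite option) \<Rightarrow> complex ^ ('m::finite option)) \<Rightarrow> ('m, 'n) components" where
  "embed_right S F k q = (case k of None \<Rightarrow> 1 | Some j \<Rightarrow> of_real (sig S j)) * cnj (F (cnj_vec q) $ k)"

lemma cnj_vec_cnj_vec [simp]: "cnj_vec (cnj_vec p) = p"
  by (simp add: cnj_vec_def vec_eq_iff)

text \<open>On q = cnj p the polarised equation is 2 \<i> times the real equation of the quadric at
  F p.\<close>

lemma quadric_eq_embed:
  assumes "F p \<in> hyperquadric S"
  shows "quadric_eq (embed_left F) (embed_right S F) p (cnj_vec p) = 0"
proof -
  have "(\<Sum>j\<in>UNIV. F p $ Some j * (of_real (sig S j) * cnj (F p $ Some j)))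
      = of_real (\<Sum>j\<in>UNIV. sig S j * (F p $ Some j \<bullet> F p $ Some j))"
    by (simp add: mult.left_commute complex_mult_cnj inner_complex_def power2_eq_square)
  also have "\<dots> = of_real (Im (F p $ None))" using assms unfolding hyperquadric_iff by simp
  finally have *: "(\<Sum>j\<in>UNIV. F p $ Some j * (of_real (sig S j) * cnj (F p $ Some j))) = of_real (Im (F p $ None))" .
  show ?thesis
    unfolding quadric_eq_def embed_left_def embed_right_def cnj_vec_cnj_vec option.case * mult_1
    by (simp add: complex_eq_iff)
qed

lemma has_derivative_holomorphic_map:
  assumes "holomorphic_map_on F U" "p \<in> U"
  shows "(F has_derivative (\<lambda>v. \<chi> k. cderiv (\<lambda>x. F x $ k) p v)) (at p)"
  using assms
  by (intro has_derivative_vec_componentwise)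
     (auto simp: holomorphic_map_on_def intro: holomorphic_fun_on_imp_has_derivative)

text \<open>If the derivative of the mapping equation along \<open>(z, w)\<close> vanished, the range of \<open>dF\<close> would
  lie in the tangent space of the hyperquadric.\<close>

lemma transverse_left_partial_nonzero:
  fixes F :: "complex ^ ('n::finite option) \<Rightarrow> complex ^ ('m::finite option)"
  assumes F: "holomorphic_map_on F U" "p \<in> U" and tr: "transverse_at F (hyperquadric S) p"
  shows "\<exists>i. left_partial (embed_left F) (embed_right S F) i p (cnj_vec p) \<noteq> 0"
proof (rule ccontr)
  assume "\<not> ?thesis"
  then have zero: "left_partial (embed_left F) (embed_right S F) i p (cnj_vec p) = 0" for i by blast
  \<comment> \<open>A real linear functional that vanishes on the tangent vectors of the quadric at
    F p; on the range of dF it is the imaginary part of a combination of the left partial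
    derivatives.\<close>
  define l where "l w = Im (w $ None) - 2 * (\<Sum>j\<in>UNIV. sig S j * (F p $ Some j \<bullet> w $ Some j))" for w :: "complex ^ ('m option)"
  have dF: "frechet_derivative F (at p) = (\<lambda>v. \<chi> k. cderiv (\<lambda>x. F x $ k) p v)"
    by (rule frechet_derivative_at[symmetric, OF has_derivative_holomorphic_map[OF F]])
  have range: "l (frechet_derivative F (at p) v) = 0" for v
  proof -
    let ?w = "frechet_derivative F (at p) v"
    have "0 = (\<Sum>i\<in>UNIV. v $ i * left_partial (embed_left F) (embed_right S F) i p (cnj_vec p))"
      by (simp add: zero)
    also have "\<dots> = ?w $ None - 2 * \<i> * (\<Sum>j\<in>UNIV. of_real (sig S j) * (cnj (F p $ Some j) * ?w $ Some j))"
    proof -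
      have "(\<Sum>i\<in>UNIV. v $ i * (\<Sum>j\<in>UNIV. cpartial i (\<lambda>x. F x $ Some j) p * (of_real (sig S j) * cnj (F p $ Some j))))
        = (\<Sum>j\<in>UNIV. of_real (sig S j) * (cnj (F p $ Some j) * (\<Sum>i\<in>UNIV. v $ i * cpartial i (\<lambda>x. F x $ Some j) p)))"
        unfolding sum_distrib_left by (subst sum.swap) (simp add: ac_simps)
      moreover have "v $ i * left_partial (embed_left F) (embed_right S F) i p (cnj_vec p) = v $ i * cpartial i (\<lambda>x. F x $ None) p
          - 2 * \<i> * (v $ i * (\<Sum>j\<in>UNIV. cpartial i (\<lambda>x. F x $ Some j) p * (of_real (sig S j) * cnj (F p $ Some j))))" for i
        by (simp add: left_partial_def embed_left_def[abs_def] embed_right_def right_diff_distrib)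
      ultimately show ?thesis
        by (simp only: sum_subtractf sum_distrib_left[symmetric]) (simp add: dF cderiv_def)
    qed
    finally have "Im (?w $ None - 2 * \<i> * (\<Sum>j\<in>UNIV. of_real (sig S j) * (cnj (F p $ Some j) * ?w $ Some j))) = 0"
      by simp
    then show ?thesis by (simp add: l_def inner_complex_def)
  qed
  \<comment> \<open>The direction of Im W, on which l takes the value 1.\<close>
  have "axis None \<i> \<in> {v + w |v w. v \<in> real_tangent_space (hyperquadric S) (F p) \<and> w \<in> range (frechet_derivative F (at p))}"
    using tr unfolding transverse_at_def by blast
  then obtain v w where vw: "axis None \<i> = v + w" "v \<in> real_tangent_space (hyperquadric S) (F p)"
    "w \<in> range (frechet_derivative F (at p))" by blast
  have "l v = 0" using real_tangent_space_hyperquadric[OF vw(2)] by (simp add: l_def)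
  moreover have "l w = 0" using vw(3) range by auto
  moreover have "l (v + w) = l v + l w" by (simp add: l_def inner_add_right algebra_simps sum.distrib)
  ultimately have "l (axis None \<i>) = 0" by (simp add: vw(1))
  then show False by (simp add: l_def axis_def)
qed

section \<open>Propagation of the differential equation\<close>

lemma holomorphic_foldr_cpartial:
  "holomorphic_fun_on f U \<Longrightarrow> open U \<Longrightarrow> holomorphic_fun_on (foldr cpartial L f) U"
  by (induction L) (auto intro: holomorphic_cpartial)

lemma foldr_cpartial_cong_open:
  assumes "open U" "\<And>y. y \<in> U \<Longrightarrow> f y = g y"
  shows "x \<in> U \<Longrightarrow> foldr cpartial L f x = foldr cpartial L g x"
  by (induction L arbitrary: x) (auto intro: cpartial_cong_open[OF assms(1)] assms(2))

lemma holomorphic_diff_alg_op: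
  assumes "holomorphic_fun_on f U" "open U"
  shows "holomorphic_fun_on (diff_alg_op P f) U"
proof -
  have "holomorphic_fun_on (\<lambda>x. jet_coord_value f x c) U" for c
  proof (cases c)
    case (Jet \<alpha>)
    obtain L where "\<And>f. mixed_partial \<alpha> f = foldr cpartial L f" using mixed_partial_as_foldr by metis
    then show ?thesis using holomorphic_foldr_cpartial[OF assms] by (simp add: Jet)
  qed (simp add: holomorphic_fun_on_nth)
  then show ?thesis
    unfolding diff_alg_op_def[abs_def]
    by (intro holomorphic_fun_on_sum holomorphic_fun_on_mult holomorphic_fun_on_const
        holomorphic_fun_on_prod holomorphic_fun_on_power)
qed

lemma diff_alg_op_cong_open:
  assumes "open U" "\<And>y. y \<in> U \<Longrightarrow> f y = g y" "x \<in> U"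
  shows "diff_alg_op P f x = diff_alg_op P g x"
proof -
  have "jet_coord_value f x c = jet_coord_value g x c" for c
  proof (cases c)
    case (Jet \<alpha>)
    obtain L where "\<And>f. mixed_partial \<alpha> f = foldr cpartial L f" using mixed_partial_as_foldr by metis
    then show ?thesis using foldr_cpartial_cong_open[OF assms] by (simp add: Jet)
  qed simp
  then show ?thesis by (simp add: diff_alg_op_def)
qed

text \<open>The part of \<open>complexification\<close> that every smaller domain inherits.\<close>

definition extends_graph_fun ::
    "((complex ^ 'n::finite) \<times> real) set \<Rightarrow> ((complex ^ 'n) \<times> real \<Rightarrow> real) \<Rightarrow>
     (complex ^ (('n + 'n) option)) set \<Rightarrow> (complex ^ (('n + 'n) option) \<Rightarrow> complex) \<Rightarrow> bool" where
  "extends_graph_fun V \<phi> \<Omega> \<Psi> \<longleftrightarrow> holomorphic_fun_on \<Psi> \<Omega> \<and>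
     (\<forall>q\<in>V. z_zbar_u q \<in> \<Omega> \<longrightarrow> \<Psi> (z_zbar_u q) = of_real (\<phi> q))"

text \<open>Asking for one extension is enough: for q in an open V any two agree near
  \<open>z_zbar_u q\<close> by \<open>totally_real_slice\<close>.\<close>

definition locally_vanishing ::
    "(('n::finite + 'n) option) jet_poly \<Rightarrow> ((complex ^ 'n) \<times> real) set \<Rightarrow> ((complex ^ 'n) \<times> real \<Rightarrow> real) \<Rightarrow>
     (complex ^ 'n) \<times> real \<Rightarrow> bool" where
  "locally_vanishing D V \<phi> q \<longleftrightarrow> (\<exists>\<Psi> e. e > 0 \<and> extends_graph_fun V \<phi> (ball (z_zbar_u q) e) \<Psi> \<and>
     (\<forall>x\<in>ball (z_zbar_u q) e. diff_alg_op D \<Psi> x = 0))"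

lemma extends_graph_fun_subset:
  "extends_graph_fun V \<phi> \<Omega> \<Psi> \<Longrightarrow> \<Omega>' \<subseteq> \<Omega> \<Longrightarrow> extends_graph_fun V \<phi> \<Omega>' \<Psi>"
  unfolding extends_graph_fun_def by (auto intro: holomorphic_fun_on_subset)

text \<open>Near \<open>z_zbar_u q\<close> the given \<Psi> coincides with the extension witnessing
  \<open>locally_vanishing\<close>, as both equal \<phi> on the slice. So the operator applied to
  \<Psi>, a holomorphic function on the connected \<Omega>, vanishes near one point and hence
  everywhere.\<close>

lemma locally_vanishing_propagates:
  assumes V: "open V" and \<Omega>: "open \<Omega>" "connected \<Omega>" and ext: "extends_graph_fun V \<phi> \<Omega> \<Psi>"
    and q: "q \<in> V" "z_zbar_u q \<in> \<Omega>" and good: "locally_vanishing D V \<phi> q" and x: "x \<in> \<Omega>"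
  shows "diff_alg_op D \<Psi> x = 0"
proof -
  obtain \<Psi>1 e1 where \<Psi>1: "e1 > 0" "extends_graph_fun V \<phi> (ball (z_zbar_u q) e1) \<Psi>1"
    "\<And>x. x \<in> ball (z_zbar_u q) e1 \<Longrightarrow> diff_alg_op D \<Psi>1 x = 0"
    using good unfolding locally_vanishing_def by blast
  obtain e0 where e0: "e0 > 0" "ball (z_zbar_u q) e0 \<subseteq> \<Omega>" using \<Omega>(1) q(2) open_contains_ball by metis
  obtain d where d: "d > 0" "ball q d \<subseteq> V" using V q(1) open_contains_ball by metis
  define e where "e = min e0 e1"
  have e: "e > 0" "ball (z_zbar_u q) e \<subseteq> \<Omega>" "ball (z_zbar_u q) e \<subseteq> ball (z_zbar_u q) e1"
    using e0 \<Psi>1(1) by (auto simp: e_def)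
  note ext' = extends_graph_fun_subset[OF ext e(2)] extends_graph_fun_subset[OF \<Psi>1(2) e(3)]
  have "holomorphic_fun_on (\<lambda>x. \<Psi> x - \<Psi>1 x) (ball (z_zbar_u q) e)"
    using ext' unfolding extends_graph_fun_def by (blast intro: holomorphic_fun_on_diff)
  then obtain e' where e': "e' > 0" "\<And>x. x \<in> ball (z_zbar_u q) e' \<Longrightarrow> \<Psi> x - \<Psi>1 x = 0"
  proof (rule totally_real_slice[OF _ e(1) d(1)])
    fix q' assume "q' \<in> ball q d" "z_zbar_u q' \<in> ball (z_zbar_u q) e"
    then show "\<Psi> (z_zbar_u q') - \<Psi>1 (z_zbar_u q') = 0"
      using ext' d(2) unfolding extends_graph_fun_def by auto
  qed (rule that)
  have "diff_alg_op D \<Psi> y = 0" if y: "y \<in> ball (z_zbar_u q) (min e e')" for y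
  proof -
    have "diff_alg_op D \<Psi> y = diff_alg_op D \<Psi>1 y"
      by (rule diff_alg_op_cong_open[OF open_ball _ y]) (use e' in auto)
    also have "\<dots> = 0" using y e(3) by (intro \<Psi>1(3)) auto
    finally show ?thesis .
  qed
  moreover have "holomorphic_fun_on (diff_alg_op D \<Psi>) \<Omega>"
    using ext \<Omega>(1) unfolding extends_graph_fun_def by (blast intro: holomorphic_diff_alg_op)
  ultimately show ?thesis
    using identity_theorem[OF _ \<Omega> q(2), of "diff_alg_op D \<Psi>" "min e e'" x] e(1) e'(1) x by simp
qed

text \<open>Around each point of V one local complexification on a ball carries the property from
  any slice point over V in that ball to any other; connectedness of V then links q0 to q.\<close>

lemma locally_vanishing_everywhere:
  fixes V :: "((complex ^ 'n::finite) \<times> real) set"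
  assumes V: "open V" "connected V" and \<phi>: "real_analytic_on \<phi> V"
    and q0: "q0 \<in> V" "locally_vanishing D V \<phi> q0" and q: "q \<in> V"
  shows "locally_vanishing D V \<phi> q"
proof (rule connected_induction_simple[where P = "locally_vanishing D V \<phi>", OF V(2) q0(1) q q0(2)])
  fix a assume a: "a \<in> V"
  obtain \<Psi> e where e: "e > 0" and \<Psi>: "holomorphic_fun_on \<Psi> (ball (z_zbar_u a) e)"
    "\<And>q. z_zbar_u q \<in> ball (z_zbar_u a) e \<Longrightarrow> \<Psi> (z_zbar_u q) = of_real (\<phi> q)"
    using real_analytic_local_complexification[OF \<phi> a] by metis
  have ext: "extends_graph_fun V \<phi> (ball (z_zbar_u a) e) \<Psi>"
    unfolding extends_graph_fun_def using \<Psi> by blast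
  define T where "T = V \<inter> z_zbar_u -` ball (z_zbar_u a) e"
  have "locally_vanishing D V \<phi> y" if "x \<in> T" "y \<in> T" "locally_vanishing D V \<phi> x" for x y
  proof -
    have van: "diff_alg_op D \<Psi> w = 0" if "w \<in> ball (z_zbar_u a) e" for w
      by (rule locally_vanishing_propagates[OF V(1) open_ball connected_ball ext _ _ _ that, of x])
         (use \<open>x \<in> T\<close> \<open>locally_vanishing D V \<phi> x\<close> in \<open>auto simp: T_def\<close>)
    have "z_zbar_u y \<in> ball (z_zbar_u a) e" using \<open>y \<in> T\<close> by (simp add: T_def)
    then obtain r where r: "r > 0" "ball (z_zbar_u y) r \<subseteq> ball (z_zbar_u a) e"
      using open_contains_ball[of "ball (z_zbar_u a) e"] by blast
    show ?thesis unfolding locally_vanishing_def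
      by (intro exI[of _ \<Psi>] exI[of _ r] conjI r(1) extends_graph_fun_subset[OF ext r(2)] ballI van subsetD[OF r(2)])
  qed
  moreover have "openin (top_of_set V) T"
  proof -
    have "continuous_on UNIV (z_zbar_u :: (complex ^ 'n) \<times> real \<Rightarrow> _)"
      by (rule linear_continuous_on[OF linear_z_zbar_u[unfolded linear_conv_bounded_linear]])
    then have "open (z_zbar_u -` ball (z_zbar_u a) e)" by (intro open_vimage) auto
    then show ?thesis unfolding T_def by (rule openin_open_Int)
  qed
  moreover have "a \<in> T" using a e by (simp add: T_def)
  ultimately show "\<exists>T. openin (top_of_set V) T \<and> a \<in> T \<and>
      (\<forall>x\<in>T. \<forall>y\<in>T. locally_vanishing D V \<phi> x \<longrightarrow> locally_vanishing D V \<phi> y)" by blast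
qed

section \<open>From the embedding to the complexified mapping equation\<close>

definition graph_point :: "((complex ^ 'n::finite) \<times> real \<Rightarrow> real) \<Rightarrow> (complex ^ 'n) \<times> real \<Rightarrow> complex ^ ('n option)" where
  "graph_point \<phi> q = (\<chi> i. case i of None \<Rightarrow> Complex (snd q) (\<phi> q) | Some j \<Rightarrow> fst q $ j)"

lemma z_u_part_graph_point [simp]: "z_u_part (graph_point \<phi> q) = q"
  by (cases q) (simp add: z_u_part_def graph_point_def vec_eq_iff)

lemma graph_point_in: "q \<in> V \<Longrightarrow> graph_point \<phi> q \<in> graph_hypersurface V \<phi>"
  unfolding graph_hypersurface_def by simp (simp add: graph_point_def)

lemma graph_point_z_u_part:
  assumes "p \<in> graph_hypersurface V \<phi>"
  shows "graph_point \<phi> (z_u_part p) = p"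
proof -
  have "graph_point \<phi> (z_u_part p) $ i = p $ i" for i
    using assms by (cases i) (auto simp: graph_hypersurface_def graph_point_def z_u_part_def complex_eq_iff)
  then show ?thesis by (simp add: vec_eq_iff)
qed

lemma connected_graph_base:
  assumes "connected (graph_hypersurface V \<phi>)"
  shows "connected V"
proof -
  have "continuous_on (graph_hypersurface V \<phi>) z_u_part"
    unfolding z_u_part_def by (intro continuous_intros)
  then have "connected (z_u_part ` graph_hypersurface V \<phi>)" using assms by (rule connected_continuous_image)
  also have "z_u_part ` graph_hypersurface V \<phi> = V"
  proof
    show "z_u_part ` graph_hypersurface V \<phi> \<subseteq> V" by (auto simp: graph_hypersurface_def)
    show "V \<subseteq> z_u_part ` graph_hypersurface V \<phi>"
      using graph_point_in z_u_part_graph_point by (metis image_eqI subsetI)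
  qed
  finally show ?thesis .
qed

lemma left_right_map_slice:
  assumes "\<Phi> (z_zbar_u q) = of_real (\<phi> q)"
  shows "left_map \<Phi> (z_zbar_u q) = graph_point \<phi> q" "right_map \<Phi> (z_zbar_u q) = cnj_vec (graph_point \<phi> q)"
  using assms
  by (auto simp: left_map_def right_map_def graph_point_def cnj_vec_def vec_eq_iff complex_eq_iff split: option.split)

lemma holomorphic_left_right_map:
  assumes "holomorphic_fun_on \<Phi> W"
  shows "holomorphic_map_on (left_map \<Phi>) W" "holomorphic_map_on (right_map \<Phi>) W"
proof -
  have "holomorphic_fun_on (\<lambda>x. left_map \<Phi> x $ i) W" for i
    unfolding left_map_def
    by (cases i) (auto intro!: holomorphic_fun_on_add holomorphic_fun_on_nth holomorphic_fun_on_cmult assms)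
  then show "holomorphic_map_on (left_map \<Phi>) W" by (simp add: holomorphic_map_on_def)
  have "holomorphic_fun_on (\<lambda>x. right_map \<Phi> x $ i) W" for i
    unfolding right_map_def
    by (cases i) (auto intro!: holomorphic_fun_on_diff holomorphic_fun_on_nth holomorphic_fun_on_cmult assms)
  then show "holomorphic_map_on (right_map \<Phi>) W" by (simp add: holomorphic_map_on_def)
qed

lemma continuous_on_holomorphic_map:
  assumes "holomorphic_map_on G W"
  shows "continuous_on W G"
proof -
  have "continuous_on W (\<lambda>x. \<chi> i. G x $ i)"
    using assms unfolding holomorphic_map_on_def
    by (intro continuous_on_vec_lambda holomorphic_fun_on_continuous) auto
  then show ?thesis by simp
qed

text \<open>Suppose \<Delta> = 0. The equation differentiated in u says that the derivatives in w
  and \<tau> add up to 0, while \<Delta> = 0 says that they are equal, so both vanish.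
  Differentiating in the z variables then kills the remaining derivatives in p.\<close>

lemma mapping_equation_imp_transverse:
  assumes me: "mapping_equation A B \<Phi> W UA UB" and x: "x \<in> W"
    and nz: "\<exists>i. left_partial A B i (left_map \<Phi> x) (right_map \<Phi> x) \<noteq> 0"
  shows "normal_partial A B (left_map \<Phi> x) (right_map \<Phi> x) \<noteq> 0"
proof
  interpret mapping_equation A B \<Phi> W UA UB by (rule me)
  let ?p = "left_map \<Phi> x" and ?q = "right_map \<Phi> x"
  assume 0: "normal_partial A B ?p ?q = 0"
  have "left_partial A B None ?p ?q + right_partial A B None ?p ?q = 0"
    using derived_mapping_equation[OF x, of None] by (simp add: 0 along_left_def along_right_def add_eq_0_iff)
  moreover have "left_partial A B None ?p ?q - right_partial A B None ?p ?q = 0"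
    using 0 by (simp add: normal_partial_def)
  ultimately have "left_partial A B None ?p ?q = 0" by algebra
  moreover have "left_partial A B (Some j) ?p ?q = 0" for j
    using derived_mapping_equation[OF x, of "Some (Inl j)"] by (simp add: 0 along_left_def along_right_def)
  ultimately have "left_partial A B i ?p ?q = 0" for i by (cases i) auto
  with nz show False by blast
qed

text \<open>The ball around x0 shrinks in turn so that \<Phi> exists, the two maps land in the
  domains of A and B, the equation holds off the slice, and \<Delta> has no zero.\<close>

lemma embedding_imp_locally_vanishing:
  fixes V :: "((complex ^ 'n::finite) \<times> real) set" and F :: "complex ^ ('n option) \<Rightarrow> complex ^ ('m::finite option)"
  assumes D: "\<And>(A :: ('m::finite, 'n) components) B \<Phi> W UA UB x.
       transverse_mapping_equation A B \<Phi> W UA UB \<Longrightarrow> x \<in> W \<Longrightarrow> diff_alg_op D \<Phi> x = 0"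
    and V: "open V" and \<phi>: "real_analytic_on \<phi> V" and p0: "p0 \<in> graph_hypersurface V \<phi>"
    and emb: "local_transverse_embedding (graph_hypersurface V \<phi>) (hyperquadric S) p0 U F"
  shows "locally_vanishing D V \<phi> (z_u_part p0)"
proof -
  define q0 where "q0 = z_u_part p0"
  define x0 where "x0 = z_zbar_u q0"
  have q0: "q0 \<in> V" using p0 by (simp add: q0_def graph_hypersurface_def)
  have p0': "graph_point \<phi> q0 = p0" unfolding q0_def by (rule graph_point_z_u_part[OF p0])
  have U: "open U" "p0 \<in> U" and F: "holomorphic_map_on F U"
    and FQ: "\<And>p. p \<in> graph_hypersurface V \<phi> \<inter> U \<Longrightarrow> F p \<in> hyperquadric S"
    and tr: "transverse_at F (hyperquadric S) p0"
    using emb unfolding local_transverse_embedding_def holomorphic_embedding_on_def by auto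
  obtain \<Phi> e where e: "e > 0" and \<Phi>: "holomorphic_fun_on \<Phi> (ball x0 e)"
    and \<Phi>\<phi>: "\<And>q. z_zbar_u q \<in> ball x0 e \<Longrightarrow> \<Phi> (z_zbar_u q) = of_real (\<phi> q)"
    using real_analytic_local_complexification[OF \<phi> q0] unfolding x0_def by metis
  define A where "A = embed_left F"
  define B where "B = embed_right S F"
  define UB where "UB = cnj_vec -` U"
  have UB: "open UB" unfolding UB_def
    by (intro open_vimage U(1) linear_continuous_on bounded_linear_cnj_vec)
  have hA: "holomorphic_fun_on (A k) U" for k
    using F unfolding A_def embed_left_def[abs_def] holomorphic_map_on_def by blast
  have hB: "holomorphic_fun_on (B k) UB" for k
    unfolding B_def embed_right_def[abs_def] UB_def
    by (intro holomorphic_fun_on_cmult holomorphic_reflection) (use F in \<open>simp add: holomorphic_map_on_def\<close>)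
  note lr = holomorphic_left_right_map[OF \<Phi>]
  define W0 where "W0 = (ball x0 e \<inter> left_map \<Phi> -` U) \<inter> (ball x0 e \<inter> right_map \<Phi> -` UB)"
  have "open W0" unfolding W0_def
    by (intro open_Int continuous_open_preimage continuous_on_holomorphic_map lr open_ball U(1) UB)
  have x0e: "x0 \<in> ball x0 e" using e by simp
  have lr0: "left_map \<Phi> x0 = p0" "right_map \<Phi> x0 = cnj_vec p0"
    unfolding x0_def p0'[symmetric] by (rule left_right_map_slice, rule \<Phi>\<phi>, use x0e in \<open>simp add: x0_def\<close>)+
  have "x0 \<in> W0" using e U(2) by (simp add: W0_def lr0 UB_def)
  then obtain e1 where e1: "e1 > 0" "ball x0 e1 \<subseteq> W0" using \<open>open W0\<close> open_contains_ball by metis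
  have sub1: "ball x0 e1 \<subseteq> ball x0 e" using e1(2) by (auto simp: W0_def)
  have left1: "left_map \<Phi> x \<in> U" and right1: "right_map \<Phi> x \<in> UB" if "x \<in> ball x0 e1" for x
    using e1(2) that by (auto simp: W0_def)
  have lr1: "holomorphic_map_on (left_map \<Phi>) (ball x0 e1)" "holomorphic_map_on (right_map \<Phi>) (ball x0 e1)"
    by (rule holomorphic_left_right_map[OF holomorphic_fun_on_subset[OF \<Phi> sub1]])+
  note compL = holomorphic_map_on_compose[OF _ lr1(1) left1]
  note compR = holomorphic_map_on_compose[OF _ lr1(2) right1]
  obtain d where d: "d > 0" "ball q0 d \<subseteq> V" using V q0 open_contains_ball by metis
  have "holomorphic_fun_on (\<lambda>x. quadric_eq A B (left_map \<Phi> x) (right_map \<Phi> x)) (ball x0 e1)"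
    unfolding quadric_eq_def
    by (intro holomorphic_fun_on_diff holomorphic_fun_on_cmult holomorphic_fun_on_sum holomorphic_fun_on_mult
        compL[OF hA] compR[OF hB])
  \<comment> \<open>On the slice the equation says that F sends the hypersurface into the quadric;
    \<open>totally_real_slice\<close> extends it to independent z, a, u.\<close>
  then obtain e2 where e2: "e2 > 0" "\<And>x. x \<in> ball x0 e2 \<Longrightarrow> quadric_eq A B (left_map \<Phi> x) (right_map \<Phi> x) = 0"
    unfolding x0_def
  proof (rule totally_real_slice[OF _ e1(1) d(1)])
    fix q assume q: "q \<in> ball q0 d" "z_zbar_u q \<in> ball (z_zbar_u q0) e1"
    have eq: "\<Phi> (z_zbar_u q) = of_real (\<phi> q)" using q(2) sub1 by (intro \<Phi>\<phi>) (auto simp: x0_def)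
    note lrq = left_right_map_slice[where \<Phi> = \<Phi> and \<phi> = \<phi> and q = q, OF eq]
    have "graph_point \<phi> q \<in> graph_hypersurface V \<phi> \<inter> U"
      using graph_point_in[of q V \<phi>] q d(2) left1[of "z_zbar_u q"] by (auto simp: lrq x0_def)
    then show "quadric_eq A B (left_map \<Phi> (z_zbar_u q)) (right_map \<Phi> (z_zbar_u q)) = 0"
      unfolding lrq A_def B_def by (intro quadric_eq_embed FQ)
  qed (rule that; simp add: x0_def)
  define W1 where "W1 = ball x0 (min e1 e2)"
  have W1: "W1 \<subseteq> ball x0 e1" "x0 \<in> W1" using e1 e2 by (auto simp: W1_def)
  \<comment> \<open>Stated for all open subsets of W1 because it serves twice: on W1, to obtain
    \<open>\<Delta> x0 \<noteq> 0\<close>, and on the smaller ball where \<Delta> has no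
    zero.\<close>
  have me: "mapping_equation A B \<Phi> W UA' UB" if "W \<subseteq> W1" "open W" "UA' = U" for W UA'
  proof
    show "open W" "open UA'" "open UB" using that U UB by auto
    show "holomorphic_fun_on (A j) UA'" "holomorphic_fun_on (B j) UB" for j using hA hB that by auto
    show "holomorphic_fun_on \<Phi> W" using \<Phi> sub1 W1 that by (meson holomorphic_fun_on_subset order_trans)
    fix x assume "x \<in> W"
    then have x: "x \<in> ball x0 e1" "x \<in> ball x0 e2" using that W1(1) by (auto simp: W1_def)
    show "left_map \<Phi> x \<in> UA'" "right_map \<Phi> x \<in> UB" using left1[OF x(1)] right1[OF x(1)] that by auto
    show "quadric_eq A B (left_map \<Phi> x) (right_map \<Phi> x) = 0" by (rule e2(2)[OF x(2)])
  qed
  define \<Delta> where "\<Delta> x = normal_partial A B (left_map \<Phi> x) (right_map \<Phi> x)" for x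
  have "\<exists>i. left_partial A B i p0 (cnj_vec p0) \<noteq> 0"
    unfolding A_def B_def by (rule transverse_left_partial_nonzero[OF F U(2) tr])
  then have \<Delta>0: "\<Delta> x0 \<noteq> 0"
    unfolding \<Delta>_def by (intro mapping_equation_imp_transverse[OF me[OF order_refl _ refl] W1(2)]) (auto simp: W1_def lr0)
  have "holomorphic_fun_on \<Delta> (ball x0 e1)"
    unfolding \<Delta>_def normal_partial_def left_partial_def right_partial_def
    by (intro holomorphic_fun_on_diff holomorphic_fun_on_cmult holomorphic_fun_on_sum holomorphic_fun_on_mult
        compL[OF hA] compR[OF hB] compL[OF holomorphic_cpartial[OF hA U(1)]] compR[OF holomorphic_cpartial[OF hB UB]]
        holomorphic_fun_on_cmult[where c = "-1", simplified])
  then have "continuous_on W1 \<Delta>" using W1(1) by (meson continuous_on_subset holomorphic_fun_on_continuous)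
  then have "open (W1 \<inter> \<Delta> -` (- {0}))" by (intro continuous_open_preimage) (auto simp: W1_def)
  moreover have "x0 \<in> W1 \<inter> \<Delta> -` (- {0})" using W1(2) \<Delta>0 by simp
  ultimately obtain e3 where e3: "e3 > 0" "ball x0 e3 \<subseteq> W1 \<inter> \<Delta> -` (- {0})" using open_contains_ball by metis
  have t: "transverse_mapping_equation A B \<Phi> (ball x0 e3) U UB"
    unfolding transverse_mapping_equation_def transverse_mapping_equation_axioms_def
    using me[of "ball x0 e3" U] e3 by (auto simp: \<Delta>_def)
  have "extends_graph_fun V \<phi> (ball x0 e3) \<Phi>"
    unfolding extends_graph_fun_def
  proof (intro conjI ballI impI)
    have sub: "ball x0 e3 \<subseteq> ball x0 e" using e3(2) W1(1) sub1 by blast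
    show "holomorphic_fun_on \<Phi> (ball x0 e3)" by (rule holomorphic_fun_on_subset[OF \<Phi> sub])
    show "\<Phi> (z_zbar_u q) = of_real (\<phi> q)" if "z_zbar_u q \<in> ball x0 e3" for q
      by (rule \<Phi>\<phi>) (rule subsetD[OF sub that])
  qed
  then show ?thesis
    unfolding locally_vanishing_def q0_def[symmetric] x0_def[symmetric]
    using e3(1) D[OF t] by blast
qed

theorem theorem1:
  assumes "CARD('n::finite) < CARD('m::finite)"
  shows "\<exists>(l::nat) (D :: (('n + 'n) option) jet_poly).
    l \<ge> 1 \<and> jet_poly_of_order l D \<and> nonzero_op D \<and> shift_invariant D \<and>
    (\<forall>(V :: ((complex ^ 'n) \<times> real) set) (\<phi> :: (complex ^ 'n) \<times> real \<Rightarrow> real).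
       open V \<longrightarrow> real_analytic_on \<phi> V \<longrightarrow>
       connected (graph_hypersurface V \<phi>) \<longrightarrow>
       (\<exists>p\<in>graph_hypersurface V \<phi>. levi_nondegenerate_at (graph_defining_fun \<phi>) p) \<longrightarrow>
       (\<exists>p0\<in>graph_hypersurface V \<phi>. \<exists>(S :: 'm set) U F.
          local_transverse_embedding (graph_hypersurface V \<phi>) (hyperquadric S) p0 U F) \<longrightarrow>
       diff_alg_op_vanishes D V \<phi>)"
proof -
  obtain l and D :: "(('n + 'n) option) jet_poly" where D: "l \<ge> 1" "jet_poly_of_order l D" "nonzero_op D" "shift_invariant D"
    "\<And>(A :: ('m, 'n) components) B \<Phi> W UA UB x.
       transverse_mapping_equation A B \<Phi> W UA UB \<Longrightarrow> x \<in> W \<Longrightarrow> diff_alg_op D \<Phi> x = 0"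
    by (rule universal_operator) (rule that)
  show ?thesis
  proof (intro exI[of _ l] exI[of _ D] conjI allI impI, rule D(1), rule D(2), rule D(3), rule D(4))
    fix V :: "((complex ^ 'n) \<times> real) set" and \<phi> :: "(complex ^ 'n) \<times> real \<Rightarrow> real"
    assume V: "open V" and \<phi>: "real_analytic_on \<phi> V" and conn: "connected (graph_hypersurface V \<phi>)"
      and "\<exists>p0\<in>graph_hypersurface V \<phi>. \<exists>(S :: 'm set) U F.
          local_transverse_embedding (graph_hypersurface V \<phi>) (hyperquadric S) p0 U F"
    then obtain p0 and S :: "'m set" and U F where p0: "p0 \<in> graph_hypersurface V \<phi>"
      and emb: "local_transverse_embedding (graph_hypersurface V \<phi>) (hyperquadric S) p0 U F" by blast
    have "z_u_part p0 \<in> V" using p0 by (simp add: graph_hypersurface_def)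
    moreover have "locally_vanishing D V \<phi> (z_u_part p0)"
      by (rule embedding_imp_locally_vanishing[OF _ V \<phi> p0 emb]) (rule D(5))
    ultimately have everywhere: "locally_vanishing D V \<phi> q" if "q \<in> V" for q
      using locally_vanishing_everywhere[OF V connected_graph_base[OF conn] \<phi> _ _ that] by blast
    show "diff_alg_op_vanishes D V \<phi>"
      unfolding diff_alg_op_vanishes_def
    proof (intro allI impI ballI)
      fix \<Omega> \<Phi> x assume c: "complexification V \<phi> \<Omega> \<Phi>" and x: "x \<in> \<Omega>"
      \<comment> \<open>A complexification meets the slice over V by definition; the propagation
        over \<Omega> starts at such a point.\<close>
      then obtain q where q: "q \<in> V" "z_zbar_u q \<in> \<Omega>" unfolding complexification_def by blast
      have "open \<Omega>" "connected \<Omega>" "extends_graph_fun V \<phi> \<Omega> \<Phi>"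
        using c unfolding complexification_def extends_graph_fun_def by auto
      then show "diff_alg_op D \<Phi> x = 0"
        by (intro locally_vanishing_propagates[OF V _ _ _ q everywhere[OF q(1)] x])
    qed
  qed
qed

end
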